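(* Let $K$ be a field and let $G$ be a graph with $2n$ vertices, none of which is isolated, and with $\operatorname{height} I(G)=n$. Assume that $V(G)=X\cup Y$ with $X\cap Y=\emptyset$, where $X=\{x_1,\dots,x_n\}$ is a minimal vertex cover of $G$ and $Y=\{y_1,\dots,y_n\}$ is a maximal independent set of $G$ such that $\{x_1y_1,\dots,x_ny_n\}\subset E(G)$. Assume also that $x_iy_j\in E(G)$ implies $i\le j$. Then the following conditions are equivalent: (1) $G$ is Cohen-Macaulay. (2) $G$ is unmixed. (3) The following two conditions hold: (i) for all distinct $i,j,k$ and for $z_i\in\{x_i,y_i\}$, if $z_ix_j,\ y_jx_k\in E(G)$, then $z_ix_k\in E(G)$; (ii) if $x_iy_j\in E(G)$, then $x_ix_j\notin E(G)$.
   Context: All graphs are finite simple graphs (no loops or multiple edges), with vertex set $V(G)$ and edge set $E(G)$. For a field $K$, let $S$ be the polynomial ring over $K$ whose variables are the vertices of $G$; the edge ideal $I(G)\subset S$ is generated by all products $uv$ with $uv\in E(G)$. $G$ is Cohen-Macaulay if $S/I(G)$ is a Cohen-Macaulay ring. A vertex cover of $G$ is a set of vertices meeting every edge; it is minimal if no proper subset is a vertex cover. An independent set is a set of pairwise non-adjacent vertices; maximal means maximal under inclusion. $G$ is unmixed if all its minimal vertex covers have the same cardinality. $\operatorname{height} I(G)$ equals the smallest cardinality of a minimal vertex cover of $G$. *)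

theory Defs
  imports
    "HOL-Algebra.QuotRing"
    "HOL-Algebra.Ring_Divisibility"
    "HOL-Library.Poly_Mapping"
    "HOL-Library.Extended_Nat"
begin

section \<open>Finite simple graphs\<close>

text \<open>A graph is a vertex set together with a set of two-element sets of vertices.\<close>

definition simple_graph :: "'v set \<Rightarrow> 'v set set \<Rightarrow> bool" where
  "simple_graph V E \<longleftrightarrow> finite V \<and> (\<forall>e\<in>E. e \<subseteq> V \<and> card e = 2)"

definition isolated_vertex :: "'v set set \<Rightarrow> 'v \<Rightarrow> bool" where
  "isolated_vertex E v \<longleftrightarrow> (\<forall>e\<in>E. v \<notin> e)"

definition vertex_cover :: "'v set \<Rightarrow> 'v set set \<Rightarrow> 'v set \<Rightarrow> bool" where
  "vertex_cover V E C \<longleftrightarrow> C \<subseteq> V \<and> (\<forall>e\<in>E. e \<inter> C \<noteq> {})"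

definition minimal_vertex_cover :: "'v set \<Rightarrow> 'v set set \<Rightarrow> 'v set \<Rightarrow> bool" where
  "minimal_vertex_cover V E C \<longleftrightarrow> vertex_cover V E C \<and> (\<forall>D. D \<subset> C \<longrightarrow> \<not> vertex_cover V E D)"

definition independent_set :: "'v set \<Rightarrow> 'v set set \<Rightarrow> 'v set \<Rightarrow> bool" where
  "independent_set V E A \<longleftrightarrow> A \<subseteq> V \<and> (\<forall>u\<in>A. \<forall>v\<in>A. {u, v} \<notin> E)"

definition maximal_independent_set :: "'v set \<Rightarrow> 'v set set \<Rightarrow> 'v set \<Rightarrow> bool" where
  "maximal_independent_set V E A \<longleftrightarrow>
    independent_set V E A \<and> (\<forall>B. A \<subset> B \<longrightarrow> \<not> independent_set V E B)"

definition unmixed_graph :: "'v set \<Rightarrow> 'v set set \<Rightarrow> bool" where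
  "unmixed_graph V E \<longleftrightarrow>
    (\<forall>C D. minimal_vertex_cover V E C \<and> minimal_vertex_cover V E D \<longrightarrow> card C = card D)"

section \<open>Krull dimension, height and depth\<close>

definition prime_chain :: "('a, 'b) ring_scheme \<Rightarrow> nat \<Rightarrow> (nat \<Rightarrow> 'a set) \<Rightarrow> bool" where
  "prime_chain R l P \<longleftrightarrow> (\<forall>i\<le>l. primeideal (P i) R) \<and> (\<forall>i<l. P i \<subset> P (Suc i))"

definition krull_dim :: "('a, 'b) ring_scheme \<Rightarrow> enat" where
  "krull_dim R = Sup {enat l |l. \<exists>P. prime_chain R l P}"

definition prime_height :: "('a, 'b) ring_scheme \<Rightarrow> 'a set \<Rightarrow> enat" where
  "prime_height R Q = Sup {enat l |l. \<exists>P. prime_chain R l P \<and> P l = Q}"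

definition ideal_height :: "('a, 'b) ring_scheme \<Rightarrow> 'a set \<Rightarrow> enat" where
  "ideal_height R I = (INF Q\<in>{Q. primeideal Q R \<and> I \<subseteq> Q}. prime_height R Q)"

text \<open>
  The middle condition says that the \<open>i\<close>-th element is a nonzerodivisor modulo the ideal generated
  by the preceding ones.
\<close>

definition regular_sequence :: "('a, 'b) ring_scheme \<Rightarrow> 'a list \<Rightarrow> bool" where
  "regular_sequence R xs \<longleftrightarrow>
    set xs \<subseteq> carrier R \<and>
    (\<forall>i<length xs. \<forall>a\<in>carrier R.
      xs ! i \<otimes>\<^bsub>R\<^esub> a \<in> Idl\<^bsub>R\<^esub> (set (take i xs)) \<longrightarrow> a \<in> Idl\<^bsub>R\<^esub> (set (take i xs))) \<and>
    Idl\<^bsub>R\<^esub> (set xs) \<noteq> carrier R"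

definition depth :: "('a, 'b) ring_scheme \<Rightarrow> 'a set \<Rightarrow> enat" where
  "depth R M = Sup {enat (length xs) |xs. regular_sequence R xs \<and> set xs \<subseteq> M}"

section \<open>Localization at a prime ideal\<close>

definition loc_rel :: "('a, 'b) ring_scheme \<Rightarrow> 'a set \<Rightarrow> (('a \<times> 'a) \<times> ('a \<times> 'a)) set" where
  "loc_rel R P =
    {((a, s), (b, t)) |a s b t.
      a \<in> carrier R \<and> b \<in> carrier R \<and> s \<in> carrier R - P \<and> t \<in> carrier R - P \<and>
      (\<exists>u\<in>carrier R - P. u \<otimes>\<^bsub>R\<^esub> (a \<otimes>\<^bsub>R\<^esub> t) = u \<otimes>\<^bsub>R\<^esub> (b \<otimes>\<^bsub>R\<^esub> s))}"

definition loc_frac :: "('a, 'b) ring_scheme \<Rightarrow> 'a set \<Rightarrow> 'a \<Rightarrow> 'a \<Rightarrow> ('a \<times> 'a) set" where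
  "loc_frac R P a s = loc_rel R P `` {(a, s)}"

definition localization :: "('a, 'b) ring_scheme \<Rightarrow> 'a set \<Rightarrow> ('a \<times> 'a) set ring" where
  "localization R P =
    \<lparr>carrier = (carrier R \<times> (carrier R - P)) // loc_rel R P,
     mult = (\<lambda>A B. \<Union>(a, s)\<in>A. \<Union>(b, t)\<in>B. loc_frac R P (a \<otimes>\<^bsub>R\<^esub> b) (s \<otimes>\<^bsub>R\<^esub> t)),
     one = loc_frac R P \<one>\<^bsub>R\<^esub> \<one>\<^bsub>R\<^esub>,
     zero = loc_frac R P \<zero>\<^bsub>R\<^esub> \<one>\<^bsub>R\<^esub>,
     add = (\<lambda>A B. \<Union>(a, s)\<in>A. \<Union>(b, t)\<in>B.
       loc_frac R P ((a \<otimes>\<^bsub>R\<^esub> t) \<oplus>\<^bsub>R\<^esub> (b \<otimes>\<^bsub>R\<^esub> s)) (s \<otimes>\<^bsub>R\<^esub> t))\<rparr>"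

section \<open>Cohen-Macaulay rings\<close>

definition local_ring :: "('a, 'b) ring_scheme \<Rightarrow> 'a set \<Rightarrow> bool" where
  "local_ring R M \<longleftrightarrow>
    cring R \<and> maximalideal M R \<and> (\<forall>N. maximalideal N R \<longrightarrow> N = M)"

definition cohen_macaulay_local :: "('a, 'b) ring_scheme \<Rightarrow> bool" where
  "cohen_macaulay_local R \<longleftrightarrow>
    noetherian_ring R \<and> (\<exists>M. local_ring R M \<and> depth R M = krull_dim R)"

definition cohen_macaulay_ring :: "('a, 'b) ring_scheme \<Rightarrow> bool" where
  "cohen_macaulay_ring R \<longleftrightarrow>
    cring R \<and> noetherian_ring R \<and>
    (\<forall>M. maximalideal M R \<longrightarrow> cohen_macaulay_local (localization R M))"

section \<open>Edge ideals\<close>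

text \<open>
  A polynomial is a finitely supported map from monomials to coefficients, a monomial being a
  finitely supported exponent function on the vertices. The carrier only admits variables from \<open>V\<close>.
\<close>

type_synonym ('v, 'k) vpoly = "('v \<Rightarrow>\<^sub>0 nat) \<Rightarrow>\<^sub>0 'k"

definition vertex_ring :: "'v set \<Rightarrow> ('v, 'k::field) vpoly ring" where
  "vertex_ring V =
    \<lparr>carrier = {p. \<forall>m\<in>Poly_Mapping.keys p. Poly_Mapping.keys m \<subseteq> V},
     mult = (*), one = 1, zero = 0, add = (+)\<rparr>"

definition vertex_var :: "'v \<Rightarrow> ('v, 'k::field) vpoly" where
  "vertex_var v = Poly_Mapping.single (Poly_Mapping.single v 1) 1"

definition edge_ideal :: "'v set \<Rightarrow> 'v set set \<Rightarrow> ('v, 'k::field) vpoly set" where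
  "edge_ideal V E =
    Idl\<^bsub>vertex_ring V\<^esub> {vertex_var u * vertex_var v |u v. {u, v} \<in> E}"

text \<open>The type argument carries the coefficient field.\<close>

definition cohen_macaulay_graph :: "'k::field itself \<Rightarrow> 'v set \<Rightarrow> 'v set set \<Rightarrow> bool" where
  "cohen_macaulay_graph K V E \<longleftrightarrow>
    cohen_macaulay_ring
      ((vertex_ring V :: ('v, 'k) vpoly ring) Quot (edge_ideal V E :: ('v, 'k) vpoly set))"

end

(*
  Unmixedness and condition (3) are compared through minimal vertex covers, which contain exactly one
  vertex of every edge x_i y_i as soon as they have n elements.

  If (3) holds, the n elements f_i(x_i + y_i) form a regular sequence on S/I(G) for arbitrary nonzero
  univariate polynomials f_i: choosing the smallest undecided index t, the ideal is split into its
  colon ideal by x_t and its sum with x_t; after all pairs are decided there remain the primes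
  generated by one variable of each pair, where the f_i are polynomials in distinct variables. By the
  Nullstellensatz every maximal ideal contains such a sequence, so all its local rings have depth at
  least n, while their dimension is at most n because every prime over I(G) contains n variables.

  Conversely, let D be a minimal vertex cover. The prime generated by D is the annihilator of the
  product of the variables outside D. In a Noetherian local ring a regular sequence of length l
  yields a chain of l + 1 primes above the annihilator of any nonzero element, and above the prime
  of D there is no chain longer than card (V - D). At the irrelevant ideal the dimension, and
  hence the depth of a Cohen-Macaulay ring, is at least n, which gives card D = n.
*)

theory Submission
  imports Defs "HOL-Computational_Algebra.Polynomial"
begin

section \<open>Ideals, depth and prime chains\<close>

text \<open>Cohen-Macaulayness is demanded at every maximal ideal of S/I(G), and over an arbitrary
  field a maximal ideal need not contain x_i + y_i minus a constant. This forces the polynomials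
  f_i; as regularity holds for every choice of them, one induction serves all maximal ideals. Depth
  and dimension agree by the squeeze n <= depth <= dimension <= n. The smallest undecided index t is
  the right pivot because y_t has only neighbours x_l with l <= t, so that y_t has no undecided
  neighbour left once x_t is set to zero. Condition (3) is what keeps the colon ideal by x_t of the
  same form: an edge ideal plus variables, with pairs decided consistently. Dimension is bounded by
  counting: elements that separate the primes of a chain satisfy no algebraic relation, and too many
  of them would have more products of bounded degree than there are monomials. Depth is compared
  with dimension through colon ideals and Nakayama's lemma, without homological algebra.\<close>

lemma (in cring) idealI_cring:
  assumes "J \<subseteq> carrier R" "\<zero> \<in> J"
    and add: "\<And>a b. a \<in> J \<Longrightarrow> b \<in> J \<Longrightarrow> a \<oplus> b \<in> J"
    and mult: "\<And>a b. a \<in> carrier R \<Longrightarrow> b \<in> J \<Longrightarrow> a \<otimes> b \<in> J"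
  shows "ideal J R"
proof (rule idealI[OF ring_axioms])
  have neg: "\<ominus> a \<in> J" if "a \<in> J" for a
  proof -
    have "(\<ominus> \<one>) \<otimes> a \<in> J" using that by (intro mult) auto
    then show ?thesis using that assms(1) l_minus[of \<one> a] by auto
  qed
  show "subgroup J (add_monoid R)"
    using assms neg by unfold_locales (auto simp: a_inv_def[symmetric])
  show "a \<otimes> b \<in> J" if "a \<in> J" "b \<in> carrier R" for a b
    using mult[OF that(2,1)] that assms(1) by (auto simp: m_comm)
qed (rule mult)

definition (in ring) adjoin :: "'a set \<Rightarrow> 'a \<Rightarrow> 'a set" where
  "adjoin J s = {j \<oplus> a \<otimes> s |j a. j \<in> J \<and> a \<in> carrier R}"

definition (in ring) colon :: "'a set \<Rightarrow> 'a \<Rightarrow> 'a set" where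
  "colon J g = {a \<in> carrier R. a \<otimes> g \<in> J}"

context cring
begin

lemma ideal_closed:
  assumes "ideal J R"
  shows "J \<subseteq> carrier R" "\<zero> \<in> J" "a \<in> J \<Longrightarrow> b \<in> J \<Longrightarrow> a \<oplus> b \<in> J"
    "c \<in> carrier R \<Longrightarrow> a \<in> J \<Longrightarrow> c \<otimes> a \<in> J" "a \<in> J \<Longrightarrow> \<ominus> a \<in> J" "a \<in> J \<Longrightarrow> a \<in> carrier R"
    "a \<in> J \<Longrightarrow> c \<in> carrier R \<Longrightarrow> a \<otimes> c \<in> J"
proof -
  interpret J: ideal J R by fact
  show "J \<subseteq> carrier R" "\<zero> \<in> J" "a \<in> J \<Longrightarrow> b \<in> J \<Longrightarrow> a \<oplus> b \<in> J"
    "c \<in> carrier R \<Longrightarrow> a \<in> J \<Longrightarrow> c \<otimes> a \<in> J" "a \<in> J \<Longrightarrow> \<ominus> a \<in> J" "a \<in> J \<Longrightarrow> a \<in> carrier R"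
    "a \<in> J \<Longrightarrow> c \<in> carrier R \<Longrightarrow> a \<otimes> c \<in> J"
    by (fact J.a_subset J.zero_closed J.a_closed J.I_l_closed[rotated] J.a_inv_closed J.Icarr J.I_r_closed)+
qed

lemma ideal_unit:
  assumes "ideal J R" "u \<in> Units R" "u \<in> J"
  shows "J = carrier R"
proof -
  have "inv u \<otimes> u \<in> J" by (rule ideal_closed(4)) (use assms in auto)
  then have "\<one> \<in> J" using assms by simp
  then show ?thesis using assms(1) by (simp add: ideal.one_imp_carrier)
qed

lemma ideal_unit_cancel:
  assumes "ideal J R" "u \<in> Units R" "a \<in> carrier R" "a \<otimes> u \<in> J"
  shows "a \<in> J"
proof -
  have "a \<otimes> u \<otimes> inv u \<in> J" by (rule ideal_closed(7)) (use assms in auto)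
  moreover have "a \<otimes> u \<otimes> inv u = a" using assms(2,3) by (simp add: m_assoc Units_closed)
  ultimately show ?thesis by simp
qed

lemma adjoin_ideal:
  assumes J: "ideal J R" and s: "s \<in> carrier R"
  shows "ideal (adjoin J s) R"
proof (rule idealI_cring)
  note J' = ideal_closed[OF J]
  show "adjoin J s \<subseteq> carrier R" using s J'(6) by (auto simp: adjoin_def)
  show "\<zero> \<in> adjoin J s"
    using J'(2) s unfolding adjoin_def by (intro CollectI exI[of _ \<zero>]) auto
  fix a b
  show "a \<oplus> b \<in> adjoin J s" if ab: "a \<in> adjoin J s" "b \<in> adjoin J s"
  proof -
    obtain j1 c1 j2 c2 where *: "a = j1 \<oplus> c1 \<otimes> s" "b = j2 \<oplus> c2 \<otimes> s" "j1 \<in> J" "j2 \<in> J"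
      "c1 \<in> carrier R" "c2 \<in> carrier R" using ab unfolding adjoin_def by blast
    then have "a \<oplus> b = (j1 \<oplus> j2) \<oplus> (c1 \<oplus> c2) \<otimes> s"
      using s J'(6)[of j1] J'(6)[of j2] by algebra
    then show ?thesis using * J'(3) unfolding adjoin_def by blast
  qed
  show "a \<otimes> b \<in> adjoin J s" if ab: "a \<in> carrier R" "b \<in> adjoin J s"
  proof -
    obtain j2 c2 where *: "b = j2 \<oplus> c2 \<otimes> s" "j2 \<in> J" "c2 \<in> carrier R"
      using ab(2) unfolding adjoin_def by blast
    then have "a \<otimes> b = (a \<otimes> j2) \<oplus> (a \<otimes> c2) \<otimes> s"
      using s J'(6)[of j2] ab(1) by algebra
    then show ?thesis using * J'(4) ab(1) unfolding adjoin_def by blast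
  qed
qed

lemma adjoin_superset:
  assumes "ideal J R" "s \<in> carrier R"
  shows "J \<subseteq> adjoin J s" "s \<in> adjoin J s"
proof -
  show "J \<subseteq> adjoin J s"
  proof
    fix j assume "j \<in> J"
    then have "j = j \<oplus> \<zero> \<otimes> s" using assms ideal_closed(6) by simp
    then show "j \<in> adjoin J s" using \<open>j \<in> J\<close> unfolding adjoin_def by blast
  qed
  have "s = \<zero> \<oplus> \<one> \<otimes> s" using assms by simp
  then show "s \<in> adjoin J s" using ideal_closed(2)[OF assms(1)] unfolding adjoin_def by blast
qed

lemma adjoin_minimal:
  assumes "ideal K R" "J \<subseteq> K" "s \<in> K"
  shows "adjoin J s \<subseteq> K"
  using assms ideal_closed(3,4)[OF assms(1)] unfolding adjoin_def by blast

text \<open>Lets the ideals of the initial segments of a sequence be built one element at a time,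
  with an explicit cofactor for the last element.\<close>

lemma Idl_insert:
  assumes "G \<subseteq> carrier R" "s \<in> carrier R"
  shows "Idl (insert s G) = adjoin (Idl G) s"
proof
  have G: "ideal (Idl G) R" using assms(1) by (rule genideal_ideal)
  have "insert s G \<subseteq> adjoin (Idl G) s"
    using adjoin_superset[OF G assms(2)] genideal_self[OF assms(1)] by blast
  then show "Idl (insert s G) \<subseteq> adjoin (Idl G) s"
    by (rule genideal_minimal[OF adjoin_ideal[OF G assms(2)]])
  have "insert s G \<subseteq> carrier R" using assms by simp
  then show "adjoin (Idl G) s \<subseteq> Idl (insert s G)"
    using genideal_self[of "insert s G"]
    by (intro adjoin_minimal genideal_ideal subset_Idl_subset) auto
qed

lemma Idl_empty: "Idl {} = {\<zero>}"
  using genideal_minimal[OF zeroideal, of "{}"] ideal_closed(2)[OF genideal_ideal[of "{}"]] by auto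

lemma colon_ideal:
  assumes J: "ideal J R" and g: "g \<in> carrier R"
  shows "ideal (colon J g) R"
proof (rule idealI_cring)
  note J' = ideal_closed[OF J]
  show "colon J g \<subseteq> carrier R" by (auto simp: colon_def)
  show "\<zero> \<in> colon J g" using J'(2) g by (simp add: colon_def)
  show "a \<oplus> b \<in> colon J g" if "a \<in> colon J g" "b \<in> colon J g" for a b
    using that J'(3) g by (simp add: colon_def l_distr)
  show "a \<otimes> b \<in> colon J g" if "a \<in> carrier R" "b \<in> colon J g" for a b
    using that J'(4) g by (simp add: colon_def m_assoc)
qed

lemma colon_superset:
  assumes "ideal J R" "g \<in> carrier R"
  shows "J \<subseteq> colon J g"
  using assms ideal_closed[OF assms(1)] by (auto simp: colon_def)

text \<open>A nonempty chain of ideals of a Noetherian ring contains its own union, so Zorn's lemma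
  applies to every nonempty family of ideals, without any closure condition on the family.\<close>

lemma noetherian_maximal_ideal_in_family:
  assumes "noetherian_ring R" "F \<noteq> {}" "\<And>J. J \<in> F \<Longrightarrow> ideal J R"
  obtains J where "J \<in> F" "\<And>K. K \<in> F \<Longrightarrow> J \<subseteq> K \<Longrightarrow> K = J"
proof -
  have "\<exists>M\<in>F. \<forall>X\<in>F. M \<subseteq> X \<longrightarrow> X = M"
  proof (rule subset_Zorn_nonempty[OF assms(2)])
    fix C assume C: "C \<noteq> {}" "subset.chain F C"
    then have "subset.chain {J. ideal J R} C"
      using assms(3) unfolding subset_chain_def by blast
    then have "\<Union>C \<in> C"
      using noetherian_ring.ideal_chain_is_trivial[OF assms(1) C(1)] by blast
    then show "\<Union>C \<in> F" using C(2) unfolding subset_chain_def by blast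
  qed
  then show thesis using that by blast
qed

text \<open>Produces an associated prime above a prescribed colon ideal. If a b lies in a maximal
  \<open>colon J g\<close> and b g is not in \<open>J\<close>, then the colon by b g is again in the
  family and contains \<open>colon J g\<close>; by maximality both agree, and a belongs to the
  former.\<close>

lemma maximal_colon_prime:
  assumes noeth: "noetherian_ring R" and J: "ideal J R" and f: "f \<in> carrier R" "f \<notin> J"
  obtains g where "g \<in> carrier R" "g \<notin> J" "colon J f \<subseteq> colon J g" "primeideal (colon J g) R"
proof -
  define F where "F = {colon J g |g. g \<in> carrier R \<and> g \<notin> J \<and> colon J f \<subseteq> colon J g}"
  have "F \<noteq> {}" using f unfolding F_def by blast
  moreover have "ideal K R" if "K \<in> F" for K
    using that colon_ideal[OF J] unfolding F_def by blast
  ultimately obtain K where K: "K \<in> F" "\<And>K'. K' \<in> F \<Longrightarrow> K \<subseteq> K' \<Longrightarrow> K' = K"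
    using noetherian_maximal_ideal_in_family[OF noeth] by metis
  then obtain g where g: "g \<in> carrier R" "g \<notin> J" "colon J f \<subseteq> colon J g" "K = colon J g"
    unfolding F_def by blast
  have "primeideal (colon J g) R"
  proof (rule primeidealI[OF colon_ideal[OF J g(1)] is_cring])
    have "\<one> \<notin> colon J g" using g by (simp add: colon_def)
    then show "carrier R \<noteq> colon J g" by blast
    fix a b assume ab: "a \<in> carrier R" "b \<in> carrier R" "a \<otimes> b \<in> colon J g"
    show "a \<in> colon J g \<or> b \<in> colon J g"
    proof (cases "b \<otimes> g \<in> J")
      case False
      have sub: "colon J g \<subseteq> colon J (b \<otimes> g)"
      proof
        fix c assume "c \<in> colon J g"
        then have c: "c \<in> carrier R" "c \<otimes> g \<in> J" by (auto simp: colon_def)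
        have "b \<otimes> (c \<otimes> g) \<in> J" using ideal_closed(4)[OF J ab(2) c(2)] .
        then show "c \<in> colon J (b \<otimes> g)" using c ab g by (simp add: colon_def m_lcomm)
      qed
      then have "colon J (b \<otimes> g) \<in> F" using False g ab unfolding F_def by blast
      then have "colon J (b \<otimes> g) = colon J g" using K(2) sub g(4) by blast
      moreover have "a \<in> colon J (b \<otimes> g)" using ab g by (simp add: colon_def m_assoc)
      ultimately show ?thesis by blast
    qed (use ab in \<open>simp add: colon_def\<close>)
  qed
  with g show thesis by (intro that[of g])
qed

lemma local_ring_one_minus_unit:
  assumes "local_ring R M" "\<And>a. a \<in> carrier R - M \<Longrightarrow> a \<in> Units R" "a \<in> M"
  shows "\<one> \<ominus> a \<in> Units R"
proof -
  interpret M: maximalideal M R using assms(1) by (simp add: local_ring_def)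
  have a: "a \<in> carrier R" using assms(3) by (rule M.Icarr)
  have "\<one> \<ominus> a \<notin> M"
  proof
    assume "\<one> \<ominus> a \<in> M"
    then have "(\<one> \<ominus> a) \<oplus> a \<in> M" using assms(3) by (intro M.a_closed)
    moreover have "(\<one> \<ominus> a) \<oplus> a = \<one>" using a by algebra
    ultimately have "\<one> \<in> M" by simp
    then show False using M.I_notcarr M.one_imp_carrier by simp
  qed
  then show ?thesis using assms(2) a by auto
qed

text \<open>
  Nakayama's lemma for a set that need not be finitely generated: the ascending chain condition is
  applied to the ideals \<open>adjoin J s\<close> with \<open>s \<in> U\<close>.
\<close>

lemma divisible_submodule_trivial:
  assumes noeth: "noetherian_ring R" and J: "ideal J R" and x: "x \<in> carrier R"
    and unit: "\<And>a. a \<in> carrier R \<Longrightarrow> \<one> \<ominus> a \<otimes> x \<in> Units R"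
    and U: "U \<subseteq> carrier R" "U \<subseteq> adjoin J x"
    and sat: "\<And>j s. j \<in> J \<Longrightarrow> s \<in> carrier R \<Longrightarrow> j \<oplus> s \<otimes> x \<in> U \<Longrightarrow> s \<in> U"
  shows "U \<subseteq> J"
proof (rule ccontr)
  assume "\<not> U \<subseteq> J"
  define F where "F = {adjoin J s |s. s \<in> U \<and> s \<notin> J}"
  have "F \<noteq> {}" using \<open>\<not> U \<subseteq> J\<close> unfolding F_def by blast
  moreover have "ideal K R" if "K \<in> F" for K
    using that U(1) adjoin_ideal[OF J] unfolding F_def by blast
  ultimately obtain K where K: "K \<in> F" "\<And>K'. K' \<in> F \<Longrightarrow> K \<subseteq> K' \<Longrightarrow> K' = K"
    using noetherian_maximal_ideal_in_family[OF noeth] by metis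
  obtain s where s: "s \<in> U" "s \<notin> J" "K = adjoin J s" using K(1) unfolding F_def by blast
  have sc: "s \<in> carrier R" using s U by blast
  obtain j t where jt: "s = j \<oplus> t \<otimes> x" "j \<in> J" "t \<in> carrier R"
    using s U(2) unfolding adjoin_def by blast
  have tU: "t \<in> U" using sat[OF jt(2,3)] jt(1) s(1) by simp
  have tJ: "t \<notin> J" using jt s(2) ideal_closed(3,7)[OF J] x by blast
  have "s = j \<oplus> x \<otimes> t" using jt x by (simp add: m_comm)
  then have "s \<in> adjoin J t" using jt(2) x unfolding adjoin_def by blast
  then have "K \<subseteq> adjoin J t"
    unfolding s(3) using adjoin_superset[OF J jt(3)]
    by (intro adjoin_minimal[OF adjoin_ideal[OF J jt(3)]]) (use \<open>s \<in> adjoin J t\<close> in auto)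
  then have "adjoin J t = adjoin J s" using K(2) tU tJ s(3) unfolding F_def by blast
  then have "t \<in> adjoin J s" using adjoin_superset[OF J jt(3)] by blast
  then obtain j' a where a: "t = j' \<oplus> a \<otimes> s" "j' \<in> J" "a \<in> carrier R" unfolding adjoin_def by blast
  have jc: "j \<in> carrier R" "j' \<in> carrier R" using jt a ideal_closed(6)[OF J] by auto
  \<comment> \<open>By maximality of \<open>K\<close>, s and t generate the same ideal modulo
    \<open>J\<close>. Eliminating s from s = j + t x and t = j' + a s leaves t (1 - a x) in
    \<open>J\<close>, and the second factor is a unit.\<close>
  have "t \<otimes> (\<one> \<ominus> a \<otimes> x) = t \<ominus> a \<otimes> (t \<otimes> x)" using jt(3) a(3) x by algebra
  also have "t \<otimes> x = s \<ominus> j" using jt(1,3) jc x by algebra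
  also have "t \<ominus> a \<otimes> (s \<ominus> j) = j' \<oplus> a \<otimes> j"
    using a(1,3) jc sc by algebra
  finally have "t \<otimes> (\<one> \<ominus> a \<otimes> x) \<in> J"
    using ideal_closed(3)[OF J a(2) ideal_closed(4)[OF J a(3) jt(2)]] by (simp only:)
  then show False using ideal_unit_cancel[OF J unit[OF a(3)] jt(3)] tJ by simp
qed

text \<open>
  One prime of the chain is produced for every element of the regular sequence: if the last prime is
  \<open>colon J g\<close>, the next one is a maximal colon ideal modulo \<open>adjoin J x\<close> of an element that is
  annihilated by \<open>colon J g\<close> modulo \<open>J\<close>.
\<close>

theorem regular_sequence_prime_chain:
  assumes noeth: "noetherian_ring R" and loc: "local_ring R M"
    and units: "\<And>a. a \<in> carrier R - M \<Longrightarrow> a \<in> Units R"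
    and reg: "regular_sequence R xs" "set xs \<subseteq> M"
    and f: "f \<in> carrier R" "f \<noteq> \<zero>"
  obtains P where "prime_chain R (length xs) P" "colon {\<zero>} f \<subseteq> P 0"
proof -
  let ?J = "\<lambda>i. Idl (set (take i xs))"
  have xs: "set xs \<subseteq> carrier R" using reg(1) by (simp add: regular_sequence_def)
  have J: "ideal (?J i) R" for i
    using xs set_take_subset[of i xs] by (intro genideal_ideal) blast
  have "i \<le> length xs \<Longrightarrow> \<exists>P g. prime_chain R i P \<and> colon {\<zero>} f \<subseteq> P 0 \<and>
      g \<in> carrier R \<and> g \<notin> ?J i \<and> P i = colon (?J i) g" for i
  proof (induction i)
    case 0
    obtain g where "g \<in> carrier R" "g \<notin> {\<zero>}" "colon {\<zero>} f \<subseteq> colon {\<zero>} g"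
      "primeideal (colon {\<zero>} g) R"
      using maximal_colon_prime[OF noeth zeroideal] f by blast
    then show ?case
      by (intro exI[of _ "\<lambda>_. colon {\<zero>} g"] exI[of _ g]) (simp add: prime_chain_def Idl_empty)
  next
    case (Suc i)
    then obtain P g where P: "prime_chain R i P" "colon {\<zero>} f \<subseteq> P 0"
      and g: "g \<in> carrier R" "g \<notin> ?J i" "P i = colon (?J i) g" by auto
    let ?x = "xs ! i"
    have x: "?x \<in> carrier R" "?x \<in> M" using xs reg(2) Suc.prems by auto
    have JS: "?J (Suc i) = adjoin (?J i) ?x"
    proof -
      have "set (take (Suc i) xs) = insert ?x (set (take i xs))"
        using Suc.prems by (simp add: take_Suc_conv_app_nth)
      moreover have "set (take i xs) \<subseteq> carrier R"
        using xs set_take_subset[of i xs] by blast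
      ultimately show ?thesis using Idl_insert x(1) by simp
    qed
    have xreg: "a \<in> ?J i" if "a \<in> carrier R" "?x \<otimes> a \<in> ?J i" for a
      using reg(1) that Suc.prems unfolding regular_sequence_def by auto
    \<comment> \<open>\<open>U\<close> is the colon of the ideal \<open>?J i\<close> by the prime
      \<open>P i\<close>. The colon ideal of any element of \<open>U\<close> contains
      \<open>P i\<close>, which allows the chain to be continued upward.\<close>
    define U where "U = {r \<in> carrier R. \<forall>p\<in>P i. p \<otimes> r \<in> ?J i}"
    have Pc: "p \<in> carrier R" if "p \<in> P i" for p using that g(3) by (simp add: colon_def)
    have "g \<in> U" using g unfolding U_def by (auto simp: colon_def)
    \<comment> \<open>If every element of \<open>U\<close> were divisible by \<open>?x\<close>
      modulo \<open>?J i\<close>, regularity of \<open>?x\<close> would put the quotients into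
      \<open>U\<close> again, and Nakayama's lemma would give \<open>U \<subseteq> ?J i\<close>,
      against \<open>g\<close>.\<close>
    have "\<not> U \<subseteq> adjoin (?J i) ?x"
    proof
      assume sub: "U \<subseteq> adjoin (?J i) ?x"
      have "U \<subseteq> ?J i"
      proof (rule divisible_submodule_trivial[OF noeth J x(1) _ _ sub])
        fix a assume "a \<in> carrier R"
        then have "a \<otimes> ?x \<in> M"
          using x(2) loc ideal_closed(4)[of M] by (auto simp: local_ring_def maximalideal_def)
        then show "\<one> \<ominus> a \<otimes> ?x \<in> Units R" using local_ring_one_minus_unit[OF loc units] by blast
      next
        fix j s assume js: "j \<in> ?J i" "s \<in> carrier R" "j \<oplus> s \<otimes> ?x \<in> U"
        have "p \<otimes> s \<in> ?J i" if p: "p \<in> P i" for p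
        proof -
          have jc: "j \<in> carrier R" using js(1) ideal_closed(6)[OF J] by blast
          have "p \<otimes> (j \<oplus> s \<otimes> ?x) \<in> ?J i" using js(3) p unfolding U_def by blast
          moreover have "p \<otimes> j \<in> ?J i" using js(1) Pc[OF p] ideal_closed(4)[OF J] by blast
          ultimately have "p \<otimes> (j \<oplus> s \<otimes> ?x) \<oplus> \<ominus> (p \<otimes> j) \<in> ?J i"
            using ideal_closed(3,5)[OF J] by blast
          moreover have "p \<otimes> (j \<oplus> s \<otimes> ?x) \<oplus> \<ominus> (p \<otimes> j) = ?x \<otimes> (p \<otimes> s)"
            using jc js(2) x(1) Pc[OF p] by algebra
          ultimately show ?thesis using xreg js(2) Pc[OF p] by simp
        qed
        then show "s \<in> U" using js(2) unfolding U_def by blast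
      qed (auto simp: U_def)
      then show False using \<open>g \<in> U\<close> g(2) by blast
    qed
    then obtain r where r: "r \<in> U" "r \<notin> ?J (Suc i)" using JS by auto
    then obtain h where h: "h \<in> carrier R" "h \<notin> ?J (Suc i)"
      "colon (?J (Suc i)) r \<subseteq> colon (?J (Suc i)) h" "primeideal (colon (?J (Suc i)) h) R"
      using maximal_colon_prime[OF noeth J] unfolding U_def by blast
    have JJ: "?J i \<subseteq> ?J (Suc i)" unfolding JS using adjoin_superset[OF J x(1)] by blast
    have "P i \<subseteq> colon (?J (Suc i)) r"
      using r(1) Pc JJ unfolding U_def colon_def by blast
    moreover have "?x \<in> colon (?J (Suc i)) r"
    proof -
      have "?x \<in> ?J (Suc i)" unfolding JS using adjoin_superset[OF J x(1)] by blast
      then show ?thesis using colon_superset[OF J] r(1) unfolding U_def by blast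
    qed
    \<comment> \<open>Strictness: \<open>?x\<close> annihilates no nonzero class modulo
      \<open>?J i\<close>, in particular not the class of \<open>g\<close>.\<close>
    moreover have "?x \<notin> P i" using g xreg by (auto simp: colon_def)
    ultimately have "P i \<subset> colon (?J (Suc i)) h" using h(3) by blast
    then show ?case
      using P g h
      by (intro exI[of _ "P(Suc i := colon (?J (Suc i)) h)"] exI[of _ h])
        (auto simp: prime_chain_def less_Suc_eq le_Suc_eq)
  qed
  then show thesis using that by blast
qed

text \<open>The chain theorem for \<open>f = \<one>\<close>, whose annihilator is zero and therefore
  restricts the first prime in no way.\<close>

lemma depth_le_krull_dim:
  assumes "noetherian_ring R" and loc: "local_ring R M"
    and "\<And>a. a \<in> carrier R - M \<Longrightarrow> a \<in> Units R"
  shows "depth R M \<le> krull_dim R"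
  unfolding depth_def
proof (rule Sup_least, clarify)
  fix xs assume xs: "regular_sequence R xs" "set xs \<subseteq> M"
  interpret M: maximalideal M R using loc by (simp add: local_ring_def)
  have "\<one> \<noteq> \<zero>"
  proof
    assume "\<one> = \<zero>"
    then have "\<one> \<in> M" using ideal_closed(2)[OF M.is_ideal] by simp
    then show False using M.I_notcarr M.one_imp_carrier by simp
  qed
  then obtain P where "prime_chain R (length xs) P"
    using regular_sequence_prime_chain[OF assms(1,2,3) xs one_closed] by metis
  then show "enat (length xs) \<le> krull_dim R"
    unfolding krull_dim_def by (intro Sup_upper) blast
qed

end

section \<open>Localization of a quotient ring\<close>

context primeideal
begin

lemma one_notin: "\<one> \<notin> I"
  using one_imp_carrier I_notcarr by blast

lemma denom_mult:
  assumes "s \<in> carrier R - I" "t \<in> carrier R - I"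
  shows "s \<otimes> t \<in> carrier R - I"
  using assms I_prime by auto

lemma denom_one: "\<one> \<in> carrier R - I"
  using one_notin by simp

lemma loc_rel_iff:
  "((a, s), (b, t)) \<in> loc_rel R I \<longleftrightarrow>
    a \<in> carrier R \<and> b \<in> carrier R \<and> s \<in> carrier R - I \<and> t \<in> carrier R - I \<and>
    (\<exists>u\<in>carrier R - I. u \<otimes> (a \<otimes> t) = u \<otimes> (b \<otimes> s))"
  unfolding loc_rel_def by blast

lemma loc_rel_trans:
  assumes "((a, s), (b, t)) \<in> loc_rel R I" "((b, t), (c, r)) \<in> loc_rel R I"
  shows "((a, s), (c, r)) \<in> loc_rel R I"
proof -
  obtain u v where u: "u \<in> carrier R - I" "u \<otimes> (a \<otimes> t) = u \<otimes> (b \<otimes> s)"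
    and v: "v \<in> carrier R - I" "v \<otimes> (b \<otimes> r) = v \<otimes> (c \<otimes> t)"
    using assms unfolding loc_rel_iff by blast
  have c: "a \<in> carrier R" "b \<in> carrier R" "c \<in> carrier R" "s \<in> carrier R - I"
    "t \<in> carrier R - I" "r \<in> carrier R - I"
    using assms unfolding loc_rel_iff by blast+
  then have c': "s \<in> carrier R" "t \<in> carrier R" "r \<in> carrier R" "u \<in> carrier R" "v \<in> carrier R"
    using u v by auto
  \<comment> \<open>Zero divisors forbid cancelling the middle denominator t, so it becomes part of
    the multiplier.\<close>
  have "(u \<otimes> v \<otimes> t) \<otimes> (a \<otimes> r) = (v \<otimes> r) \<otimes> (u \<otimes> (a \<otimes> t))"
    using c(1-3) c' by (simp add: m_ac)
  also have "\<dots> = (u \<otimes> s) \<otimes> (v \<otimes> (b \<otimes> r))"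
    unfolding u(2) using c(1-3) c' by (simp add: m_ac)
  also have "\<dots> = (u \<otimes> v \<otimes> t) \<otimes> (c \<otimes> s)"
    unfolding v(2) using c(1-3) c' by (simp add: m_ac)
  finally have eq: "(u \<otimes> v \<otimes> t) \<otimes> (a \<otimes> r) = (u \<otimes> v \<otimes> t) \<otimes> (c \<otimes> s)" .
  have "u \<otimes> v \<otimes> t \<in> carrier R - I" using denom_mult u(1) v(1) c(5) by blast
  with eq c show ?thesis unfolding loc_rel_iff by blast
qed

lemma loc_rel_equiv: "equiv (carrier R \<times> (carrier R - I)) (loc_rel R I)"
proof (rule equivI)
  show "loc_rel R I \<subseteq> (carrier R \<times> (carrier R - I)) \<times> carrier R \<times> (carrier R - I)"
    unfolding loc_rel_def by blast
  show "refl_on (carrier R \<times> (carrier R - I)) (loc_rel R I)"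
    using denom_one by (intro refl_onI) (auto simp: loc_rel_iff)
  show "sym (loc_rel R I)"
  proof (rule symI, clarify)
    fix a s b t assume "((a, s), (b, t)) \<in> loc_rel R I"
    then show "((b, t), (a, s)) \<in> loc_rel R I" unfolding loc_rel_iff by metis
  qed
  show "trans (loc_rel R I)"
    by (intro transI) (metis loc_rel_trans surj_pair)
qed

abbreviation "L \<equiv> localization R I"
abbreviation "fr \<equiv> loc_frac R I"

lemma frac_eq_iff:
  assumes "a \<in> carrier R" "b \<in> carrier R" "s \<in> carrier R - I" "t \<in> carrier R - I"
  shows "fr a s = fr b t \<longleftrightarrow> (\<exists>u\<in>carrier R - I. u \<otimes> (a \<otimes> t) = u \<otimes> (b \<otimes> s))"
proof -
  have "fr a s = fr b t \<longleftrightarrow> ((a, s), (b, t)) \<in> loc_rel R I"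
    unfolding loc_frac_def using assms by (intro eq_equiv_class_iff[OF loc_rel_equiv]) auto
  then show ?thesis using assms by (simp add: loc_rel_iff)
qed

lemma frac_eqI:
  assumes "a \<in> carrier R" "b \<in> carrier R" "s \<in> carrier R - I" "t \<in> carrier R - I"
    "a \<otimes> t = b \<otimes> s"
  shows "fr a s = fr b t"
  using assms denom_one by (subst frac_eq_iff) auto

lemma frac_closed:
  assumes "a \<in> carrier R" "s \<in> carrier R - I"
  shows "fr a s \<in> carrier L"
  using assms unfolding localization_def loc_frac_def by (auto intro: quotientI)

lemma fracE:
  assumes "l \<in> carrier L"
  obtains a s where "a \<in> carrier R" "s \<in> carrier R - I" "l = fr a s"
  using assms unfolding localization_def loc_frac_def by (auto elim!: quotientE)

lemma mem_frac:
  assumes "a \<in> carrier R" "s \<in> carrier R - I"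
  shows "(a, s) \<in> fr a s"
  using assms equiv_class_self[OF loc_rel_equiv, of "(a, s)"] by (simp add: loc_frac_def)

lemma mem_fracD:
  assumes "a \<in> carrier R" "s \<in> carrier R - I" "(b, t) \<in> fr a s"
  shows "b \<in> carrier R" "t \<in> carrier R - I"
    "\<exists>u\<in>carrier R - I. u \<otimes> (a \<otimes> t) = u \<otimes> (b \<otimes> s)"
  using assms unfolding loc_frac_def by (auto simp: loc_rel_iff)

text \<open>The operations of \<open>localization\<close> are unions over all pairs of
  representatives. Once the value is independent of the representatives, such a union collapses to
  it, because the classes are nonempty.\<close>

lemma UN_frac:
  assumes a: "a \<in> carrier R" "s \<in> carrier R - I" and b: "b \<in> carrier R" "t \<in> carrier R - I"
    and const: "\<And>a' s' b' t'. (a', s') \<in> fr a s \<Longrightarrow> (b', t') \<in> fr b t \<Longrightarrow> F a' s' b' t' = C"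
  shows "(\<Union>(a', s')\<in>fr a s. \<Union>(b', t')\<in>fr b t. F a' s' b' t') = C"
proof
  show "(\<Union>(a', s')\<in>fr a s. \<Union>(b', t')\<in>fr b t. F a' s' b' t') \<subseteq> C"
    using const by fastforce
  show "C \<subseteq> (\<Union>(a', s')\<in>fr a s. \<Union>(b', t')\<in>fr b t. F a' s' b' t')"
    using mem_frac[OF a] mem_frac[OF b] const by fastforce
qed

lemma frac_mult:
  assumes a: "a \<in> carrier R" "s \<in> carrier R - I" and b: "b \<in> carrier R" "t \<in> carrier R - I"
  shows "fr a s \<otimes>\<^bsub>L\<^esub> fr b t = fr (a \<otimes> b) (s \<otimes> t)"
proof -
  have "fr (a' \<otimes> b') (s' \<otimes> t') = fr (a \<otimes> b) (s \<otimes> t)"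
    if "(a', s') \<in> fr a s" "(b', t') \<in> fr b t" for a' s' b' t'
  proof -
    note A = mem_fracD[OF a that(1)] and B = mem_fracD[OF b that(2)]
    obtain u v where u: "u \<in> carrier R - I" "u \<otimes> (a \<otimes> s') = u \<otimes> (a' \<otimes> s)"
      and v: "v \<in> carrier R - I" "v \<otimes> (b \<otimes> t') = v \<otimes> (b' \<otimes> t)"
      using A(3) B(3) by blast
    have c: "s \<in> carrier R" "t \<in> carrier R" "s' \<in> carrier R" "t' \<in> carrier R" "u \<in> carrier R"
      "v \<in> carrier R" using a b A B u v by auto
    have "(u \<otimes> v) \<otimes> ((a' \<otimes> b') \<otimes> (s \<otimes> t)) = (u \<otimes> (a' \<otimes> s)) \<otimes> (v \<otimes> (b' \<otimes> t))"
      using a(1) b(1) A(1) B(1) c by (simp add: m_ac)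
    also have "\<dots> = (u \<otimes> (a \<otimes> s')) \<otimes> (v \<otimes> (b \<otimes> t'))" by (simp only: u(2) v(2))
    also have "\<dots> = (u \<otimes> v) \<otimes> ((a \<otimes> b) \<otimes> (s' \<otimes> t'))"
      using a(1) b(1) A(1) B(1) c by (simp add: m_ac)
    finally have "(u \<otimes> v) \<otimes> ((a' \<otimes> b') \<otimes> (s \<otimes> t)) = (u \<otimes> v) \<otimes> ((a \<otimes> b) \<otimes> (s' \<otimes> t'))" .
    moreover have "u \<otimes> v \<in> carrier R - I" using denom_mult u v by blast
    moreover have "s \<otimes> t \<in> carrier R - I" "s' \<otimes> t' \<in> carrier R - I"
      using denom_mult a b A B by blast+
    ultimately show ?thesis using a(1) b(1) A(1) B(1) by (subst frac_eq_iff) auto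
  qed
  then show ?thesis unfolding localization_def by (simp add: UN_frac[OF a b])
qed

lemma frac_add:
  assumes a: "a \<in> carrier R" "s \<in> carrier R - I" and b: "b \<in> carrier R" "t \<in> carrier R - I"
  shows "fr a s \<oplus>\<^bsub>L\<^esub> fr b t = fr ((a \<otimes> t) \<oplus> (b \<otimes> s)) (s \<otimes> t)"
proof -
  have "fr ((a' \<otimes> t') \<oplus> (b' \<otimes> s')) (s' \<otimes> t') = fr ((a \<otimes> t) \<oplus> (b \<otimes> s)) (s \<otimes> t)"
    if "(a', s') \<in> fr a s" "(b', t') \<in> fr b t" for a' s' b' t'
  proof -
    note A = mem_fracD[OF a that(1)] and B = mem_fracD[OF b that(2)]
    obtain u v where u: "u \<in> carrier R - I" "u \<otimes> (a \<otimes> s') = u \<otimes> (a' \<otimes> s)"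
      and v: "v \<in> carrier R - I" "v \<otimes> (b \<otimes> t') = v \<otimes> (b' \<otimes> t)"
      using A(3) B(3) by blast
    have c: "s \<in> carrier R" "t \<in> carrier R" "s' \<in> carrier R" "t' \<in> carrier R" "u \<in> carrier R"
      "v \<in> carrier R" using a b A B u v by auto
    have "(u \<otimes> v) \<otimes> (((a' \<otimes> t') \<oplus> (b' \<otimes> s')) \<otimes> (s \<otimes> t)) =
        (u \<otimes> (a' \<otimes> s)) \<otimes> (v \<otimes> t \<otimes> t') \<oplus> (v \<otimes> (b' \<otimes> t)) \<otimes> (u \<otimes> s \<otimes> s')"
      using a(1) b(1) A(1) B(1) c by (simp add: m_ac l_distr r_distr)
    also have "\<dots> = (u \<otimes> (a \<otimes> s')) \<otimes> (v \<otimes> t \<otimes> t') \<oplus> (v \<otimes> (b \<otimes> t')) \<otimes> (u \<otimes> s \<otimes> s')"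
      by (simp only: u(2) v(2))
    also have "\<dots> = (u \<otimes> v) \<otimes> (((a \<otimes> t) \<oplus> (b \<otimes> s)) \<otimes> (s' \<otimes> t'))"
      using a(1) b(1) A(1) B(1) c by (simp add: m_ac l_distr r_distr)
    finally have "(u \<otimes> v) \<otimes> (((a' \<otimes> t') \<oplus> (b' \<otimes> s')) \<otimes> (s \<otimes> t)) =
      (u \<otimes> v) \<otimes> (((a \<otimes> t) \<oplus> (b \<otimes> s)) \<otimes> (s' \<otimes> t'))" .
    moreover have "u \<otimes> v \<in> carrier R - I" using denom_mult u v by blast
    moreover have "s \<otimes> t \<in> carrier R - I" "s' \<otimes> t' \<in> carrier R - I"
      using denom_mult a b A B by blast+
    ultimately show ?thesis using a(1) b(1) A(1) B(1) c by (subst frac_eq_iff) auto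
  qed
  then show ?thesis unfolding localization_def by (simp add: UN_frac[OF a b])
qed

lemma frac_zero: "\<zero>\<^bsub>L\<^esub> = fr \<zero> \<one>" and frac_one: "\<one>\<^bsub>L\<^esub> = fr \<one> \<one>"
  unfolding localization_def by simp_all

lemma localization_cring: "cring L"
proof (rule cringI)
  show "abelian_group L"
  proof (rule abelian_groupI)
    show "\<zero>\<^bsub>L\<^esub> \<in> carrier L" using denom_one by (simp add: frac_zero frac_closed)
    fix k l assume kl: "k \<in> carrier L" "l \<in> carrier L"
    obtain a s where a: "a \<in> carrier R" "s \<in> carrier R - I" "k = fr a s" using fracE[OF kl(1)] .
    obtain b t where b: "b \<in> carrier R" "t \<in> carrier R - I" "l = fr b t" using fracE[OF kl(2)] .
    have st: "s \<in> carrier R" "t \<in> carrier R" using a b by auto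
    have D: "s \<otimes> t \<in> carrier R - I" "t \<otimes> s \<in> carrier R - I" using denom_mult a b by blast+
    show "k \<oplus>\<^bsub>L\<^esub> l \<in> carrier L" using a b D st by (auto simp: frac_add intro!: frac_closed)
    show "k \<oplus>\<^bsub>L\<^esub> l = l \<oplus>\<^bsub>L\<^esub> k"
      using a b st by (simp add: frac_add m_comm a_comm)
    show "\<zero>\<^bsub>L\<^esub> \<oplus>\<^bsub>L\<^esub> k = k"
      unfolding frac_zero a(3) using a denom_one st by (simp add: frac_add)
    have "fr (\<ominus> a) s \<oplus>\<^bsub>L\<^esub> k = fr ((\<ominus> a) \<otimes> s \<oplus> a \<otimes> s) (s \<otimes> s)"
      using a by (simp add: frac_add)
    also have "\<dots> = fr \<zero> \<one>"
      using a st denom_one denom_mult[OF a(2) a(2)] by (intro frac_eqI) (auto simp: l_minus l_neg)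
    finally show "\<exists>j\<in>carrier L. j \<oplus>\<^bsub>L\<^esub> k = \<zero>\<^bsub>L\<^esub>"
      using a frac_closed by (intro bexI[of _ "fr (\<ominus> a) s"]) (auto simp: frac_zero)
    fix m assume "m \<in> carrier L"
    then obtain c r where c: "c \<in> carrier R" "r \<in> carrier R - I" "m = fr c r" by (rule fracE)
    have r: "r \<in> carrier R" using c by auto
    have D': "t \<otimes> r \<in> carrier R - I" using denom_mult b c by blast
    have "(a \<otimes> t \<oplus> b \<otimes> s) \<otimes> r \<oplus> c \<otimes> (s \<otimes> t) = a \<otimes> (t \<otimes> r) \<oplus> (b \<otimes> r \<oplus> c \<otimes> t) \<otimes> s"
      using a(1) b(1) c(1) st r by algebra
    then show "k \<oplus>\<^bsub>L\<^esub> l \<oplus>\<^bsub>L\<^esub> m = k \<oplus>\<^bsub>L\<^esub> (l \<oplus>\<^bsub>L\<^esub> m)"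
      using a b c st r D D' by (simp add: frac_add m_assoc)
  qed
  show "comm_monoid L"
  proof (rule comm_monoidI)
    show "\<one>\<^bsub>L\<^esub> \<in> carrier L" using denom_one by (simp add: frac_one frac_closed)
    fix k l assume kl: "k \<in> carrier L" "l \<in> carrier L"
    obtain a s where a: "a \<in> carrier R" "s \<in> carrier R - I" "k = fr a s" using fracE[OF kl(1)] .
    obtain b t where b: "b \<in> carrier R" "t \<in> carrier R - I" "l = fr b t" using fracE[OF kl(2)] .
    have st: "s \<in> carrier R" "t \<in> carrier R" using a b by auto
    have D: "s \<otimes> t \<in> carrier R - I" "t \<otimes> s \<in> carrier R - I" using denom_mult a b by blast+
    show "k \<otimes>\<^bsub>L\<^esub> l \<in> carrier L" using a b D by (auto simp: frac_mult intro!: frac_closed)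
    show "k \<otimes>\<^bsub>L\<^esub> l = l \<otimes>\<^bsub>L\<^esub> k" using a b st by (simp add: frac_mult m_comm)
    show "\<one>\<^bsub>L\<^esub> \<otimes>\<^bsub>L\<^esub> k = k"
      unfolding frac_one a(3) using a denom_one st by (simp add: frac_mult)
    fix m assume "m \<in> carrier L"
    then obtain c r where c: "c \<in> carrier R" "r \<in> carrier R - I" "m = fr c r" by (rule fracE)
    have D': "t \<otimes> r \<in> carrier R - I" using denom_mult b c by blast
    show "k \<otimes>\<^bsub>L\<^esub> l \<otimes>\<^bsub>L\<^esub> m = k \<otimes>\<^bsub>L\<^esub> (l \<otimes>\<^bsub>L\<^esub> m)"
      using a b c D D' st by (simp add: frac_mult m_assoc)
  qed
  fix k l m assume klm: "k \<in> carrier L" "l \<in> carrier L" "m \<in> carrier L"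
  obtain a s where a: "a \<in> carrier R" "s \<in> carrier R - I" "k = fr a s" using fracE[OF klm(1)] .
  obtain b t where b: "b \<in> carrier R" "t \<in> carrier R - I" "l = fr b t" using fracE[OF klm(2)] .
  obtain c r where c: "c \<in> carrier R" "r \<in> carrier R - I" "m = fr c r" using fracE[OF klm(3)] .
  have st: "s \<in> carrier R" "t \<in> carrier R" "r \<in> carrier R" using a b c by auto
  have D: "s \<otimes> t \<in> carrier R - I" "s \<otimes> r \<in> carrier R - I" "t \<otimes> r \<in> carrier R - I"
    using denom_mult a b c by blast+
  have DD: "(s \<otimes> t) \<otimes> r \<in> carrier R - I" "(s \<otimes> r) \<otimes> (t \<otimes> r) \<in> carrier R - I"
    using denom_mult D c by blast+
  have "(k \<oplus>\<^bsub>L\<^esub> l) \<otimes>\<^bsub>L\<^esub> m = fr ((a \<otimes> t \<oplus> b \<otimes> s) \<otimes> c) ((s \<otimes> t) \<otimes> r)"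
    using a b c D st by (simp add: frac_add frac_mult)
  also have "\<dots> = fr ((a \<otimes> c) \<otimes> (t \<otimes> r) \<oplus> (b \<otimes> c) \<otimes> (s \<otimes> r)) ((s \<otimes> r) \<otimes> (t \<otimes> r))"
    using a(1) b(1) c(1) st DD by (intro frac_eqI) (simp_all add: m_ac l_distr r_distr)
  also have "\<dots> = k \<otimes>\<^bsub>L\<^esub> m \<oplus>\<^bsub>L\<^esub> l \<otimes>\<^bsub>L\<^esub> m"
    using a b c D st by (simp add: frac_add frac_mult)
  finally show "(k \<oplus>\<^bsub>L\<^esub> l) \<otimes>\<^bsub>L\<^esub> m = k \<otimes>\<^bsub>L\<^esub> m \<oplus>\<^bsub>L\<^esub> l \<otimes>\<^bsub>L\<^esub> m" .
qed

lemma frac_ring_hom: "ring_hom_cring R L (\<lambda>a. fr a \<one>)"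
proof (rule ring_hom_cringI[OF cring_axioms localization_cring], rule ring_hom_memI)
qed (use denom_one in \<open>simp_all add: frac_closed frac_mult frac_add frac_one\<close>)

lemma frac_cancel:
  assumes "a \<in> carrier R" "s \<in> carrier R - I"
  shows "fr (a \<otimes> s) s = fr a \<one>"
  using assms denom_one by (intro frac_eqI) auto

lemma frac_unit: "s \<in> carrier R - I \<Longrightarrow> fr s \<one> \<in> Units L"
proof -
  assume s: "s \<in> carrier R - I"
  then have c: "s \<in> carrier R" by blast
  have "fr s s = fr \<one> \<one>" using s denom_one by (intro frac_eqI) auto
  then have "fr s \<one> \<otimes>\<^bsub>L\<^esub> fr \<one> s = \<one>\<^bsub>L\<^esub>" "fr \<one> s \<otimes>\<^bsub>L\<^esub> fr s \<one> = \<one>\<^bsub>L\<^esub>"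
    using s c denom_one by (simp_all add: frac_mult frac_one)
  moreover have "fr s \<one> \<in> carrier L" "fr \<one> s \<in> carrier L"
    using s denom_one by (auto intro: frac_closed)
  ultimately show ?thesis unfolding Units_def by blast
qed

lemma frac_surj:
  assumes "l \<in> carrier L"
  shows "\<exists>a\<in>carrier R. \<exists>s\<in>carrier R - I. l \<otimes>\<^bsub>L\<^esub> fr s \<one> = fr a \<one>"
proof -
  obtain a s where a: "a \<in> carrier R" "s \<in> carrier R - I" "l = fr a s" using fracE[OF assms] .
  then have "l \<otimes>\<^bsub>L\<^esub> fr s \<one> = fr a \<one>"
    using denom_one frac_cancel[OF a(1,2)] by (simp add: frac_mult)
  with a show ?thesis by blast
qed

lemma frac_kernel:
  assumes "a \<in> carrier R"
  shows "fr a \<one> = \<zero>\<^bsub>L\<^esub> \<longleftrightarrow> (\<exists>u\<in>carrier R - I. u \<otimes> a = \<zero>)"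
proof -
  have "fr a \<one> = \<zero>\<^bsub>L\<^esub> \<longleftrightarrow> (\<exists>u\<in>carrier R - I. u \<otimes> (a \<otimes> \<one>) = u \<otimes> (\<zero> \<otimes> \<one>))"
    unfolding frac_zero using assms denom_one by (intro frac_eq_iff) auto
  also have "\<dots> \<longleftrightarrow> (\<exists>u\<in>carrier R - I. u \<otimes> a = \<zero>)"
    using assms by (intro bex_cong) auto
  finally show ?thesis .
qed

end

text \<open>
  The composite \<open>S \<rightarrow> S/I \<rightarrow> (S/I)\<^sub>P\<close> is described by its values on denominators, its image and its
  kernel, so that the two-step construction need not be unfolded again.
\<close>

locale quotient_localization = ring_hom_cring S L \<phi>
  for S (structure) and L and \<phi> +
  fixes I P
  assumes P: "primeideal P S" and I: "ideal I S" and I_sub: "I \<subseteq> P"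
    and unit: "s \<in> carrier S - P \<Longrightarrow> \<phi> s \<in> Units L"
    and surj: "l \<in> carrier L \<Longrightarrow> \<exists>a\<in>carrier S. \<exists>s\<in>carrier S - P. l \<otimes>\<^bsub>L\<^esub> \<phi> s = \<phi> a"
    and kernel: "a \<in> carrier S \<Longrightarrow> \<phi> a = \<zero>\<^bsub>L\<^esub> \<longleftrightarrow> (\<exists>u\<in>carrier S - P. u \<otimes> a \<in> I)"

text \<open>The two steps of the construction are merged here once and for all. A class dies in the
  localization exactly if some element outside \<open>M\<close> annihilates it in the quotient;
  lifted to S, some u outside the preimage of \<open>M\<close> multiplies the representative into
  \<open>I\<close>.\<close>

lemma quotient_localization_Quot:
  assumes S: "cring S" and I: "ideal I S" and M: "primeideal M (S Quot I)"
  shows "quotient_localization S (localization (S Quot I) M)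
    (\<lambda>a. loc_frac (S Quot I) M (I +>\<^bsub>S\<^esub> a) \<one>\<^bsub>S Quot I\<^esub>) I {a \<in> carrier S. I +>\<^bsub>S\<^esub> a \<in> M}"
proof -
  interpret S: cring S by fact
  interpret I: ideal I S by fact
  interpret Q: primeideal M "S Quot I" by fact
  interpret \<pi>: ring_hom_cring S "S Quot I" "(+>\<^bsub>S\<^esub>) I" by (rule I.rcos_ring_hom_cring[OF S])
  interpret \<psi>: ring_hom_cring "S Quot I" "localization (S Quot I) M"
    "\<lambda>a. loc_frac (S Quot I) M a \<one>\<^bsub>S Quot I\<^esub>" by (rule Q.frac_ring_hom)
  let ?P = "{a \<in> carrier S. I +>\<^bsub>S\<^esub> a \<in> M}"
  have pre: "\<exists>a\<in>carrier S. q = I +>\<^bsub>S\<^esub> a" if "q \<in> carrier (S Quot I)" for q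
    using that by (auto simp: FactRing_def A_RCOSETS_def' a_r_coset_def)
  have zero_iff: "I +>\<^bsub>S\<^esub> a = \<zero>\<^bsub>S Quot I\<^esub> \<longleftrightarrow> a \<in> I" if "a \<in> carrier S" for a
    using S.a_rcos_zero[OF I, of a] I.rcos_const_imp_mem[of a] that
    unfolding FactRing_def by simp blast
  have zM: "\<zero>\<^bsub>S Quot I\<^esub> \<in> M" by (rule additive_subgroup.zero_closed[OF Q.additive_subgroup_axioms])
  show ?thesis
  proof (rule quotient_localization.intro, goal_cases)
    case 1
    have "(\<lambda>a. loc_frac (S Quot I) M (I +>\<^bsub>S\<^esub> a) \<one>\<^bsub>S Quot I\<^esub>) \<in> ring_hom S (localization (S Quot I) M)"
      by (intro ring_hom_memI) (auto simp del: FactRing_simps)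
    then show ?case by (rule ring_hom_cringI[OF S Q.localization_cring])
  next
    case 2
    show ?case
    proof (rule quotient_localization_axioms.intro)
      have idP: "ideal ?P S" using \<pi>.ring.ideal_vimage[OF Q.is_ideal] .
      show "primeideal ?P S"
      proof (rule primeidealI[OF idP S])
        have "\<one>\<^bsub>S\<^esub> \<notin> ?P" using Q.one_notin \<pi>.hom_one by auto
        then show "carrier S \<noteq> ?P" by blast
        show "a \<in> ?P \<or> b \<in> ?P" if "a \<in> carrier S" "b \<in> carrier S" "a \<otimes>\<^bsub>S\<^esub> b \<in> ?P" for a b
          using that Q.I_prime[of "I +>\<^bsub>S\<^esub> a" "I +>\<^bsub>S\<^esub> b"] by auto
      qed
      show "ideal I S" by fact
      show "I \<subseteq> ?P"
      proof
        fix a assume "a \<in> I"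
        then have "a \<in> carrier S" "I +>\<^bsub>S\<^esub> a = \<zero>\<^bsub>S Quot I\<^esub>" using I.Icarr zero_iff by blast+
        then show "a \<in> ?P" using zM by simp
      qed
    next
      fix s assume "s \<in> carrier S - ?P"
      then show "loc_frac (S Quot I) M (I +>\<^bsub>S\<^esub> s) \<one>\<^bsub>S Quot I\<^esub> \<in> Units (localization (S Quot I) M)"
        by (intro Q.frac_unit DiffI \<pi>.hom_closed) auto
    next
      fix l assume "l \<in> carrier (localization (S Quot I) M)"
      then obtain q t where qt: "q \<in> carrier (S Quot I)" "t \<in> carrier (S Quot I) - M"
        "l \<otimes>\<^bsub>localization (S Quot I) M\<^esub> loc_frac (S Quot I) M t \<one>\<^bsub>S Quot I\<^esub> =
          loc_frac (S Quot I) M q \<one>\<^bsub>S Quot I\<^esub>"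
        using Q.frac_surj by blast
      obtain a s where as: "a \<in> carrier S" "q = I +>\<^bsub>S\<^esub> a" "s \<in> carrier S" "t = I +>\<^bsub>S\<^esub> s"
        using pre qt by (metis DiffD1)
      have s: "s \<in> carrier S - ?P" using as qt(2) by simp
      show "\<exists>a\<in>carrier S. \<exists>s\<in>carrier S - ?P.
          l \<otimes>\<^bsub>localization (S Quot I) M\<^esub> loc_frac (S Quot I) M (I +>\<^bsub>S\<^esub> s) \<one>\<^bsub>S Quot I\<^esub> =
          loc_frac (S Quot I) M (I +>\<^bsub>S\<^esub> a) \<one>\<^bsub>S Quot I\<^esub>"
        by (rule bexI[OF bexI[OF _ s] as(1)]) (use qt(3) as(2,4) in \<open>simp only:\<close>)
    next
      fix a assume a: "a \<in> carrier S"
      have "loc_frac (S Quot I) M (I +>\<^bsub>S\<^esub> a) \<one>\<^bsub>S Quot I\<^esub> = \<zero>\<^bsub>localization (S Quot I) M\<^esub> \<longleftrightarrow>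
        (\<exists>q\<in>carrier (S Quot I) - M. q \<otimes>\<^bsub>S Quot I\<^esub> (I +>\<^bsub>S\<^esub> a) = \<zero>\<^bsub>S Quot I\<^esub>)"
        using a by (intro Q.frac_kernel \<pi>.hom_closed)
      also have "\<dots> \<longleftrightarrow> (\<exists>u\<in>carrier S - ?P. (I +>\<^bsub>S\<^esub> u) \<otimes>\<^bsub>S Quot I\<^esub> (I +>\<^bsub>S\<^esub> a) = \<zero>\<^bsub>S Quot I\<^esub>)"
      proof
        assume "\<exists>q\<in>carrier (S Quot I) - M. q \<otimes>\<^bsub>S Quot I\<^esub> (I +>\<^bsub>S\<^esub> a) = \<zero>\<^bsub>S Quot I\<^esub>"
        then obtain q where q: "q \<in> carrier (S Quot I)" "q \<notin> M"
          "q \<otimes>\<^bsub>S Quot I\<^esub> (I +>\<^bsub>S\<^esub> a) = \<zero>\<^bsub>S Quot I\<^esub>" by blast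
        obtain u where "u \<in> carrier S" "q = I +>\<^bsub>S\<^esub> u" using pre[OF q(1)] by blast
        then show "\<exists>u\<in>carrier S - ?P. (I +>\<^bsub>S\<^esub> u) \<otimes>\<^bsub>S Quot I\<^esub> (I +>\<^bsub>S\<^esub> a) = \<zero>\<^bsub>S Quot I\<^esub>"
          using q by blast
      next
        assume "\<exists>u\<in>carrier S - ?P. (I +>\<^bsub>S\<^esub> u) \<otimes>\<^bsub>S Quot I\<^esub> (I +>\<^bsub>S\<^esub> a) = \<zero>\<^bsub>S Quot I\<^esub>"
        then show "\<exists>q\<in>carrier (S Quot I) - M. q \<otimes>\<^bsub>S Quot I\<^esub> (I +>\<^bsub>S\<^esub> a) = \<zero>\<^bsub>S Quot I\<^esub>"
          using \<pi>.hom_closed by blast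
      qed
      also have "\<dots> \<longleftrightarrow> (\<exists>u\<in>carrier S - ?P. u \<otimes>\<^bsub>S\<^esub> a \<in> I)"
      proof (intro bex_cong refl)
        fix u assume "u \<in> carrier S - ?P"
        then have "u \<in> carrier S" by blast
        then show "(I +>\<^bsub>S\<^esub> u) \<otimes>\<^bsub>S Quot I\<^esub> (I +>\<^bsub>S\<^esub> a) = \<zero>\<^bsub>S Quot I\<^esub> \<longleftrightarrow> u \<otimes>\<^bsub>S\<^esub> a \<in> I"
          using a zero_iff[of "u \<otimes>\<^bsub>S\<^esub> a"] \<pi>.hom_mult by simp
      qed
      finally show "loc_frac (S Quot I) M (I +>\<^bsub>S\<^esub> a) \<one>\<^bsub>S Quot I\<^esub> = \<zero>\<^bsub>localization (S Quot I) M\<^esub> \<longleftrightarrow>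
        (\<exists>u\<in>carrier S - ?P. u \<otimes>\<^bsub>S\<^esub> a \<in> I)" .
    qed
  qed
qed

section \<open>Extension and contraction of ideals and of prime chains\<close>

context quotient_localization
begin

interpretation P: primeideal P S by (rule P)

text \<open>The ideal generated by the image of \<open>J\<close>. It is described by clearing
  denominators, since the locale does not represent elements of L as fractions and only provides
  equations between l times \<open>\<phi> s\<close> and \<open>\<phi> a\<close>.\<close>

definition extension :: "'a set \<Rightarrow> 'c set" where
  "extension J = {l \<in> carrier L. \<exists>a\<in>J. \<exists>s\<in>carrier S - P. l \<otimes>\<^bsub>L\<^esub> \<phi> s = \<phi> a}"

definition contraction :: "'c set \<Rightarrow> 'a set" where
  "contraction N = {a \<in> carrier S. \<phi> a \<in> N}"

lemma unit': "s \<in> carrier S \<Longrightarrow> s \<notin> P \<Longrightarrow> \<phi> s \<in> Units L"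
  using unit by blast

lemma surjE:
  assumes "l \<in> carrier L"
  obtains a s where "a \<in> carrier S" "s \<in> carrier S" "s \<notin> P" "l \<otimes>\<^bsub>L\<^esub> \<phi> s = \<phi> a"
  using surj[OF assms] by blast

lemma kernel_I: "a \<in> I \<Longrightarrow> \<phi> a = \<zero>\<^bsub>L\<^esub>"
proof -
  assume a: "a \<in> I"
  have "a \<in> carrier S" using R.ideal_closed(6)[OF I a] .
  moreover have "\<one> \<otimes> a \<in> I" using a calculation by simp
  ultimately show ?thesis using kernel P.denom_one by blast
qed

lemma extension_ideal:
  assumes J: "ideal J S"
  shows "ideal (extension J) L"
proof (rule S.idealI_cring)
  note J' = R.ideal_closed[OF J]
  show "extension J \<subseteq> carrier L" by (auto simp: extension_def)
  have "\<zero>\<^bsub>L\<^esub> \<otimes>\<^bsub>L\<^esub> \<phi> \<one> = \<phi> \<zero>" by simp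
  then show "\<zero>\<^bsub>L\<^esub> \<in> extension J" using J'(2) P.denom_one unfolding extension_def by blast
next
  note J' = R.ideal_closed[OF J]
  fix l m assume "l \<in> extension J" "m \<in> extension J"
  then obtain a s b t where *: "l \<in> carrier L" "a \<in> J" "s \<in> carrier S - P" "l \<otimes>\<^bsub>L\<^esub> \<phi> s = \<phi> a"
    "m \<in> carrier L" "b \<in> J" "t \<in> carrier S - P" "m \<otimes>\<^bsub>L\<^esub> \<phi> t = \<phi> b"
    unfolding extension_def by blast
  have c: "a \<in> carrier S" "b \<in> carrier S" "s \<in> carrier S" "t \<in> carrier S" using * J'(6) by auto
  have "(l \<oplus>\<^bsub>L\<^esub> m) \<otimes>\<^bsub>L\<^esub> \<phi> (s \<otimes> t) =
      (l \<otimes>\<^bsub>L\<^esub> \<phi> s) \<otimes>\<^bsub>L\<^esub> \<phi> t \<oplus>\<^bsub>L\<^esub> (m \<otimes>\<^bsub>L\<^esub> \<phi> t) \<otimes>\<^bsub>L\<^esub> \<phi> s"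
    using *(1,5) c by (simp add: S.m_ac S.r_distr)
  also have "\<dots> = \<phi> (a \<otimes> t \<oplus> b \<otimes> s)" unfolding *(4,8) using c by simp
  finally have eq: "(l \<oplus>\<^bsub>L\<^esub> m) \<otimes>\<^bsub>L\<^esub> \<phi> (s \<otimes> t) = \<phi> (a \<otimes> t \<oplus> b \<otimes> s)" .
  have "a \<otimes> t \<oplus> b \<otimes> s \<in> J" using J'(3)[OF J'(7)[OF *(2) c(4)] J'(7)[OF *(6) c(3)]] .
  moreover have "s \<otimes> t \<in> carrier S - P" by (rule P.denom_mult[OF *(3,7)])
  ultimately show "l \<oplus>\<^bsub>L\<^esub> m \<in> extension J" using eq *(1,5) unfolding extension_def by blast
next
  note J' = R.ideal_closed[OF J]
  fix r l assume r: "r \<in> carrier L" and "l \<in> extension J"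
  then obtain a s where *: "l \<in> carrier L" "a \<in> J" "s \<in> carrier S - P" "l \<otimes>\<^bsub>L\<^esub> \<phi> s = \<phi> a"
    unfolding extension_def by blast
  obtain c t where ct: "c \<in> carrier S" "t \<in> carrier S - P" "r \<otimes>\<^bsub>L\<^esub> \<phi> t = \<phi> c" using surj[OF r] by blast
  have cc: "a \<in> carrier S" "s \<in> carrier S" "t \<in> carrier S" using * J'(6) ct by auto
  have "(r \<otimes>\<^bsub>L\<^esub> l) \<otimes>\<^bsub>L\<^esub> \<phi> (t \<otimes> s) = (r \<otimes>\<^bsub>L\<^esub> \<phi> t) \<otimes>\<^bsub>L\<^esub> (l \<otimes>\<^bsub>L\<^esub> \<phi> s)"
    using r *(1) cc by (simp add: S.m_ac)
  also have "\<dots> = \<phi> (c \<otimes> a)" unfolding ct(3) *(4) using ct cc by simp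
  finally have eq: "(r \<otimes>\<^bsub>L\<^esub> l) \<otimes>\<^bsub>L\<^esub> \<phi> (t \<otimes> s) = \<phi> (c \<otimes> a)" .
  have "c \<otimes> a \<in> J" by (rule J'(4)[OF ct(1) *(2)])
  moreover have "t \<otimes> s \<in> carrier S - P" by (rule P.denom_mult[OF ct(2) *(3)])
  ultimately show "r \<otimes>\<^bsub>L\<^esub> l \<in> extension J" using eq r *(1) unfolding extension_def by blast
qed

lemma contraction_ideal: "ideal N L \<Longrightarrow> ideal (contraction N) S"
  unfolding contraction_def by (rule ring.ideal_vimage)

lemma image_in_extension:
  assumes "ideal J S" "a \<in> J"
  shows "\<phi> a \<in> extension J"
proof -
  have a: "a \<in> carrier S" using R.ideal_closed(6)[OF assms] .
  then have "\<phi> a \<otimes>\<^bsub>L\<^esub> \<phi> \<one> = \<phi> a" by simp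
  then show ?thesis using a assms(2) P.denom_one unfolding extension_def by blast
qed

text \<open>In general only the saturation of \<open>J\<close> by the complement of \<open>P\<close>
  is recovered: an equation in L holds in S after multiplication by some u outside \<open>P\<close>
  and modulo \<open>I\<close>, and \<open>I\<close> is absorbed by \<open>J\<close>.\<close>

lemma image_in_extensionD:
  assumes J: "ideal J S" "I \<subseteq> J" and a: "a \<in> carrier S" "\<phi> a \<in> extension J"
  shows "\<exists>u\<in>carrier S - P. u \<otimes> a \<in> J"
proof -
  note J' = R.ideal_closed[OF J(1)]
  obtain b s where b: "b \<in> J" "s \<in> carrier S" "s \<notin> P" "\<phi> a \<otimes>\<^bsub>L\<^esub> \<phi> s = \<phi> b"
    using a(2) unfolding extension_def by blast
  have bc: "b \<in> carrier S" using J'(6)[OF b(1)] .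
  have "\<phi> (a \<otimes> s \<ominus> b) = \<phi> a \<otimes>\<^bsub>L\<^esub> \<phi> s \<ominus>\<^bsub>L\<^esub> \<phi> b"
    using a b bc by (simp add: a_minus_def)
  also have "\<dots> = \<zero>\<^bsub>L\<^esub>" unfolding b(4) using bc by (simp add: S.r_neg a_minus_def)
  finally obtain u where u: "u \<in> carrier S - P" "u \<otimes> (a \<otimes> s \<ominus> b) \<in> I"
    using kernel[of "a \<otimes> s \<ominus> b"] a b bc by auto
  have uc: "u \<in> carrier S" using u by blast
  have "u \<otimes> (a \<otimes> s \<ominus> b) \<oplus> u \<otimes> b \<in> J"
    using J'(3)[OF subsetD[OF J(2) u(2)] J'(4)[OF uc b(1)]] .
  moreover have "u \<otimes> (a \<otimes> s \<ominus> b) \<oplus> u \<otimes> b = (u \<otimes> s) \<otimes> a"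
    using uc a(1) b(2) bc by algebra
  ultimately have "(u \<otimes> s) \<otimes> a \<in> J" by simp
  moreover have "u \<otimes> s \<in> carrier S - P" using P.denom_mult u b by blast
  ultimately show ?thesis by blast
qed

lemma mem_ideal_iff_numerator:
  assumes "ideal N L" "l \<in> carrier L" "s \<in> carrier S" "s \<notin> P" "l \<otimes>\<^bsub>L\<^esub> \<phi> s = \<phi> a"
  shows "l \<in> N \<longleftrightarrow> \<phi> a \<in> N"
proof
  show "\<phi> a \<in> N" if "l \<in> N"
    using S.ideal_closed(7)[OF assms(1) that hom_closed[OF assms(3)]] assms(5) by simp
  show "l \<in> N" if "\<phi> a \<in> N"
    using S.ideal_unit_cancel[OF assms(1) unit'[OF assms(3,4)] assms(2)] that assms(5) by simp
qed

text \<open>Denominators are units, so an ideal of L is determined by the numerators it contains.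
  Hence contraction is injective on ideals, which keeps the inclusions of a contracted prime chain
  strict.\<close>

lemma extension_contraction:
  assumes N: "ideal N L"
  shows "extension (contraction N) = N"
proof
  show "extension (contraction N) \<subseteq> N"
    using mem_ideal_iff_numerator[OF N] unfolding extension_def contraction_def by blast
  show "N \<subseteq> extension (contraction N)"
  proof
    fix l assume l: "l \<in> N"
    then have lc: "l \<in> carrier L" using S.ideal_closed(6)[OF N] by blast
    obtain a s where *: "a \<in> carrier S" "s \<in> carrier S" "s \<notin> P" "l \<otimes>\<^bsub>L\<^esub> \<phi> s = \<phi> a"
      using surjE[OF lc] .
    then have "a \<in> contraction N"
      using mem_ideal_iff_numerator[OF N lc *(2-4)] l unfolding contraction_def by blast
    then show "l \<in> extension (contraction N)" using * lc unfolding extension_def by blast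
  qed
qed

text \<open>Finiteness is inherited along contraction: generators of the contracted ideal, mapped by
  \<open>\<phi>\<close>, generate the given one.\<close>

lemma localization_noetherian:
  assumes "noetherian_ring S"
  shows "noetherian_ring L"
proof (rule S.noetherian_ringI)
  fix N assume N: "ideal N L"
  obtain A where A: "A \<subseteq> carrier S" "finite A" "contraction N = Idl A"
    using noetherian_ring.finetely_gen[OF assms contraction_ideal[OF N]] by blast
  have AL: "\<phi> ` A \<subseteq> carrier L" using A(1) by auto
  let ?K = "Idl\<^bsub>L\<^esub> (\<phi> ` A)"
  have K: "ideal ?K L" using AL by (rule S.genideal_ideal)
  have "A \<subseteq> contraction N" using R.genideal_self[OF A(1)] A(3) by simp
  then have "\<phi> ` A \<subseteq> N" unfolding contraction_def by blast
  then have "?K \<subseteq> N" by (rule S.genideal_minimal[OF N])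
  moreover have "N \<subseteq> ?K"
  proof -
    have "A \<subseteq> contraction ?K"
      using S.genideal_self[OF AL] A(1) unfolding contraction_def by blast
    then have "contraction N \<subseteq> contraction ?K"
      unfolding A(3) by (rule R.genideal_minimal[OF contraction_ideal[OF K]])
    then have "extension (contraction N) \<subseteq> extension (contraction ?K)"
      unfolding extension_def by blast
    then show ?thesis using extension_contraction N K by simp
  qed
  ultimately show "\<exists>B\<subseteq>carrier L. finite B \<and> N = Idl\<^bsub>L\<^esub> B"
    using A(2) AL by (intro exI[of _ "\<phi> ` A"]) auto
qed

lemma extension_unit:
  assumes "l \<in> carrier L - extension P"
  shows "l \<in> Units L"
proof -
  have lc: "l \<in> carrier L" using assms by blast
  obtain a s where *: "a \<in> carrier S" "s \<in> carrier S" "s \<notin> P" "l \<otimes>\<^bsub>L\<^esub> \<phi> s = \<phi> a"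
    using surjE[OF lc] .
  then have "a \<notin> P" using assms unfolding extension_def by blast
  then have u: "\<phi> a \<in> Units L" using unit' * by blast
  then have "l \<otimes>\<^bsub>L\<^esub> (\<phi> s \<otimes>\<^bsub>L\<^esub> inv\<^bsub>L\<^esub> (\<phi> a)) = \<one>\<^bsub>L\<^esub>"
    using * lc by (simp add: S.m_assoc[symmetric])
  then show ?thesis
    using u lc *(2) S.m_comm[of l] by (intro S.unit_factor[of l "\<phi> s \<otimes>\<^bsub>L\<^esub> inv\<^bsub>L\<^esub> (\<phi> a)"]) auto
qed

lemma extension_proper:
  assumes "ideal J S" "I \<subseteq> J" "J \<subseteq> P"
  shows "\<one>\<^bsub>L\<^esub> \<notin> extension J"
proof
  assume "\<one>\<^bsub>L\<^esub> \<in> extension J"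
  then have "\<phi> \<one> \<in> extension J" by simp
  then obtain u where u: "u \<in> carrier S" "u \<notin> P" "u \<otimes> \<one> \<in> J"
    using image_in_extensionD[OF assms(1,2) R.one_closed] by blast
  then show False using assms(3) by auto
qed

lemma extension_maximal: "maximalideal (extension P) L"
proof (rule maximalidealI)
  show "ideal (extension P) L" by (rule extension_ideal[OF P.is_ideal])
  show "carrier L \<noteq> extension P" using extension_proper[OF P.is_ideal I_sub] by blast
  fix J assume J: "ideal J L" "extension P \<subseteq> J" "J \<subseteq> carrier L"
  show "J = extension P \<or> J = carrier L"
  proof (cases "J = extension P")
    case False
    then obtain l where "l \<in> J" "l \<notin> extension P" using J(2) by blast
    then show ?thesis using S.ideal_unit[OF J(1)] extension_unit J(3) by blast
  qed simp
qed

lemma maximal_eq_extension: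
  assumes "maximalideal N L"
  shows "N = extension P"
proof -
  interpret N: maximalideal N L by fact
  have "N \<subseteq> extension P"
    using S.ideal_unit[OF N.is_ideal] extension_unit N.I_notcarr N.Icarr by blast
  then have "extension P = N \<or> extension P = carrier L"
    using extension_ideal[OF P.is_ideal] by (intro N.I_maximal) (auto simp: extension_def)
  then show ?thesis using extension_proper[OF P.is_ideal I_sub] by auto
qed

lemma extension_local_ring: "local_ring L (extension P)"
  unfolding local_ring_def
  using extension_maximal maximal_eq_extension S.is_cring by blast

text \<open>For a prime inside \<open>P\<close> saturation changes nothing, since the multiplier u
  lies outside \<open>Q\<close>.\<close>

lemma extension_contracts:
  assumes Q: "primeideal Q S" "I \<subseteq> Q" "Q \<subseteq> P"
  shows "contraction (extension Q) = Q"
proof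
  interpret Q: primeideal Q S by fact
  show "contraction (extension Q) \<subseteq> Q"
  proof
    fix a assume "a \<in> contraction (extension Q)"
    then have a: "a \<in> carrier S" "\<phi> a \<in> extension Q" by (auto simp: contraction_def)
    then obtain u where "u \<in> carrier S" "u \<notin> P" "u \<otimes> a \<in> Q"
      using image_in_extensionD[OF Q.is_ideal Q(2)] by blast
    then show "a \<in> Q" using Q.I_prime a(1) Q(3) by blast
  qed
  show "Q \<subseteq> contraction (extension Q)"
    using image_in_extension[OF Q.is_ideal] Q.Icarr unfolding contraction_def by blast
qed

lemma extension_prime:
  assumes Q: "primeideal Q S" "I \<subseteq> Q" "Q \<subseteq> P"
  shows "primeideal (extension Q) L"
proof -
  interpret Q: primeideal Q S by fact
  have E: "ideal (extension Q) L" by (rule extension_ideal[OF Q.is_ideal])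
  show ?thesis
  proof (rule primeidealI[OF E S.is_cring])
    show "carrier L \<noteq> extension Q" using extension_proper[OF Q.is_ideal Q(2,3)] by blast
    fix l m assume lm: "l \<in> carrier L" "m \<in> carrier L" "l \<otimes>\<^bsub>L\<^esub> m \<in> extension Q"
    obtain a s where a: "a \<in> carrier S" "s \<in> carrier S" "s \<notin> P" "l \<otimes>\<^bsub>L\<^esub> \<phi> s = \<phi> a"
      using surjE[OF lm(1)] .
    obtain b t where b: "b \<in> carrier S" "t \<in> carrier S" "t \<notin> P" "m \<otimes>\<^bsub>L\<^esub> \<phi> t = \<phi> b"
      using surjE[OF lm(2)] .
    have "\<phi> (a \<otimes> b) = (l \<otimes>\<^bsub>L\<^esub> \<phi> s) \<otimes>\<^bsub>L\<^esub> (m \<otimes>\<^bsub>L\<^esub> \<phi> t)" using a b by simp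
    also have "\<dots> = (l \<otimes>\<^bsub>L\<^esub> m) \<otimes>\<^bsub>L\<^esub> \<phi> (s \<otimes> t)" using a(2) b(2) lm by (simp add: S.m_ac)
    also have "\<dots> \<in> extension Q" using S.ideal_closed(7)[OF E lm(3)] a(2) b(2) by simp
    finally have "a \<otimes> b \<in> contraction (extension Q)" using a b unfolding contraction_def by blast
    then have "a \<in> Q \<or> b \<in> Q" using extension_contracts[OF Q] Q.I_prime a(1) b(1) by blast
    then show "l \<in> extension Q \<or> m \<in> extension Q"
      using a b lm unfolding extension_def by blast
  qed
qed

lemma contraction_prime:
  assumes "primeideal N L"
  shows "primeideal (contraction N) S"
proof -
  interpret N: primeideal N L by fact
  show ?thesis
  proof (rule primeidealI[OF contraction_ideal[OF N.is_ideal] R.is_cring])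
    have "\<one> \<notin> contraction N" using N.one_notin by (simp add: contraction_def)
    then show "carrier S \<noteq> contraction N" by blast
    fix a b assume "a \<in> carrier S" "b \<in> carrier S" "a \<otimes> b \<in> contraction N"
    then show "a \<in> contraction N \<or> b \<in> contraction N"
      using N.I_prime[of "\<phi> a" "\<phi> b"] by (auto simp: contraction_def)
  qed
qed

lemma prime_chain_contraction:
  assumes "prime_chain L k N"
  shows "prime_chain S k (\<lambda>i. contraction (N i))" "i \<le> k \<Longrightarrow> I \<subseteq> contraction (N i)"
proof -
  have N: "primeideal (N i) L" if "i \<le> k" for i using assms that by (simp add: prime_chain_def)
  have sub: "contraction (N i) \<subset> contraction (N (Suc i))" if "i < k" for i
  proof -
    have "N i \<subset> N (Suc i)" using assms that by (simp add: prime_chain_def)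
    moreover have "ideal (N i) L" "ideal (N (Suc i)) L"
      using N[of i] N[of "Suc i"] that by (auto simp: primeideal_def)
    ultimately have "contraction (N i) \<noteq> contraction (N (Suc i))"
      using extension_contraction by (metis psubsetE subset_refl)
    moreover have "contraction (N i) \<subseteq> contraction (N (Suc i))"
      using \<open>N i \<subset> N (Suc i)\<close> unfolding contraction_def by blast
    ultimately show ?thesis by blast
  qed
  show "prime_chain S k (\<lambda>i. contraction (N i))"
    using contraction_prime N sub by (simp add: prime_chain_def)
  show "I \<subseteq> contraction (N i)" if "i \<le> k"
  proof
    fix a assume a: "a \<in> I"
    have "ideal (N i) L" using N[OF that] by (rule primeideal.axioms)
    then show "a \<in> contraction (N i)"
      using kernel_I[OF a] R.ideal_closed(6)[OF I a] S.ideal_closed(2) by (simp add: contraction_def)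
  qed
qed

lemma prime_chain_extension:
  assumes "prime_chain S k Q" "I \<subseteq> Q 0" "Q k \<subseteq> P"
  shows "prime_chain L k (\<lambda>i. extension (Q i))"
proof -
  have mono: "Q i \<subseteq> Q j" if "i \<le> j" "j \<le> k" for i j
    using that
  proof (induction j rule: dec_induct)
    case (step j)
    then have "Q j \<subset> Q (Suc j)" using assms(1) by (simp add: prime_chain_def)
    then show ?case using step by auto
  qed simp
  have Q: "primeideal (Q i) S" "I \<subseteq> Q i" "Q i \<subseteq> P" if "i \<le> k" for i
    using assms mono[of 0 i] mono[of i k] that by (auto simp: prime_chain_def)
  have "extension (Q i) \<subset> extension (Q (Suc i))" if "i < k" for i
  proof -
    have s: "Q i \<subset> Q (Suc i)" using assms(1) that by (simp add: prime_chain_def)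
    then have "extension (Q i) \<subseteq> extension (Q (Suc i))" unfolding extension_def by blast
    moreover have "contraction (extension (Q j)) = Q j" if "j \<le> k" for j
      using extension_contracts[OF Q(1)[OF that] Q(2)[OF that] Q(3)[OF that]] .
    then have "contraction (extension (Q i)) = Q i" "contraction (extension (Q (Suc i))) = Q (Suc i)"
      using that by simp_all
    then have "extension (Q i) \<noteq> extension (Q (Suc i))" using s by (metis psubsetE subset_refl)
    ultimately show ?thesis by blast
  qed
  then show ?thesis using extension_prime[OF Q] by (simp add: prime_chain_def)
qed

section \<open>Transfer of regular sequences to the local ring\<close>

lemma image_in_IdlD:
  assumes G: "G \<subseteq> carrier S" and a: "a \<in> carrier S" "\<phi> a \<in> Idl\<^bsub>L\<^esub> (\<phi> ` G)"
  shows "\<exists>u\<in>carrier S - P. u \<otimes> a \<in> Idl (I \<union> G)"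
proof -
  have IG: "I \<union> G \<subseteq> carrier S" using G R.ideal_closed(1)[OF I] by blast
  have J: "ideal (Idl (I \<union> G)) S" by (rule R.genideal_ideal[OF IG])
  have sub: "I \<union> G \<subseteq> Idl (I \<union> G)" by (rule R.genideal_self[OF IG])
  have "\<phi> ` G \<subseteq> extension (Idl (I \<union> G))" using image_in_extension[OF J] sub by blast
  then have "Idl\<^bsub>L\<^esub> (\<phi> ` G) \<subseteq> extension (Idl (I \<union> G))"
    by (rule S.genideal_minimal[OF extension_ideal[OF J]])
  then show ?thesis using image_in_extensionD[OF J _ a(1)] sub a(2) by blast
qed

lemma image_in_IdlI:
  assumes G: "G \<subseteq> carrier S" and a: "a \<in> Idl (I \<union> G)"
  shows "\<phi> a \<in> Idl\<^bsub>L\<^esub> (\<phi> ` G)"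
proof -
  have GL: "\<phi> ` G \<subseteq> carrier L" using G by auto
  have K: "ideal (Idl\<^bsub>L\<^esub> (\<phi> ` G)) L" by (rule S.genideal_ideal[OF GL])
  have "I \<subseteq> contraction (Idl\<^bsub>L\<^esub> (\<phi> ` G))"
    using kernel_I R.ideal_closed(6)[OF I] S.ideal_closed(2)[OF K] by (auto simp: contraction_def)
  moreover have "G \<subseteq> contraction (Idl\<^bsub>L\<^esub> (\<phi> ` G))"
    using S.genideal_self[OF GL] G by (auto simp: contraction_def)
  ultimately have "Idl (I \<union> G) \<subseteq> contraction (Idl\<^bsub>L\<^esub> (\<phi> ` G))"
    by (intro R.genideal_minimal contraction_ideal K) auto
  then show ?thesis using a by (auto simp: contraction_def)
qed

text \<open>The hypothesis is stated in S modulo \<open>I\<close>, where it can be checked on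
  polynomials. A relation in L lifts up to a factor u outside \<open>P\<close>; this u is carried
  into the argument of the nonzerodivisor condition and cancelled in L as a unit. Properness follows
  because the images lie in the maximal ideal.\<close>

lemma regular_sequence_localization:
  assumes xs: "set xs \<subseteq> P"
    and reg: "\<And>i a. i < length xs \<Longrightarrow> a \<in> carrier S \<Longrightarrow>
      xs ! i \<otimes> a \<in> Idl (I \<union> set (take i xs)) \<Longrightarrow> a \<in> Idl (I \<union> set (take i xs))"
  shows "regular_sequence L (map \<phi> xs)" "set (map \<phi> xs) \<subseteq> extension P"
proof -
  have xc: "set xs \<subseteq> carrier S" using xs R.ideal_closed(1)[OF P.is_ideal] by blast
  show sub: "set (map \<phi> xs) \<subseteq> extension P" using image_in_extension[OF P.is_ideal] xs by auto
  show "regular_sequence L (map \<phi> xs)"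
    unfolding regular_sequence_def
  proof (intro conjI allI impI ballI)
    show "set (map \<phi> xs) \<subseteq> carrier L" using xc by auto
    have "Idl\<^bsub>L\<^esub> (set (map \<phi> xs)) \<subseteq> extension P"
      by (rule S.genideal_minimal[OF extension_ideal[OF P.is_ideal] sub])
    then show "Idl\<^bsub>L\<^esub> (set (map \<phi> xs)) \<noteq> carrier L"
      using extension_proper[OF P.is_ideal I_sub] by blast
    fix i l assume i: "i < length (map \<phi> xs)" and l: "l \<in> carrier L"
      and mem: "map \<phi> xs ! i \<otimes>\<^bsub>L\<^esub> l \<in> Idl\<^bsub>L\<^esub> (set (take i (map \<phi> xs)))"
    let ?G = "set (take i xs)"
    have G: "?G \<subseteq> carrier S" using xc set_take_subset[of i xs] by blast
    have eqG: "set (take i (map \<phi> xs)) = \<phi> ` ?G" by (simp add: take_map)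
    have K: "ideal (Idl\<^bsub>L\<^esub> (\<phi> ` ?G)) L" using G by (intro S.genideal_ideal) auto
    have x: "xs ! i \<in> carrier S" using i xc by auto
    obtain a s where a: "a \<in> carrier S" "s \<in> carrier S" "s \<notin> P" "l \<otimes>\<^bsub>L\<^esub> \<phi> s = \<phi> a"
      using surjE[OF l] .
    have "\<phi> (xs ! i \<otimes> a) = (\<phi> (xs ! i) \<otimes>\<^bsub>L\<^esub> l) \<otimes>\<^bsub>L\<^esub> \<phi> s"
      using a(1,2) x l by (simp add: S.m_assoc a(4))
    also have "\<dots> \<in> Idl\<^bsub>L\<^esub> (\<phi> ` ?G)"
      using S.ideal_closed(7)[OF K _ hom_closed[OF a(2)]] mem i unfolding eqG by simp
    finally obtain u where u: "u \<in> carrier S" "u \<notin> P" "u \<otimes> (xs ! i \<otimes> a) \<in> Idl (I \<union> ?G)"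
      using image_in_IdlD[OF G _, of "xs ! i \<otimes> a"] x a(1) by auto
    have "xs ! i \<otimes> (u \<otimes> a) \<in> Idl (I \<union> ?G)"
      using u x a(1) by (simp add: R.m_lcomm)
    then have "u \<otimes> a \<in> Idl (I \<union> ?G)" using reg[of i "u \<otimes> a"] i u(1) a(1) by simp
    then have "\<phi> (u \<otimes> a) \<in> Idl\<^bsub>L\<^esub> (\<phi> ` ?G)" by (rule image_in_IdlI[OF G])
    then have "\<phi> a \<otimes>\<^bsub>L\<^esub> \<phi> u \<in> Idl\<^bsub>L\<^esub> (\<phi> ` ?G)" using u(1) a(1) by (simp add: S.m_comm)
    then have "\<phi> a \<in> Idl\<^bsub>L\<^esub> (\<phi> ` ?G)"
      using S.ideal_unit_cancel[OF K unit'[OF u(1,2)] hom_closed[OF a(1)]] by blast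
    then show "l \<in> Idl\<^bsub>L\<^esub> (set (take i (map \<phi> xs)))"
      using mem_ideal_iff_numerator[OF K l a(2-4)] unfolding eqG by blast
  qed
qed

end

section \<open>Polynomials in the vertices\<close>

abbreviation lookup :: "('a \<Rightarrow>\<^sub>0 'b::zero) \<Rightarrow> 'a \<Rightarrow> 'b" where
  "lookup \<equiv> Poly_Mapping.lookup"

text \<open>The carrier of \<open>vertex_ring V\<close> as a plain set: computations then run in the
  type itself with its own operations, and the rings for different \<open>V\<close> share their
  elements.\<close>

definition polys :: "'v set \<Rightarrow> ('v, 'k::field) vpoly set" where
  "polys V = {p. \<forall>m\<in>Poly_Mapping.keys p. Poly_Mapping.keys m \<subseteq> V}"

abbreviation const :: "'k::field \<Rightarrow> ('v, 'k) vpoly" where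
  "const c \<equiv> Poly_Mapping.single 0 c"

lemma poly_mapping_sum_single:
  "(p :: 'a \<Rightarrow>\<^sub>0 'b::comm_monoid_add) =
    (\<Sum>m\<in>Poly_Mapping.keys p. Poly_Mapping.single m (lookup p m))"
proof (rule poly_mapping_eqI)
  fix k
  have "lookup (\<Sum>m\<in>Poly_Mapping.keys p. Poly_Mapping.single m (lookup p m)) k =
      (\<Sum>m\<in>Poly_Mapping.keys p. if m = k then lookup p m else 0)"
    unfolding lookup_sum by (intro sum.cong) (auto simp: lookup_single when_def)
  also have "\<dots> = lookup p k" by (simp add: in_keys_iff)
  finally show "lookup p k = lookup (\<Sum>m\<in>Poly_Mapping.keys p. Poly_Mapping.single m (lookup p m)) k" ..
qed

text \<open>The terms of the last case have exponents from \<open>p\<close> itself, so that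
  restrictions on the monomials of \<open>p\<close> are available there, while their coefficients
  are arbitrary.\<close>

lemma poly_mapping_single_induct [case_names zero add single]:
  fixes p :: "'a \<Rightarrow>\<^sub>0 'b::comm_monoid_add"
  assumes zero: "Q 0" and add: "\<And>q r. Q q \<Longrightarrow> Q r \<Longrightarrow> Q (q + r)"
    and single: "\<And>m c. m \<in> Poly_Mapping.keys p \<Longrightarrow> Q (Poly_Mapping.single m c)"
  shows "Q p"
proof -
  have "Q (\<Sum>m\<in>A. Poly_Mapping.single m (lookup p m))" if "A \<subseteq> Poly_Mapping.keys p" "finite A" for A
    using that(2,1) by (induction A rule: finite_induct) (auto intro: zero add single)
  from this[of "Poly_Mapping.keys p"] show ?thesis
    using poly_mapping_sum_single[of p] by simp
qed

lemma keys_plus_nat: "Poly_Mapping.keys (m + n) = Poly_Mapping.keys m \<union> Poly_Mapping.keys n"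
  for m n :: "'v \<Rightarrow>\<^sub>0 nat"
  by (auto simp: in_keys_iff lookup_add)

lemma polys_closed:
  "0 \<in> polys V" "1 \<in> polys V" "const c \<in> polys V"
  "p \<in> polys V \<Longrightarrow> q \<in> polys V \<Longrightarrow> p + q \<in> polys V"
  "p \<in> polys V \<Longrightarrow> q \<in> polys V \<Longrightarrow> p * q \<in> polys V"
  "p \<in> polys V \<Longrightarrow> - p \<in> polys V"
  "p \<in> polys V \<Longrightarrow> q \<in> polys V \<Longrightarrow> p - q \<in> polys V"
  for p q :: "('v, 'k::field) vpoly"
proof -
  show add: "p + q \<in> polys V" if "p \<in> polys V" "q \<in> polys V" for p q
    using that keys_add[of p q] unfolding polys_def by blast
  show "p * q \<in> polys V" if "p \<in> polys V" "q \<in> polys V"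
    using that keys_mult[of p q] unfolding polys_def by (fastforce simp: keys_plus_nat)
  have neg: "- p \<in> polys V" if "p \<in> polys V" for p
    using that unfolding polys_def by (auto simp: in_keys_iff)
  then show "p \<in> polys V \<Longrightarrow> - p \<in> polys V" .
  show "p - q \<in> polys V" if "p \<in> polys V" "q \<in> polys V"
    using add[OF that(1) neg[OF that(2)]] by simp
qed (auto simp: polys_def)

lemma polys_single: "Poly_Mapping.keys m \<subseteq> V \<Longrightarrow> Poly_Mapping.single m c \<in> polys V"
  by (auto simp: polys_def)

lemma polys_var: "v \<in> V \<Longrightarrow> vertex_var v \<in> polys V"
  by (auto simp: polys_def vertex_var_def)

lemma polys_mono: "V \<subseteq> W \<Longrightarrow> polys V \<subseteq> polys W"
  by (auto simp: polys_def)

lemma polys_power: "p \<in> polys V \<Longrightarrow> p ^ k \<in> polys V"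
  by (induction k) (auto intro: polys_closed)

lemma polys_sum: "(\<And>i. i \<in> A \<Longrightarrow> f i \<in> polys V) \<Longrightarrow> sum f A \<in> polys V"
  by (induction A rule: infinite_finite_induct) (auto intro: polys_closed)

lemma polys_prod: "(\<And>i. i \<in> A \<Longrightarrow> f i \<in> polys V) \<Longrightarrow> prod f A \<in> polys V"
  by (induction A rule: infinite_finite_induct) (auto intro: polys_closed)

lemmas polys_intros = polys_closed polys_single polys_var polys_power polys_sum polys_prod

lemma single_var_power: "vertex_var v ^ k = Poly_Mapping.single (Poly_Mapping.single v k) 1"
  by (induction k) (simp_all add: vertex_var_def mult_single single_add[symmetric])

lemma const_mult: "const c * const d = const (c * d)"
  by (simp add: mult_single)

lemma const_inverse: "c \<noteq> 0 \<Longrightarrow> const (inverse c) * const c = 1"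
  by (simp add: mult_single)

lemma polys_empty: "p \<in> polys {} \<longleftrightarrow> p = const (lookup p 0)"
proof
  assume "p \<in> polys {}"
  then have "Poly_Mapping.keys p \<subseteq> {0}" unfolding polys_def by fastforce
  then show "p = const (lookup p 0)"
    by (intro poly_mapping_eqI) (auto simp: lookup_single when_def in_keys_iff)
next
  assume "p = const (lookup p 0)"
  then show "p \<in> polys {}" by (metis polys_closed(3))
qed

text \<open>Monomials are built up one variable at a time, so a property only has to survive
  multiplication by a single vertex of \<open>V\<close>.\<close>

lemma polys_induct [consumes 1, case_names zero one add const var]:
  assumes "p \<in> polys V"
    and "Q 0" "Q 1" "\<And>p q. Q p \<Longrightarrow> Q q \<Longrightarrow> Q (p + q)" "\<And>c p. Q p \<Longrightarrow> Q (const c * p)"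
    and var: "\<And>v p. v \<in> V \<Longrightarrow> Q p \<Longrightarrow> Q (vertex_var v * p)"
  shows "Q p"
proof (rule poly_mapping_single_induct[of Q p])
  fix m :: "'a \<Rightarrow>\<^sub>0 nat" and c :: 'b assume "m \<in> Poly_Mapping.keys p"
  then have "Poly_Mapping.keys m \<subseteq> V" using assms(1) by (auto simp: polys_def)
  have vpow: "Q (vertex_var v ^ k * q)" if "Q q" "v \<in> V" for v k q
    by (induction k) (use that var in \<open>auto simp: mult.assoc\<close>)
  have "Q (Poly_Mapping.single (\<Sum>v\<in>A. Poly_Mapping.single v (lookup m v)) 1)"
    if "A \<subseteq> Poly_Mapping.keys m" "finite A" for A
    using that(2,1)
  proof (induction A rule: finite_induct)
    case (insert v A)
    then have "Q (vertex_var v ^ lookup m v *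
        Poly_Mapping.single (\<Sum>v\<in>A. Poly_Mapping.single v (lookup m v)) 1)"
      using \<open>Poly_Mapping.keys m \<subseteq> V\<close> by (intro vpow) auto
    then show ?case using insert by (simp add: single_var_power mult_single)
  qed (use assms(3) in simp)
  from this[of "Poly_Mapping.keys m"] have "Q (Poly_Mapping.single m 1)"
    using poly_mapping_sum_single[of m] by simp
  then have "Q (const c * Poly_Mapping.single m 1)" by (rule assms(5))
  then show "Q (Poly_Mapping.single m c)" by (simp add: mult_single)
qed (use assms in auto)

lemma vertex_ring_simps:
  "carrier (vertex_ring V) = polys V" "mult (vertex_ring V) = (*)" "\<one>\<^bsub>vertex_ring V\<^esub> = 1"
  "\<zero>\<^bsub>vertex_ring V\<^esub> = 0" "add (vertex_ring V) = (+)"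
  by (simp_all add: vertex_ring_def polys_def)

lemma vertex_ring_cring: "cring (vertex_ring V :: ('v, 'k::field) vpoly ring)"
proof (rule cringI)
  show "abelian_group (vertex_ring V :: ('v, 'k) vpoly ring)"
  proof (rule abelian_groupI)
    show "\<exists>q\<in>carrier (vertex_ring V). q \<oplus>\<^bsub>vertex_ring V\<^esub> p = \<zero>\<^bsub>vertex_ring V\<^esub>"
      if "p \<in> carrier (vertex_ring V)" for p :: "('v, 'k) vpoly"
      using that by (intro bexI[of _ "- p"]) (auto simp: vertex_ring_simps polys_closed)
  qed (auto simp: vertex_ring_simps polys_closed add.assoc add.commute)
  show "comm_monoid (vertex_ring V :: ('v, 'k) vpoly ring)"
    by (rule comm_monoidI) (auto simp: vertex_ring_simps polys_closed mult.assoc mult.commute)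
qed (auto simp: vertex_ring_simps distrib_right)

lemma vertex_ring_uminus:
  assumes "p \<in> polys V"
  shows "\<ominus>\<^bsub>vertex_ring V\<^esub> p = - p"
proof -
  interpret cring "vertex_ring V" by (rule vertex_ring_cring)
  show ?thesis
    using minus_equality[of "- p" p] assms by (simp add: vertex_ring_simps polys_closed)
qed

lemma vertex_ring_ideal_iff:
  "ideal J (vertex_ring V) \<longleftrightarrow> J \<subseteq> polys V \<and> 0 \<in> J \<and> (\<forall>p\<in>J. \<forall>q\<in>J. p + q \<in> J) \<and>
    (\<forall>a\<in>polys V. \<forall>p\<in>J. a * p \<in> J)"
proof -
  interpret cring "vertex_ring V" by (rule vertex_ring_cring)
  show ?thesis
  proof
    assume "ideal J (vertex_ring V)"
    then show "J \<subseteq> polys V \<and> 0 \<in> J \<and> (\<forall>p\<in>J. \<forall>q\<in>J. p + q \<in> J) \<and> (\<forall>a\<in>polys V. \<forall>p\<in>J. a * p \<in> J)"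
      using ideal_closed(1-4)[of J] by (auto simp: vertex_ring_simps)
  next
    assume "J \<subseteq> polys V \<and> 0 \<in> J \<and> (\<forall>p\<in>J. \<forall>q\<in>J. p + q \<in> J) \<and> (\<forall>a\<in>polys V. \<forall>p\<in>J. a * p \<in> J)"
    then show "ideal J (vertex_ring V)"
      by (intro idealI_cring) (auto simp: vertex_ring_simps)
  qed
qed

lemma vertex_ring_idealD:
  assumes "ideal J (vertex_ring V)"
  shows "J \<subseteq> polys V" "p \<in> J \<Longrightarrow> p \<in> polys V" "0 \<in> J" "p \<in> J \<Longrightarrow> q \<in> J \<Longrightarrow> p + q \<in> J"
    "a \<in> polys V \<Longrightarrow> p \<in> J \<Longrightarrow> a * p \<in> J" "p \<in> J \<Longrightarrow> - p \<in> J" "p \<in> J \<Longrightarrow> q \<in> J \<Longrightarrow> p - q \<in> J"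
    "(\<And>i. i \<in> A \<Longrightarrow> f i \<in> J) \<Longrightarrow> sum f A \<in> J"
proof -
  note J = assms[unfolded vertex_ring_ideal_iff]
  show sub: "J \<subseteq> polys V" using J by blast
  then show "p \<in> J \<Longrightarrow> p \<in> polys V" by blast
  show z: "0 \<in> J" using J by blast
  show add: "p \<in> J \<Longrightarrow> q \<in> J \<Longrightarrow> p + q \<in> J" for p q using J by blast
  show mult: "a \<in> polys V \<Longrightarrow> p \<in> J \<Longrightarrow> a * p \<in> J" for a p using J by blast
  have neg: "- p \<in> J" if "p \<in> J" for p
    using mult[of "- 1" p] that polys_closed(2,6) by fastforce
  then show "p \<in> J \<Longrightarrow> - p \<in> J" .
  show "p - q \<in> J" if "p \<in> J" "q \<in> J" using add[OF that(1) neg[OF that(2)]] by simp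
  show "sum f A \<in> J" if "\<And>i. i \<in> A \<Longrightarrow> f i \<in> J"
    using that by (induction A rule: infinite_finite_induct) (auto intro: z add)
qed

subsection \<open>Kronecker substitution\<close>

text \<open>The exponent of t after every vertex v is replaced by t to the power \<open>c v\<close>.
  With suitable weights the substitution is injective on finitely many monomials, and it transports
  domain and degree arguments to \<open>'k poly\<close>.\<close>

definition kronecker :: "('v \<Rightarrow> nat) \<Rightarrow> 'v set \<Rightarrow> ('v \<Rightarrow>\<^sub>0 nat) \<Rightarrow> nat" where
  "kronecker c V m = (\<Sum>v\<in>V. lookup m v * c v)"

definition kronecker_eval :: "('v \<Rightarrow> nat) \<Rightarrow> 'v set \<Rightarrow> ('v, 'k::field) vpoly \<Rightarrow> 'k poly" where
  "kronecker_eval c V p = (\<Sum>m\<in>Poly_Mapping.keys p. monom (lookup p m) (kronecker c V m))"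

lemma kronecker_add: "kronecker c V (m + n) = kronecker c V m + kronecker c V n"
  by (simp add: kronecker_def lookup_add algebra_simps sum.distrib)

lemma kronecker_zero: "kronecker c V 0 = 0"
  by (simp add: kronecker_def)

lemma kronecker_eval_superset:
  assumes "finite A" "Poly_Mapping.keys p \<subseteq> A"
  shows "kronecker_eval c V p = (\<Sum>m\<in>A. monom (lookup p m) (kronecker c V m))"
  unfolding kronecker_eval_def using assms
  by (intro sum.mono_neutral_left) (auto simp: in_keys_iff)

lemma kronecker_eval_add: "kronecker_eval c V (p + q) = kronecker_eval c V p + kronecker_eval c V q"
proof -
  let ?A = "Poly_Mapping.keys p \<union> Poly_Mapping.keys q"
  have "kronecker_eval c V (p + q) = (\<Sum>m\<in>?A. monom (lookup (p + q) m) (kronecker c V m))"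
    using keys_add[of p q] by (intro kronecker_eval_superset) auto
  also have "\<dots> = (\<Sum>m\<in>?A. monom (lookup p m) (kronecker c V m)) +
      (\<Sum>m\<in>?A. monom (lookup q m) (kronecker c V m))"
    by (simp add: lookup_add add_monom[symmetric] sum.distrib)
  finally show ?thesis by (simp add: kronecker_eval_superset[of ?A p] kronecker_eval_superset[of ?A q])
qed

lemma kronecker_eval_single: "kronecker_eval c V (Poly_Mapping.single m a) = monom a (kronecker c V m)"
  by (cases "a = 0") (simp_all add: kronecker_eval_def)

lemma kronecker_eval_zero: "kronecker_eval c V 0 = 0"
  by (simp add: kronecker_eval_def)

lemma kronecker_eval_one: "kronecker_eval c V 1 = 1"
  using kronecker_eval_single[of c V 0 1] by (simp add: kronecker_zero)

lemma kronecker_eval_mult: "kronecker_eval c V (p * q) = kronecker_eval c V p * kronecker_eval c V q"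
proof (induction p rule: poly_mapping_single_induct)
  case (single m a)
  show ?case
  proof (induction q rule: poly_mapping_single_induct)
    case (single n b)
    show ?case by (simp add: mult_single kronecker_eval_single kronecker_add mult_monom)
  qed (simp_all add: kronecker_eval_zero kronecker_eval_add algebra_simps)
qed (simp_all add: kronecker_eval_zero kronecker_eval_add algebra_simps)

lemma kronecker_eval_power: "kronecker_eval c V (p ^ k) = kronecker_eval c V p ^ k"
  by (induction k) (simp_all add: kronecker_eval_one kronecker_eval_mult)

lemma kronecker_eval_nonzero:
  assumes "inj_on (kronecker c V) (Poly_Mapping.keys p)" "p \<noteq> 0"
  shows "kronecker_eval c V p \<noteq> 0"
proof -
  obtain m where m: "m \<in> Poly_Mapping.keys p" using assms(2) by (metis all_not_in_conv keys_eq_empty)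
  have "coeff (kronecker_eval c V p) (kronecker c V m) =
      (\<Sum>n\<in>Poly_Mapping.keys p. if n = m then lookup p n else 0)"
    unfolding kronecker_eval_def coeff_sum
  proof (intro sum.cong refl)
    fix n assume "n \<in> Poly_Mapping.keys p"
    then have "kronecker c V n = kronecker c V m \<longleftrightarrow> n = m" using inj_onD[OF assms(1) _ _ m] by blast
    then show "coeff (monom (lookup p n) (kronecker c V n)) (kronecker c V m) =
        (if n = m then lookup p n else 0)" by simp
  qed
  also have "\<dots> = lookup p m" using m by simp
  finally show ?thesis using m by (auto simp: in_keys_iff)
qed

lemma kronecker_separating:
  assumes "finite V" "finite T"
  shows "\<exists>c. (\<forall>v. c v > 0) \<and>
    (\<forall>m\<in>T. \<forall>n\<in>T. kronecker c V m = kronecker c V n \<longrightarrow> (\<forall>v\<in>V. lookup m v = lookup n v))"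
  using assms(1)
proof (induction V rule: finite_induct)
  case empty
  show ?case by (rule exI[of _ "\<lambda>_. 1"]) auto
next
  case (insert v V)
  then obtain c where c: "\<forall>v. c v > 0"
    "\<forall>m\<in>T. \<forall>n\<in>T. kronecker c V m = kronecker c V n \<longrightarrow> (\<forall>v\<in>V. lookup m v = lookup n v)" by blast
  \<comment> \<open>The new weight exceeds the old weights of all members of \<open>T\<close>, so
    division with remainder by \<open>K\<close> recovers the exponent of v and the old weight;
    \<open>Suc\<close> also makes it positive.\<close>
  define K where "K = Suc (\<Sum>m\<in>T. kronecker c V m)"
  have less: "kronecker c V m < K" if "m \<in> T" for m
    unfolding K_def using member_le_sum[of m T "kronecker c V"] that assms(2) by simp
  have eq: "kronecker (c(v := K)) (insert v V) m = lookup m v * K + kronecker c V m" for m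
    using insert(1,2) unfolding kronecker_def by (simp cong: sum.cong_simp) (intro sum.cong, auto)
  show ?case
  proof (intro exI[of _ "c(v := K)"] conjI ballI impI allI)
    show "(c(v := K)) u > 0" for u using c(1) by (auto simp: K_def)
    fix m n u assume mn: "m \<in> T" "n \<in> T" and u: "u \<in> insert v V"
      and "kronecker (c(v := K)) (insert v V) m = kronecker (c(v := K)) (insert v V) n"
    then have e: "lookup m v * K + kronecker c V m = lookup n v * K + kronecker c V n"
      using eq by simp
    have "(lookup m v * K + kronecker c V m) div K = lookup m v"
      "(lookup n v * K + kronecker c V n) div K = lookup n v"
      using less[OF mn(1)] less[OF mn(2)] by auto
    then have "lookup m v = lookup n v" using e by simp
    then show "lookup m u = lookup n u" using e c(2) mn u by auto
  qed
qed

lemma kronecker_injective: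
  assumes "finite V" "finite T" "\<And>m. m \<in> T \<Longrightarrow> Poly_Mapping.keys m \<subseteq> V"
  obtains c where "\<And>v. c v > 0" "inj_on (kronecker c V) T"
proof -
  obtain c where c: "\<forall>v. c v > 0"
    "\<forall>m\<in>T. \<forall>n\<in>T. kronecker c V m = kronecker c V n \<longrightarrow> (\<forall>v\<in>V. lookup m v = lookup n v)"
    using kronecker_separating[OF assms(1,2)] by blast
  have "inj_on (kronecker c V) T"
  proof (rule inj_onI)
    fix m n assume mn: "m \<in> T" "n \<in> T" "kronecker c V m = kronecker c V n"
    show "m = n"
    proof (rule poly_mapping_eqI)
      fix v
      show "lookup m v = lookup n v"
      proof (cases "v \<in> V")
        case True
        then show ?thesis using c(2) mn by blast
      next
        case False
        then have "v \<notin> Poly_Mapping.keys m" "v \<notin> Poly_Mapping.keys n"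
          using assms(3)[OF mn(1)] assms(3)[OF mn(2)] by auto
        then show ?thesis by (simp add: in_keys_iff)
      qed
    qed
  qed
  with c(1) show thesis using that by blast
qed

text \<open>Weights that are injective on the monomials of both factors keep both images nonzero,
  and \<open>'k poly\<close> is a domain.\<close>

lemma polys_no_zero_divisors:
  assumes "finite V" "p \<in> polys V" "q \<in> polys V" "p \<noteq> 0" "q \<noteq> 0"
  shows "p * q \<noteq> 0"
proof -
  obtain c where c: "inj_on (kronecker c V) (Poly_Mapping.keys p \<union> Poly_Mapping.keys q)"
  proof (rule kronecker_injective[OF assms(1), of "Poly_Mapping.keys p \<union> Poly_Mapping.keys q"])
    show "Poly_Mapping.keys m \<subseteq> V" if "m \<in> Poly_Mapping.keys p \<union> Poly_Mapping.keys q" for m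
      using that assms(2,3) by (auto simp: polys_def)
  qed auto
  then have "kronecker_eval c V p \<noteq> 0" "kronecker_eval c V q \<noteq> 0"
    using assms(4,5) kronecker_eval_nonzero inj_on_subset[OF c] by (metis Un_upper1, metis Un_upper2)
  then have "kronecker_eval c V (p * q) \<noteq> 0" by (simp add: kronecker_eval_mult)
  then show ?thesis using kronecker_eval_zero by metis
qed

subsection \<open>Coefficients with respect to one variable\<close>

text \<open>The coefficient of the k-th power of v when p is read as a polynomial in v. The guard
  keeps higher powers of v out, so that the coefficient is free of v.\<close>

definition vcoeff :: "'v \<Rightarrow> nat \<Rightarrow> ('v, 'k::field) vpoly \<Rightarrow> ('v, 'k) vpoly" where
  "vcoeff v k p =
    Abs_poly_mapping (\<lambda>m. lookup p (m + Poly_Mapping.single v k) when lookup m v = 0)"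

lemma lookup_vcoeff:
  "lookup (vcoeff v k p) m = (lookup p (m + Poly_Mapping.single v k) when lookup m v = 0)"
proof -
  have "finite {m. (lookup p (m + Poly_Mapping.single v k) when lookup m v = 0) \<noteq> 0}"
  proof (rule finite_subset)
    show "{m. (lookup p (m + Poly_Mapping.single v k) when lookup m v = 0) \<noteq> 0} \<subseteq>
        (\<lambda>m. m - Poly_Mapping.single v k) ` Poly_Mapping.keys p"
    proof
      fix m assume "m \<in> {m. (lookup p (m + Poly_Mapping.single v k) when lookup m v = 0) \<noteq> 0}"
      then have "m + Poly_Mapping.single v k \<in> Poly_Mapping.keys p" by (auto simp: in_keys_iff)
      moreover have "m = (m + Poly_Mapping.single v k) - Poly_Mapping.single v k" by simp
      ultimately show "m \<in> (\<lambda>m. m - Poly_Mapping.single v k) ` Poly_Mapping.keys p" by blast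
    qed
  qed simp
  then show ?thesis unfolding vcoeff_def by simp
qed

lemma vcoeff_add: "vcoeff v k (p + q) = vcoeff v k p + vcoeff v k q"
  by (rule poly_mapping_eqI) (simp add: lookup_vcoeff lookup_add when_add_distrib)

lemma vcoeff_zero: "vcoeff v k 0 = 0"
  by (rule poly_mapping_eqI) (simp add: lookup_vcoeff)

lemma vcoeff_uminus: "vcoeff v k (- p) = - vcoeff v k p"
  by (rule poly_mapping_eqI) (simp add: lookup_vcoeff when_def)

lemma vcoeff_diff: "vcoeff v k (p - q) = vcoeff v k p - vcoeff v k q"
  using vcoeff_add[of v k p "- q"] by (simp add: vcoeff_uminus)

lemma vcoeff_sum: "vcoeff v k (sum f A) = (\<Sum>i\<in>A. vcoeff v k (f i))"
  by (induction A rule: infinite_finite_induct) (simp_all add: vcoeff_zero vcoeff_add)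

lemma vcoeff_single:
  "vcoeff v k (Poly_Mapping.single m c) =
    (if lookup m v = k then Poly_Mapping.single (m - Poly_Mapping.single v k) c else 0)"
proof (cases "lookup m v = k")
  case True
  have iff: "m = n + Poly_Mapping.single v k \<and> lookup n v = 0 \<longleftrightarrow> m - Poly_Mapping.single v k = n" for n
  proof -
    have "m - Poly_Mapping.single v k + Poly_Mapping.single v k = m"
      by (rule poly_mapping_eqI) (use True in \<open>auto simp: lookup_add lookup_minus lookup_single when_def\<close>)
    moreover have "lookup (m - Poly_Mapping.single v k) v = 0"
      using True by (simp add: lookup_minus)
    ultimately show ?thesis by (metis add_diff_cancel_right')
  qed
  show ?thesis
  proof (rule poly_mapping_eqI)
    fix n
    have "lookup (vcoeff v k (Poly_Mapping.single m c)) n =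
        (if m = n + Poly_Mapping.single v k \<and> lookup n v = 0 then c else 0)"
      by (simp add: lookup_vcoeff lookup_single when_def)
    also have "\<dots> = (if m - Poly_Mapping.single v k = n then c else 0)" by (simp only: iff)
    finally show "lookup (vcoeff v k (Poly_Mapping.single m c)) n = lookup
        (if lookup m v = k then Poly_Mapping.single (m - Poly_Mapping.single v k) c else 0) n"
      using True by (simp add: lookup_single when_def)
  qed
next
  case False
  then have "m \<noteq> n + Poly_Mapping.single v k" if "lookup n v = 0" for n
    using that by (auto simp: lookup_add)
  then show ?thesis
    using False by (intro poly_mapping_eqI) (auto simp: lookup_vcoeff lookup_single when_def)
qed

lemma vcoeff_mult_left:
  assumes "s \<in> polys W" "v \<notin> W"
  shows "vcoeff v k (s * p) = s * vcoeff v k p"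
proof (induction s rule: poly_mapping_single_induct)
  case (single m c)
  then have "Poly_Mapping.keys m \<subseteq> W" using assms(1) by (auto simp: polys_def)
  then have m: "lookup m v = 0" using assms(2) by (auto simp: in_keys_iff)
  show ?case
  proof (induction p rule: poly_mapping_single_induct)
    case (single n d)
    have "m + n - Poly_Mapping.single v k = m + (n - Poly_Mapping.single v k)" if "lookup n v = k"
      using that m
      by (intro poly_mapping_eqI) (auto simp: lookup_add lookup_minus lookup_single when_def)
    then show ?case using m by (auto simp: mult_single vcoeff_single lookup_add)
  qed (simp_all add: vcoeff_zero vcoeff_add algebra_simps)
qed (simp_all add: vcoeff_zero vcoeff_add algebra_simps)

lemma vcoeff_var_power_mult:
  "vcoeff v k (vertex_var v ^ j * p) = (if j \<le> k then vcoeff v (k - j) p else 0)"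
proof (induction p rule: poly_mapping_single_induct)
  case (single m c)
  have "Poly_Mapping.single v j + m - Poly_Mapping.single v k = m - Poly_Mapping.single v (k - j)"
    if "j \<le> k"
    using that
    by (intro poly_mapping_eqI) (auto simp: lookup_add lookup_minus lookup_single when_def)
  then show ?case
    by (auto simp: single_var_power mult_single vcoeff_single lookup_add)
qed (auto simp: vcoeff_zero vcoeff_add algebra_simps)

lemma vcoeff_polys:
  assumes "p \<in> polys V"
  shows "vcoeff v k p \<in> polys (V - {v})"
  unfolding polys_def
proof (intro CollectI ballI)
  fix m assume "m \<in> Poly_Mapping.keys (vcoeff v k p)"
  then have "m + Poly_Mapping.single v k \<in> Poly_Mapping.keys p" "lookup m v = 0"
    by (auto simp: in_keys_iff lookup_vcoeff when_def split: if_splits)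
  then have "Poly_Mapping.keys (m + Poly_Mapping.single v k) \<subseteq> V" "v \<notin> Poly_Mapping.keys m"
    using assms by (auto simp: polys_def in_keys_iff)
  then show "Poly_Mapping.keys m \<subseteq> V - {v}" by (auto simp: keys_plus_nat)
qed

lemma vcoeff_expansion:
  assumes "\<And>m. m \<in> Poly_Mapping.keys p \<Longrightarrow> lookup m v \<le> N"
  shows "p = (\<Sum>k\<le>N. vertex_var v ^ k * vcoeff v k p)"
proof (induction p rule: poly_mapping_single_induct)
  case (single m c)
  have m: "Poly_Mapping.single v (lookup m v) + (m - Poly_Mapping.single v (lookup m v)) = m"
    by (intro poly_mapping_eqI) (auto simp: lookup_add lookup_minus lookup_single when_def)
  have "(\<Sum>k\<le>N. vertex_var v ^ k * vcoeff v k (Poly_Mapping.single m c)) =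
      (\<Sum>k\<le>N. if k = lookup m v then Poly_Mapping.single m c else 0)"
    by (intro sum.cong) (auto simp: vcoeff_single single_var_power mult_single m)
  then show ?case using assms[OF single] by simp
qed (simp_all add: vcoeff_zero vcoeff_add algebra_simps sum.distrib)

lemma vcoeff_degree_bound:
  obtains N where "\<And>m. m \<in> Poly_Mapping.keys p \<Longrightarrow> lookup m v \<le> N" "\<And>k. k > N \<Longrightarrow> vcoeff v k p = 0"
proof -
  define N where "N = (\<Sum>m\<in>Poly_Mapping.keys p. lookup m v)"
  have 1: "lookup m v \<le> N" if "m \<in> Poly_Mapping.keys p" for m
    unfolding N_def using that by (intro member_le_sum) auto
  have "vcoeff v k p = 0" if "k > N" for k
  proof (rule poly_mapping_eqI)
    fix m
    show "lookup (vcoeff v k p) m = lookup 0 m"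
      using 1[of "m + Poly_Mapping.single v k"] that
      by (auto simp: lookup_vcoeff lookup_add in_keys_iff when_def)
  qed
  with 1 show thesis by (rule that)
qed

lemma vcoeff_all_zero:
  assumes "\<And>k. vcoeff v k p = 0"
  shows "p = 0"
proof -
  obtain N where "\<And>m. m \<in> Poly_Mapping.keys p \<Longrightarrow> lookup m v \<le> N"
    using vcoeff_degree_bound[of p v] by metis
  then show ?thesis using vcoeff_expansion[of p v N] assms by simp
qed

section \<open>Hilbert basis theorem\<close>

text \<open>The leading coefficient ideals of Hilbert's proof. Only degree at most d in v is
  required, so the coefficient may vanish; this makes the set closed under addition.\<close>

definition lead_coeffs :: "'v \<Rightarrow> nat \<Rightarrow> ('v, 'k::field) vpoly set \<Rightarrow> ('v, 'k) vpoly set" where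
  "lead_coeffs v d J = {vcoeff v d p |p. p \<in> J \<and> (\<forall>k>d. vcoeff v k p = 0)}"

lemma lead_coeffs_ideal:
  assumes J: "ideal J (vertex_ring (insert v V))" and v: "v \<notin> V"
  shows "ideal (lead_coeffs v d J) (vertex_ring V)"
  unfolding vertex_ring_ideal_iff
proof (intro conjI ballI)
  note J' = vertex_ring_idealD[OF J]
  show "lead_coeffs v d J \<subseteq> polys V"
    using vcoeff_polys[OF J'(2), of _ v d] v unfolding lead_coeffs_def by auto
  show "0 \<in> lead_coeffs v d J"
    unfolding lead_coeffs_def using J'(3) by (intro CollectI exI[of _ 0]) (auto simp: vcoeff_zero)
  show "a + b \<in> lead_coeffs v d J" if ab: "a \<in> lead_coeffs v d J" "b \<in> lead_coeffs v d J" for a b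
  proof -
    obtain p q where "a = vcoeff v d p" "b = vcoeff v d q" "p \<in> J" "q \<in> J"
      "\<forall>k>d. vcoeff v k p = 0" "\<forall>k>d. vcoeff v k q = 0"
      using ab unfolding lead_coeffs_def by blast
    then show ?thesis
      unfolding lead_coeffs_def using J'(4) by (intro CollectI exI[of _ "p + q"]) (auto simp: vcoeff_add)
  qed
  show "a * b \<in> lead_coeffs v d J" if ab: "a \<in> polys V" "b \<in> lead_coeffs v d J" for a b
  proof -
    obtain q where "b = vcoeff v d q" "q \<in> J" "\<forall>k>d. vcoeff v k q = 0"
      using ab unfolding lead_coeffs_def by blast
    moreover have "a \<in> polys (insert v V)" using ab polys_mono[of V "insert v V"] by blast
    ultimately show ?thesis
      unfolding lead_coeffs_def using J'(5) vcoeff_mult_left[OF ab(1) v]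
      by (intro CollectI exI[of _ "a * q"]) auto
  qed
qed

text \<open>Multiplication by a power of v moves a leading coefficient to any higher degree.\<close>

lemma lead_coeffs_mono:
  assumes J: "ideal J (vertex_ring (insert v V))" and "d \<le> d'"
  shows "lead_coeffs v d J \<subseteq> lead_coeffs v d' J"
proof
  fix a assume "a \<in> lead_coeffs v d J"
  then obtain p where p: "a = vcoeff v d p" "p \<in> J" "\<forall>k>d. vcoeff v k p = 0"
    unfolding lead_coeffs_def by blast
  let ?q = "vertex_var v ^ (d' - d) * p"
  have "?q \<in> J" using vertex_ring_idealD(5)[OF J _ p(2)] by (simp add: polys_intros)
  moreover have "vcoeff v d' ?q = a" using assms(2) p(1) by (simp add: vcoeff_var_power_mult)
  moreover have "vcoeff v k ?q = 0" if "k > d'" for k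
    using that p(3) assms(2) by (auto simp: vcoeff_var_power_mult)
  ultimately show "a \<in> lead_coeffs v d' J" unfolding lead_coeffs_def by blast
qed

text \<open>An element of \<open>K\<close> with the same top coefficient is subtracted; the
  difference stays in \<open>J\<close> and has smaller degree in v. The induction variable d is a
  strict bound for this degree.\<close>

lemma ideal_eq_if_lead_coeffs_subset:
  assumes J: "ideal J (vertex_ring V)" and K: "ideal K (vertex_ring V)" "K \<subseteq> J"
    and lead: "\<And>d. lead_coeffs v d J \<subseteq> lead_coeffs v d K"
  shows "J \<subseteq> K"
proof
  have "p \<in> K" if "p \<in> J" "\<forall>k\<ge>d. vcoeff v k p = 0" for p d
    using that
  proof (induction d arbitrary: p)
    case 0
    then show ?case using vcoeff_all_zero[of v p] vertex_ring_idealD(3)[OF K(1)] by simp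
  next
    case (Suc d)
    then have "vcoeff v d p \<in> lead_coeffs v d J" unfolding lead_coeffs_def by (auto simp: Suc_le_eq)
    then have "vcoeff v d p \<in> lead_coeffs v d K" using lead by blast
    then obtain q where q: "vcoeff v d p = vcoeff v d q" "q \<in> K" "\<forall>k>d. vcoeff v k q = 0"
      unfolding lead_coeffs_def by blast
    have "vcoeff v k (p - q) = 0" if "k \<ge> d" for k
    proof (cases "k = d")
      case False
      then have "Suc d \<le> k" "k > d" using that by auto
      then show ?thesis using Suc.prems(2) q(3) by (simp add: vcoeff_diff)
    qed (simp add: vcoeff_diff q(1))
    moreover have "p - q \<in> J" using vertex_ring_idealD(7)[OF J Suc.prems(1)] q(2) K(2) by blast
    ultimately have "p - q \<in> K" using Suc.IH by blast
    then have "(p - q) + q \<in> K" using vertex_ring_idealD(4)[OF K(1)] q(2) by blast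
    then show ?case by simp
  qed
  then show "p \<in> K" if "p \<in> J" for p
    using that vcoeff_degree_bound[of p v] by (metis Suc_le_eq)
qed

lemma polys_empty_noetherian: "noetherian_ring (vertex_ring {} :: ('v, 'k::field) vpoly ring)"
proof -
  interpret cring "vertex_ring {} :: ('v, 'k) vpoly ring" by (rule vertex_ring_cring)
  show ?thesis
  proof (rule noetherian_ringI)
    fix J :: "('v, 'k) vpoly set" assume J: "ideal J (vertex_ring {})"
    note J' = vertex_ring_idealD[OF J]
    show "\<exists>A\<subseteq>carrier (vertex_ring {}). finite A \<and> J = Idl\<^bsub>vertex_ring {}\<^esub> A"
    proof (cases "J = {0}")
      case True
      then show ?thesis using Idl_empty by (intro exI[of _ "{}"]) (auto simp: vertex_ring_simps)
    next
      case False
      then obtain p where p: "p \<in> J" "p \<noteq> 0" using J'(3) by blast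
      then obtain c where c: "p = const c" using J'(2) polys_empty by blast
      then have "c \<noteq> 0" using p(2) by auto
      have "const (inverse c) * p \<in> J" using J'(5) p(1) polys_closed(3) by blast
      then have "\<one>\<^bsub>vertex_ring {}\<^esub> \<in> J" using c \<open>c \<noteq> 0\<close> by (simp add: vertex_ring_simps const_inverse)
      then have "J = carrier (vertex_ring {})" using ideal.one_imp_carrier[OF J] by simp
      then have "J = Idl\<^bsub>vertex_ring {}\<^esub> {\<one>\<^bsub>vertex_ring {}\<^esub>}" using genideal_one by simp
      then show ?thesis by (intro exI[of _ "{\<one>\<^bsub>vertex_ring {}\<^esub>}"]) auto
    qed
  qed
qed

theorem polys_noetherian:
  assumes "finite V"
  shows "noetherian_ring (vertex_ring V :: ('v, 'k::field) vpoly ring)"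
  using assms
proof (induction V rule: finite_induct)
  case empty
  show ?case by (rule polys_empty_noetherian)
next
  case (insert v V)
  let ?R = "vertex_ring V :: ('v, 'k) vpoly ring"
  let ?S = "vertex_ring (insert v V) :: ('v, 'k) vpoly ring"
  interpret R: cring ?R by (rule vertex_ring_cring)
  interpret S: cring ?S by (rule vertex_ring_cring)
  show ?case
  proof (rule S.noetherian_ringI)
    fix J assume J: "ideal J ?S"
    let ?L = "\<lambda>d. lead_coeffs v d J"
    have L: "ideal (?L d) ?R" for d by (rule lead_coeffs_ideal[OF J insert(2)])
    have "subset.chain {I. ideal I ?R} (range ?L)"
      unfolding subset_chain_def using L lead_coeffs_mono[OF J] by (auto simp: linear) (meson linear subsetD)
    \<comment> \<open>The leading coefficient ideals increase with d, so one of them, with index N,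
      contains all others.\<close>
    then have "\<Union>(range ?L) \<in> range ?L"
      using noetherian_ring.ideal_chain_is_trivial[OF insert(3)] by blast
    then obtain N where N: "\<And>d. ?L d \<subseteq> ?L N" by blast
    have "\<forall>d. \<exists>A. A \<subseteq> carrier ?R \<and> finite A \<and> ?L d = Idl\<^bsub>?R\<^esub> A"
      using noetherian_ring.finetely_gen[OF insert(3) L] by blast
    then obtain A where A: "\<And>d. A d \<subseteq> carrier ?R" "\<And>d. finite (A d)" "\<And>d. ?L d = Idl\<^bsub>?R\<^esub> (A d)"
      by metis
    have AL: "A d \<subseteq> ?L d" for d using R.genideal_self[OF A(1)] A(3) by simp
    have "\<forall>d a. \<exists>p. a \<in> A d \<longrightarrow> p \<in> J \<and> (\<forall>k>d. vcoeff v k p = 0) \<and> vcoeff v d p = a"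
      using AL unfolding lead_coeffs_def by blast
    then obtain W where W: "\<And>d a. a \<in> A d \<Longrightarrow> W d a \<in> J \<and> (\<forall>k>d. vcoeff v k (W d a) = 0) \<and>
        vcoeff v d (W d a) = a" by metis
    \<comment> \<open>Beyond N the coefficient ideals are stationary, so it suffices to lift the
      finitely many generators of those up to N to elements of \<open>J\<close>.\<close>
    define G where "G = (\<Union>d\<le>N. W d ` A d)"
    have G: "finite G" "G \<subseteq> J" unfolding G_def using A(2) W by auto
    then have Gc: "G \<subseteq> carrier ?S" using vertex_ring_idealD(1)[OF J] by (auto simp: vertex_ring_simps)
    let ?K = "Idl\<^bsub>?S\<^esub> G"
    have K: "ideal ?K ?S" by (rule S.genideal_ideal[OF Gc])
    have KJ: "?K \<subseteq> J" by (rule S.genideal_minimal[OF J G(2)])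
    have le: "?L d \<subseteq> lead_coeffs v d ?K" if "d \<le> N" for d
      unfolding A(3)
    proof (rule R.genideal_minimal[OF lead_coeffs_ideal[OF K insert(2)]])
      show "A d \<subseteq> lead_coeffs v d ?K"
      proof
        fix a assume a: "a \<in> A d"
        then have "W d a \<in> ?K" using S.genideal_self[OF Gc] that unfolding G_def by blast
        then show "a \<in> lead_coeffs v d ?K"
          using W[OF a] unfolding lead_coeffs_def by (intro CollectI exI[of _ "W d a"]) simp
      qed
    qed
    have "?L d \<subseteq> lead_coeffs v d ?K" for d
    proof (cases "d \<le> N")
      case False
      then have "lead_coeffs v N ?K \<subseteq> lead_coeffs v d ?K" by (intro lead_coeffs_mono[OF K]) simp
      then show ?thesis using N[of d] le[of N] by blast
    qed (rule le)
    then have "J \<subseteq> ?K" by (rule ideal_eq_if_lead_coeffs_subset[OF J K KJ])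
    then show "\<exists>A\<subseteq>carrier ?S. finite A \<and> J = Idl\<^bsub>?S\<^esub> A" using KJ G(1) Gc by blast
  qed
qed

subsection \<open>Dimension of polynomial rings\<close>

interpretation vpoly_space: vector_space "\<lambda>c (p :: ('v, 'k::field) vpoly). const c * p"
  by unfold_locales (simp_all add: algebra_simps single_add const_mult mult.assoc[symmetric])

text \<open>The relation is indexed by \<open>A\<close> and not by the set of values, so that
  repetitions count: for two indices with equal values, the difference of these two terms is the
  relation.\<close>

lemma vpoly_linear_relation:
  fixes u :: "'i \<Rightarrow> ('v, 'k::field) vpoly"
  assumes "finite A" "finite W" "card W < card A" "\<And>i. i \<in> A \<Longrightarrow> u i \<in> vpoly_space.span W"
  obtains d where "\<exists>i\<in>A. d i \<noteq> 0" "(\<Sum>i\<in>A. const (d i) * u i) = 0"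
proof (cases "inj_on u A")
  case True
  have "vpoly_space.dependent (u ` A)"
  proof (rule ccontr)
    assume "vpoly_space.independent (u ` A)"
    then have "card (u ` A) \<le> card W"
      using vpoly_space.independent_span_bound[OF assms(2), of "u ` A"] assms(4) by blast
    then show False using assms(3) card_image[OF True] by simp
  qed
  then obtain f where f: "\<exists>p\<in>u ` A. f p \<noteq> 0" "(\<Sum>p\<in>u ` A. const (f p) * p) = 0"
    using vpoly_space.dependent_finite[of "u ` A"] assms(1) by blast
  show thesis
    by (rule that[of "f \<circ> u"]) (use f True in \<open>auto simp: sum.reindex\<close>)
next
  case False
  then obtain i j where ij: "i \<in> A" "j \<in> A" "i \<noteq> j" "u i = u j" by (auto simp: inj_on_def)
  define d :: "'i \<Rightarrow> 'k" where "d k = (if k = i then 1 else if k = j then - 1 else 0)" for k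
  have "(\<Sum>k\<in>A. const (d k) * u k) = (\<Sum>k\<in>{i, j}. const (d k) * u k)"
    using ij assms(1) by (intro sum.mono_neutral_right) (auto simp: d_def)
  also have "\<dots> = 0" using ij by (simp add: d_def single_uminus)
  finally show thesis using ij(1) by (intro that[of d]) (auto simp: d_def)
qed

lemma prime_vertex_ringD:
  assumes "primeideal Q (vertex_ring V)"
  shows "ideal Q (vertex_ring V)" "1 \<notin> Q"
    "p \<in> polys V \<Longrightarrow> q \<in> polys V \<Longrightarrow> p * q \<in> Q \<Longrightarrow> p \<in> Q \<or> q \<in> Q"
    "p \<in> polys V \<Longrightarrow> q \<in> polys V \<Longrightarrow> p ^ k * q \<in> Q \<Longrightarrow> p \<notin> Q \<Longrightarrow> q \<in> Q"
    "c \<noteq> 0 \<Longrightarrow> const c \<notin> Q"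
proof -
  interpret Q: primeideal Q "vertex_ring V" by fact
  show Qi: "ideal Q (vertex_ring V)" by (rule Q.is_ideal)
  show 1: "1 \<notin> Q" using Q.one_notin by (simp add: vertex_ring_simps)
  show prime: "p \<in> Q \<or> q \<in> Q" if "p \<in> polys V" "q \<in> polys V" "p * q \<in> Q" for p q
    using Q.I_prime[of p q] that by (simp add: vertex_ring_simps)
  show "p ^ k * q \<in> Q \<Longrightarrow> q \<in> Q" if "p \<in> polys V" "q \<in> polys V" "p \<notin> Q"
  proof (induction k)
    case (Suc k)
    have "p ^ k * q \<in> polys V" using that by (intro polys_intros)
    then show ?case using Suc prime[of p "p ^ k * q"] that by (simp add: mult.assoc)
  qed simp
  show "const c \<notin> Q" if "c \<noteq> 0"
    using vertex_ring_idealD(5)[OF Qi polys_closed(3), of "const c" "inverse c"] 1 that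
    by (auto simp: const_inverse)
qed

text \<open>
  The relation is factored by the power of \<open>a j\<close> of least exponent; the remaining factor lies in
  \<open>P j\<close>, and modulo \<open>a j \<in> P (Suc j)\<close> only the terms of least exponent survive.
\<close>

lemma prime_chain_no_relation:
  assumes chain: "prime_chain (vertex_ring V) l P"
    and a: "\<And>i. i < l \<Longrightarrow> a i \<in> polys V" "\<And>i. i < l \<Longrightarrow> a i \<in> P (Suc i)" "\<And>i. i < l \<Longrightarrow> a i \<notin> P i"
    and "j \<le> l" "finite A" "\<And>e. e \<in> A \<Longrightarrow> c e \<noteq> 0" "inj_on (\<lambda>e. restrict e {j..<l}) A"
    and "(\<Sum>e\<in>A. const (c e) * (\<Prod>i=j..<l. a i ^ e i)) \<in> P j"
  shows "A = {}"
  using assms(5-)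
proof (induction j arbitrary: A rule: inc_induct)
  case base
  have P: "primeideal (P l) (vertex_ring V)" using chain by (simp add: prime_chain_def)
  show ?case
  proof (rule ccontr)
    assume "A \<noteq> {}"
    then obtain e where e: "e \<in> A" by blast
    \<comment> \<open>No exponent is left to distinguish members of \<open>A\<close>: all
      restrictions to the empty interval agree, so the sum has a single term, a nonzero
      constant.\<close>
    have "e' = e" if "e' \<in> A" for e' using inj_onD[OF base(3) _ that e] by simp
    then have "A = {e}" using e by blast
    then have "const (c e) \<in> P l" using base(4) by simp
    then show False using prime_vertex_ringD(5)[OF P] base(2) e by blast
  qed
next
  case (step j)
  have P: "primeideal (P j) (vertex_ring V)" "primeideal (P (Suc j)) (vertex_ring V)"
    "P j \<subseteq> P (Suc j)" using chain step(2) by (auto simp: prime_chain_def)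
  note I = vertex_ring_idealD[OF prime_vertex_ringD(1)[OF P(2)]]
  show ?case
  proof (rule ccontr)
    assume ne: "A \<noteq> {}"
    define m where "m = Min ((\<lambda>e. e j) ` A)"
    have m_le: "m \<le> e j" if "e \<in> A" for e unfolding m_def using step(4) that by simp
    obtain e0 where e0: "e0 \<in> A" "e0 j = m"
    proof -
      have "m \<in> (\<lambda>e. e j) ` A" unfolding m_def using step(4) ne by (intro Min_in) auto
      then show thesis using that by blast
    qed
    define B where "B = {e\<in>A. e j = m}"
    let ?t = "\<lambda>e. const (c e) * (\<Prod>i=Suc j..<l. a i ^ e i)"
    have t: "?t e \<in> polys V" for e using a(1) by (intro polys_intros) auto
    have factor: "const (c e) * (\<Prod>i=j..<l. a i ^ e i) = a j ^ m * (a j ^ (e j - m) * ?t e)"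
      if "e \<in> A" for e
    proof -
      have "(\<Prod>i=j..<l. a i ^ e i) = a j ^ e j * (\<Prod>i=Suc j..<l. a i ^ e i)"
        using step(2) by (rule prod.atLeast_Suc_lessThan)
      also have "a j ^ e j = a j ^ m * a j ^ (e j - m)"
        using m_le[OF that] by (simp add: power_add[symmetric])
      finally show ?thesis by (simp add: mult_ac)
    qed
    have "(\<Sum>e\<in>A. const (c e) * (\<Prod>i=j..<l. a i ^ e i)) = a j ^ m * (\<Sum>e\<in>A. a j ^ (e j - m) * ?t e)"
      using factor by (simp add: sum_distrib_left)
    then have "a j ^ m * (\<Sum>e\<in>A. a j ^ (e j - m) * ?t e) \<in> P j" using step(7) by simp
    then have "(\<Sum>e\<in>A. a j ^ (e j - m) * ?t e) \<in> P j"
      using prime_vertex_ringD(4)[OF P(1) a(1)[OF step(2)] _ _ a(3)[OF step(2)]] t a(1)[OF step(2)]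
      by (meson polys_sum polys_closed(5) polys_power)
    then have all: "(\<Sum>e\<in>A. a j ^ (e j - m) * ?t e) \<in> P (Suc j)" using P(3) by blast
    have rest: "(\<Sum>e\<in>A - B. a j ^ (e j - m) * ?t e) \<in> P (Suc j)"
    proof (rule I(8))
      fix e assume "e \<in> A - B"
      then have "e j - m \<noteq> 0" using m_le unfolding B_def by fastforce
      then obtain k where "e j - m = Suc k" using not0_implies_Suc by blast
      then have eq: "a j ^ (e j - m) * ?t e = (a j ^ k * ?t e) * a j" by (simp add: mult_ac)
      have "a j ^ k * ?t e \<in> polys V" by (rule polys_closed(5)[OF polys_power[OF a(1)[OF step(2)]] t])
      then show "a j ^ (e j - m) * ?t e \<in> P (Suc j)" unfolding eq by (rule I(5)) (rule a(2)[OF step(2)])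
    qed
    have "(\<Sum>e\<in>A. a j ^ (e j - m) * ?t e) =
        (\<Sum>e\<in>A - B. a j ^ (e j - m) * ?t e) + (\<Sum>e\<in>B. a j ^ (e j - m) * ?t e)"
      using step(4) by (intro sum.subset_diff) (auto simp: B_def)
    then have "(\<Sum>e\<in>B. a j ^ (e j - m) * ?t e) \<in> P (Suc j)"
      using I(7)[OF all rest] by simp
    moreover have "(\<Sum>e\<in>B. a j ^ (e j - m) * ?t e) = (\<Sum>e\<in>B. ?t e)"
      by (intro sum.cong) (auto simp: B_def)
    ultimately have "(\<Sum>e\<in>B. ?t e) \<in> P (Suc j)" by simp
    \<comment> \<open>All members of \<open>B\<close> have the same exponent at j, hence the
      remaining exponents still separate them.\<close>
    moreover have "inj_on (\<lambda>e. restrict e {Suc j..<l}) B"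
    proof (rule inj_onI)
      fix e e' assume e: "e \<in> B" "e' \<in> B" "restrict e {Suc j..<l} = restrict e' {Suc j..<l}"
      have "e i = e' i" if "i \<in> {j..<l}" for i
      proof (cases "i = j")
        case False
        then show ?thesis using that fun_cong[OF e(3), of i] by auto
      qed (use e in \<open>auto simp: B_def\<close>)
      then have "restrict e {j..<l} = restrict e' {j..<l}" by (auto simp: restrict_def)
      moreover have "e \<in> A" "e' \<in> A" using e by (auto simp: B_def)
      ultimately show "e = e'" using step(6) unfolding inj_on_def by blast
    qed
    moreover have "finite B" "\<And>e. e \<in> B \<Longrightarrow> c e \<noteq> 0" using step(4,5) by (auto simp: B_def)
    ultimately have "B = {}" by (intro step(3))
    then show False using e0 by (auto simp: B_def)
  qed
qed

text \<open>Monomials are bounded variable by variable instead of by total degree: the size of the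
  box is then bounded by a power of k + 1, and sides add under multiplication.\<close>

definition exponent_box :: "'v set \<Rightarrow> nat \<Rightarrow> ('v \<Rightarrow>\<^sub>0 nat) set" where
  "exponent_box U k = {m. Poly_Mapping.keys m \<subseteq> U \<and> (\<forall>v\<in>U. lookup m v \<le> k)}"

lemma exponent_box_finite:
  assumes "finite U"
  shows "finite (exponent_box U k)" "card (exponent_box U k) \<le> (k + 1) ^ card U"
proof -
  let ?f = "\<lambda>m. restrict (lookup m) U"
  have inj: "inj_on ?f (exponent_box U k)"
  proof (rule inj_onI)
    fix m n assume mn: "m \<in> exponent_box U k" "n \<in> exponent_box U k" "?f m = ?f n"
    show "m = n"
    proof (rule poly_mapping_eqI)
      fix v
      show "lookup m v = lookup n v"
      proof (cases "v \<in> U")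
        case True
        then show ?thesis using fun_cong[OF mn(3), of v] by simp
      next
        case False
        then have "v \<notin> Poly_Mapping.keys m" "v \<notin> Poly_Mapping.keys n"
          using mn by (auto simp: exponent_box_def)
        then show ?thesis by (simp add: in_keys_iff)
      qed
    qed
  qed
  have sub: "?f ` exponent_box U k \<subseteq> (\<Pi>\<^sub>E v\<in>U. {..k})" by (auto simp: exponent_box_def)
  have fin: "finite (\<Pi>\<^sub>E v\<in>U. {..k})" using assms by (intro finite_PiE) auto
  show "finite (exponent_box U k)" using inj sub fin by (meson finite_imageD finite_subset)
  have "card (exponent_box U k) = card (?f ` exponent_box U k)" using card_image[OF inj] by simp
  also have "\<dots> \<le> card (\<Pi>\<^sub>E v\<in>U. {..k})" by (rule card_mono[OF fin sub])
  also have "\<dots> = (k + 1) ^ card U" using assms by (simp add: card_PiE)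
  finally show "card (exponent_box U k) \<le> (k + 1) ^ card U" .
qed

lemma exponent_box_mono: "j \<le> k \<Longrightarrow> exponent_box U j \<subseteq> exponent_box U k"
  by (auto simp: exponent_box_def)

lemma keys_mult_exponent_box:
  assumes "Poly_Mapping.keys p \<subseteq> exponent_box U j" "Poly_Mapping.keys q \<subseteq> exponent_box U k"
  shows "Poly_Mapping.keys (p * q) \<subseteq> exponent_box U (j + k)"
proof
  fix m assume "m \<in> Poly_Mapping.keys (p * q)"
  then obtain m1 m2 where "m = m1 + m2" "m1 \<in> Poly_Mapping.keys p" "m2 \<in> Poly_Mapping.keys q"
    using keys_mult[of p q] by blast
  moreover from this have "m1 \<in> exponent_box U j" "m2 \<in> exponent_box U k" using assms by auto
  ultimately show "m \<in> exponent_box U (j + k)"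
    by (auto simp: exponent_box_def keys_plus_nat lookup_add intro!: add_mono)
qed

lemma keys_power_exponent_box:
  assumes "Poly_Mapping.keys p \<subseteq> exponent_box U j"
  shows "Poly_Mapping.keys (p ^ e) \<subseteq> exponent_box U (e * j)"
proof (induction e)
  case (Suc e)
  then show ?case using keys_mult_exponent_box[OF assms Suc] by simp
qed (auto simp: exponent_box_def)

lemma keys_prod_exponent_box:
  assumes "finite A" "\<And>i. i \<in> A \<Longrightarrow> Poly_Mapping.keys (f i) \<subseteq> exponent_box U (d i)"
  shows "Poly_Mapping.keys (prod f A) \<subseteq> exponent_box U (sum d A)"
  using assms
proof (induction A rule: finite_induct)
  case (insert i A)
  then show ?case using keys_mult_exponent_box[of "f i" U "d i" "prod f A" "sum d A"] by simp
qed (auto simp: exponent_box_def)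

lemma keys_subset_span:
  assumes "Poly_Mapping.keys p \<subseteq> B"
  shows "p \<in> vpoly_space.span ((\<lambda>m. Poly_Mapping.single m 1) ` B)"
proof -
  have "(\<Sum>m\<in>Poly_Mapping.keys p. const (lookup p m) * Poly_Mapping.single m 1)
      \<in> vpoly_space.span ((\<lambda>m. Poly_Mapping.single m 1) ` B)"
    using assms by (intro vpoly_space.span_sum vpoly_space.span_scale vpoly_space.span_base) auto
  also have "(\<Sum>m\<in>Poly_Mapping.keys p. const (lookup p m) * Poly_Mapping.single m 1) = p"
    using poly_mapping_sum_single[of p] by (simp add: mult_single)
  finally show ?thesis .
qed

text \<open>Representatives in the remaining variables are how \<open>card (V - C)\<close> enters
  the dimension bound, and how primality of an ideal of variables is reduced to the domain
  property.\<close>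

lemma polys_mod_vars:
  assumes J: "ideal J (vertex_ring V)" and C: "\<And>v. v \<in> C \<Longrightarrow> vertex_var v \<in> J" and p: "p \<in> polys V"
  shows "\<exists>q\<in>polys (V - C). p - q \<in> J"
proof -
  note J' = vertex_ring_idealD[OF J]
  have "p \<in> polys V \<and> (\<exists>q\<in>polys (V - C). p - q \<in> J)"
    using p
  proof (induction rule: polys_induct)
    case (add p q)
    then obtain p' q' where *: "p' \<in> polys (V - C)" "p - p' \<in> J" "q' \<in> polys (V - C)" "q - q' \<in> J" by blast
    have "(p + q) - (p' + q') \<in> J" using J'(4)[OF *(2,4)] by (simp add: algebra_simps)
    then show ?case using * add polys_closed(4) by blast
  next
    case (const c p)
    then obtain p' where *: "p' \<in> polys (V - C)" "p - p' \<in> J" by blast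
    have "const c * p - const c * p' \<in> J"
      using J'(5)[OF polys_closed(3)[of c] *(2)] by (simp add: algebra_simps)
    then show ?case using * const polys_closed(3,5) by blast
  next
    case (var v p)
    then obtain p' where *: "p' \<in> polys (V - C)" "p - p' \<in> J" by blast
    have vp: "vertex_var v * p \<in> polys V" using var by (intro polys_intros) auto
    show ?case
    proof (cases "v \<in> C")
      case True
      then have "p * vertex_var v \<in> J" using J'(5) C var by blast
      then show ?thesis using vp polys_closed(1) by (intro conjI bexI[of _ 0]) (auto simp: mult.commute)
    next
      case False
      have "vertex_var v * (p - p') \<in> J" using J'(5)[OF polys_var[OF var(1)] *(2)] .
      moreover have "vertex_var v * p' \<in> polys (V - C)" using False var(1) * by (intro polys_intros) auto
      ultimately show ?thesis using vp
        by (intro conjI bexI[of _ "vertex_var v * p'"]) (auto simp: algebra_simps)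
    qed
  next
    case zero
    show ?case using J'(3) polys_closed(1) by (intro conjI bexI[of _ 0]) auto
  next
    case one
    show ?case using J'(3) polys_closed(2) by (intro conjI bexI[of _ 1]) auto
  qed
  then show ?thesis by blast
qed

text \<open>Elements that separate consecutive primes satisfy no nontrivial relation modulo
  \<open>P 0\<close>. If there were more of them than variables outside \<open>C\<close>, their
  products with exponents below a large \<open>N\<close> would outnumber the monomials available to
  them, and linear dependence would give a relation.\<close>

theorem prime_chain_length_le:
  fixes P :: "nat \<Rightarrow> ('v, 'k::field) vpoly set"
  assumes V: "finite V" and chain: "prime_chain (vertex_ring V) l P"
    and C: "\<And>v. v \<in> C \<Longrightarrow> vertex_var v \<in> P 0"
  shows "l \<le> card (V - C)"
proof (rule ccontr)
  assume less: "\<not> l \<le> card (V - C)"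
  let ?U = "V - C"
  have P: "primeideal (P i) (vertex_ring V)" if "i \<le> l" for i
    using chain that by (simp add: prime_chain_def)
  note PI = prime_vertex_ringD(1)[OF P]
  have mono: "P 0 \<subseteq> P i" if "i \<le> l" for i
    using that
  proof (induction i)
    case (Suc i)
    then have "P i \<subset> P (Suc i)" using chain by (simp add: prime_chain_def)
    then show ?case using Suc by auto
  qed simp
  \<comment> \<open>An element of \<open>P (Suc i)\<close> outside \<open>P i\<close> may be
    replaced by one free of the variables in \<open>C\<close>, since these belong to
    \<open>P i\<close>.\<close>
  have "\<exists>a. i < l \<longrightarrow> a \<in> polys ?U \<and> a \<in> P (Suc i) \<and> a \<notin> P i" for i
  proof (cases "i < l")
    case True
    then have il: "i \<le> l" "Suc i \<le> l" by auto
    have sub: "P i \<subset> P (Suc i)" using chain True by (simp add: prime_chain_def)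
    then obtain b where b: "b \<in> P (Suc i)" "b \<notin> P i" by blast
    then have "b \<in> polys V" using vertex_ring_idealD(2)[OF PI[OF il(2)]] by blast
    then obtain q where q: "q \<in> polys ?U" "b - q \<in> P i"
      using polys_mod_vars[OF PI[OF il(1)], of C b] C mono[OF il(1)] by blast
    have "b - (b - q) \<in> P (Suc i)"
      using vertex_ring_idealD(7)[OF PI[OF il(2)] b(1), of "b - q"] q(2) sub by blast
    moreover have "q \<notin> P i"
    proof
      assume "q \<in> P i"
      then have "(b - q) + q \<in> P i" using vertex_ring_idealD(4)[OF PI[OF il(1)] q(2)] by blast
      then show False using b by simp
    qed
    ultimately show ?thesis using q(1) by auto
  qed simp
  then obtain a where a: "\<And>i. i < l \<Longrightarrow> a i \<in> polys ?U" "\<And>i. i < l \<Longrightarrow> a i \<in> P (Suc i)"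
    "\<And>i. i < l \<Longrightarrow> a i \<notin> P i" by metis
  define D where "D = (\<Sum>i<l. \<Sum>m\<in>Poly_Mapping.keys (a i). \<Sum>v\<in>?U. lookup m v)"
  have aD: "Poly_Mapping.keys (a i) \<subseteq> exponent_box ?U D" if "i < l" for i
  proof
    fix m assume m: "m \<in> Poly_Mapping.keys (a i)"
    have "lookup m v \<le> D" if v: "v \<in> ?U" for v
    proof -
      have "lookup m v \<le> (\<Sum>v\<in>?U. lookup m v)" using V v by (intro member_le_sum) auto
      also have "\<dots> \<le> (\<Sum>m\<in>Poly_Mapping.keys (a i). \<Sum>v\<in>?U. lookup m v)"
        using m by (intro member_le_sum[of m _ "\<lambda>m. \<Sum>v\<in>?U. lookup m v"]) auto
      also have "\<dots> \<le> D" unfolding D_def using \<open>i < l\<close>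
        by (intro member_le_sum[of i _ "\<lambda>i. \<Sum>m\<in>Poly_Mapping.keys (a i). \<Sum>v\<in>?U. lookup m v"]) auto
      finally show ?thesis .
    qed
    then show "m \<in> exponent_box ?U D" using a(1)[OF that] m by (auto simp: exponent_box_def polys_def)
  qed
  define d where "d = card ?U"
  \<comment> \<open>Chosen for the estimate (l N D + 1)^d <= N^d (l D + 1)^d < N^(d+1) <= N^l, whose
    last step uses d < l.\<close>
  define N where "N = (l * D + 1) ^ d + 1"
  define A where "A = (\<Pi>\<^sub>E i\<in>{..<l}. {..<N})"
  have A: "finite A" "card A = N ^ l" unfolding A_def by (auto intro: finite_PiE simp: card_PiE)
  let ?mon = "\<lambda>e. \<Prod>i=0..<l. a i ^ e i"
  let ?B = "exponent_box ?U (l * (N * D))"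
  have span: "?mon e \<in> vpoly_space.span ((\<lambda>m. Poly_Mapping.single m 1) ` ?B)" if e: "e \<in> A" for e
  proof (rule keys_subset_span)
    have "Poly_Mapping.keys (?mon e) \<subseteq> exponent_box ?U (\<Sum>i=0..<l. e i * D)"
      using aD by (intro keys_prod_exponent_box keys_power_exponent_box) auto
    moreover have "(\<Sum>i=0..<l. e i * D) \<le> (\<Sum>i=0..<l. N * D)"
    proof (intro sum_mono mult_right_mono)
      fix i assume "i \<in> {0..<l}"
      then have "e i \<in> {..<N}" using e unfolding A_def by (auto simp: PiE_iff)
      then show "e i \<le> N" by simp
    qed simp
    ultimately show "Poly_Mapping.keys (?mon e) \<subseteq> ?B"
      using exponent_box_mono[of "\<Sum>i=0..<l. e i * D" "l * (N * D)" ?U] by auto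
  qed
  have less_card: "card ((\<lambda>m. Poly_Mapping.single m (1::'k)) ` ?B) < card A"
  proof -
    have "card ((\<lambda>m. Poly_Mapping.single m (1::'k)) ` ?B) \<le> card ?B"
      using V by (intro card_image_le exponent_box_finite) auto
    also have "\<dots> \<le> (l * (N * D) + 1) ^ d"
      unfolding d_def using V by (intro exponent_box_finite) auto
    also have "\<dots> \<le> (N * (l * D + 1)) ^ d"
      by (intro power_mono) (auto simp: N_def algebra_simps)
    also have "\<dots> = N ^ d * (l * D + 1) ^ d" by (rule power_mult_distrib)
    also have "\<dots> < N ^ d * N" by (simp add: N_def)
    also have "\<dots> = N ^ Suc d" by simp
    also have "\<dots> \<le> N ^ l" using less unfolding d_def by (intro power_increasing) (auto simp: N_def)
    finally show ?thesis using A(2) by simp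
  qed
  have fin: "finite ((\<lambda>m. Poly_Mapping.single m (1::'k)) ` ?B)"
    using V exponent_box_finite(1)[of ?U] by simp
  obtain c where c: "\<exists>e\<in>A. c e \<noteq> 0" "(\<Sum>e\<in>A. const (c e) * ?mon e) = 0"
    by (rule vpoly_linear_relation[OF A(1) fin less_card, of ?mon]) (use span in auto)
  define A' where "A' = {e\<in>A. c e \<noteq> 0}"
  have "(\<Sum>e\<in>A'. const (c e) * ?mon e) = (\<Sum>e\<in>A. const (c e) * ?mon e)"
    unfolding A'_def using A(1) by (intro sum.mono_neutral_left) auto
  then have "(\<Sum>e\<in>A'. const (c e) * ?mon e) \<in> P 0"
    using c(2) vertex_ring_idealD(3)[OF PI[of 0]] by simp
  moreover have "inj_on (\<lambda>e. restrict e {0..<l}) A'"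
  proof (rule inj_onI)
    fix e e' assume *: "e \<in> A'" "e' \<in> A'" "restrict e {0..<l} = restrict e' {0..<l}"
    have "restrict e {..<l} = e" "restrict e' {..<l} = e'"
      using *(1,2) unfolding A'_def A_def by (auto intro: PiE_restrict)
    then show "e = e'" using *(3) by (simp add: atLeast0LessThan)
  qed
  moreover have "a i \<in> polys V" if "i < l" for i
    using a(1)[OF that] polys_mono[of ?U V] by blast
  ultimately have "A' = {}"
    using A(1) a(2,3) by (intro prime_chain_no_relation[OF chain, of a 0 A' c]) (auto simp: A'_def)
  then show False using c(1) by (auto simp: A'_def)
qed

section \<open>Nullstellensatz\<close>

text \<open>g - 1 is invertible modulo each power of g, since its product with a geometric sum is
  g^j - 1. The factors g - 1 can therefore be removed one by one.\<close>

lemma power_dvd_mult_pred_power: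
  fixes f g :: "'a::comm_ring_1"
  assumes "g ^ j dvd f * (g - 1) ^ N"
  shows "g ^ j dvd f"
  using assms
proof (induction N)
  case (Suc N)
  have "g ^ j dvd (f * (g - 1) ^ N) * (g - 1)" using Suc.prems by (simp add: mult_ac)
  then have "g ^ j dvd (f * (g - 1) ^ N) * (g - 1) * (\<Sum>i<j. g ^ i)" by (rule dvd_mult2)
  also have "(f * (g - 1) ^ N) * (g - 1) * (\<Sum>i<j. g ^ i) = (f * (g - 1) ^ N) * (g ^ j - 1)"
    by (simp add: power_diff_1_eq mult.assoc)
  also have "\<dots> = (f * (g - 1) ^ N) * g ^ j - f * (g - 1) ^ N" by (simp add: algebra_simps)
  finally have "g ^ j dvd f * (g - 1) ^ N" by (simp add: dvd_diff_right_iff)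
  then show ?case by (rule Suc.IH)
qed simp

text \<open>
  Since \<open>1 + s * v\<close> is coprime to \<open>s\<close>, its powers that divide \<open>e * s ^ N\<close> already divide \<open>e\<close>; the
  Kronecker substitution turns this into a bound by degrees.
\<close>

lemma bounded_power_divisor:
  fixes e s :: "('v, 'k::field) vpoly"
  assumes U: "finite U" "v \<in> U" and e: "e \<in> polys U" "e \<noteq> 0" and s: "s \<in> polys U" "s \<noteq> 0"
  shows "1 + s * vertex_var v \<noteq> 0"
    "\<exists>j. \<forall>N a. e * s ^ N \<noteq> (1 + s * vertex_var v) ^ j * a"
proof -
  let ?p = "1 + s * vertex_var v"
  obtain c where c: "\<And>u. c u > 0" "inj_on (kronecker c U) (Poly_Mapping.keys e \<union> Poly_Mapping.keys s)"
  proof (rule kronecker_injective[OF U(1), of "Poly_Mapping.keys e \<union> Poly_Mapping.keys s"])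
    show "Poly_Mapping.keys m \<subseteq> U" if "m \<in> Poly_Mapping.keys e \<union> Poly_Mapping.keys s" for m
      using that e s by (auto simp: polys_def)
  qed auto
  let ?E = "kronecker_eval c U :: ('v, 'k) vpoly \<Rightarrow> 'k poly"
  have ne: "?E e \<noteq> 0" "?E s \<noteq> 0"
    using kronecker_eval_nonzero e(2) s(2) inj_on_subset[OF c(2)] by (metis Un_upper1, metis Un_upper2)
  have kv: "kronecker c U (Poly_Mapping.single v (Suc 0)) = c v"
  proof -
    have "kronecker c U (Poly_Mapping.single v (Suc 0)) = (\<Sum>u\<in>U. if u = v then c v else 0)"
      unfolding kronecker_def by (intro sum.cong) (auto simp: lookup_single when_def)
    then show ?thesis using U by simp
  qed
  have Ep: "?E ?p = 1 + ?E s * monom 1 (c v)"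
    by (simp add: kronecker_eval_add kronecker_eval_one kronecker_eval_mult vertex_var_def
        kronecker_eval_single kv)
  \<comment> \<open>The positive weight of v makes the image of 1 + s v nonconstant, so the degrees
    of its powers are unbounded.\<close>
  have "degree (?E s * monom 1 (c v)) = degree (?E s) + c v"
    using ne(2) by (subst degree_mult_eq) (auto simp: degree_monom_eq monom_eq_0_iff)
  then have "degree (?E s * monom 1 (c v)) > 0" using c(1)[of v] by simp
  then have deg: "degree (?E ?p) > 0" unfolding Ep by (subst degree_add_eq_right) auto
  then show "?p \<noteq> 0" by (auto simp: kronecker_eval_zero)
  show "\<exists>j. \<forall>N a. e * s ^ N \<noteq> ?p ^ j * a"
  proof (intro exI allI notI)
    fix N a
    \<comment> \<open>The j-th power of a nonconstant polynomial has degree at least j, here more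
      than the degree of the image of e.\<close>
    let ?j = "Suc (degree (?E e))"
    assume eq: "e * s ^ N = ?p ^ ?j * a"
    \<comment> \<open>Multiplication by v^N turns s^N into a power of \<open>?p - 1\<close>, so that
      the coprimality of \<open>?p\<close> and \<open>?p - 1\<close> applies.\<close>
    have "e * (?p - 1) ^ N = e * s ^ N * vertex_var v ^ N" by (simp add: power_mult_distrib mult.assoc)
    also have "\<dots> = ?p ^ ?j * (a * vertex_var v ^ N)" unfolding eq by (simp add: mult.assoc)
    finally have "?E (e * (?p - 1) ^ N) = ?E ?p ^ ?j * ?E (a * vertex_var v ^ N)"
      by (simp only: kronecker_eval_mult kronecker_eval_power)
    moreover have "?E (e * (?p - 1) ^ N) = ?E e * (?E ?p - 1) ^ N"
    proof -
      have "?E (s * vertex_var v) = ?E ?p - 1"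
        unfolding Ep by (simp add: kronecker_eval_mult vertex_var_def kronecker_eval_single kv)
      moreover have "?p - 1 = s * vertex_var v" by simp
      ultimately show ?thesis by (simp only: kronecker_eval_mult[of c U e] kronecker_eval_power)
    qed
    ultimately have "?E ?p ^ ?j dvd ?E e * (?E ?p - 1) ^ N" by (metis dvd_triv_left)
    then have "?E ?p ^ ?j dvd ?E e" by (rule power_dvd_mult_pred_power)
    then have "degree (?E ?p ^ ?j) \<le> degree (?E e)" using ne(1) by (rule dvd_imp_degree_le)
    moreover have "degree (?E ?p ^ ?j) = ?j * degree (?E ?p)"
      using deg by (intro degree_power_eq) auto
    moreover have "?j * degree (?E ?p) \<ge> ?j * 1" using deg by (intro mult_le_mono2) simp
    ultimately show False by simp
  qed
qed

text \<open>Maximality is encoded by inverses modulo \<open>M\<close>, the form in which the proof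
  of the Nullstellensatz uses it.\<close>

locale maximal_poly_ideal =
  fixes V :: "'v set" and M :: "('v, 'k::field) vpoly set"
  assumes V: "finite V" and M: "ideal M (vertex_ring V)" and proper: "1 \<notin> M"
    and inverse_mod: "\<And>a. a \<in> polys V \<Longrightarrow> a \<notin> M \<Longrightarrow> \<exists>b\<in>polys V. a * b - 1 \<in> M"
begin

lemmas M_zero = vertex_ring_idealD(3)[OF M]
  and M_add = vertex_ring_idealD(4)[OF M] and M_mult = vertex_ring_idealD(5)[OF M]
  and M_diff = vertex_ring_idealD(7)[OF M]
  and M_sum = vertex_ring_idealD(8)[OF M]

definition span_mod :: "'v set \<Rightarrow> ('v \<Rightarrow>\<^sub>0 nat) set \<Rightarrow> ('v, 'k) vpoly set" where
  "span_mod U B = {p \<in> polys V. \<exists>a. (\<forall>m\<in>B. a m \<in> polys U) \<and>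
    p - (\<Sum>m\<in>B. a m * Poly_Mapping.single m 1) \<in> M}"

lemma span_modI:
  assumes "p \<in> polys V" "\<And>m. m \<in> B \<Longrightarrow> a m \<in> polys U"
    "p - (\<Sum>m\<in>B. a m * Poly_Mapping.single m 1) \<in> M"
  shows "p \<in> span_mod U B"
  using assms unfolding span_mod_def by blast

lemma span_modE:
  assumes "p \<in> span_mod U B"
  obtains a where "p \<in> polys V" "\<And>m. m \<in> B \<Longrightarrow> a m \<in> polys U"
    "p - (\<Sum>m\<in>B. a m * Poly_Mapping.single m 1) \<in> M"
  using assms unfolding span_mod_def by blast

lemma span_mod_add:
  assumes "p \<in> span_mod U B" "q \<in> span_mod U B"
  shows "p + q \<in> span_mod U B"
proof -
  obtain a where a: "p \<in> polys V" "\<And>m. m \<in> B \<Longrightarrow> a m \<in> polys U"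
    "p - (\<Sum>m\<in>B. a m * Poly_Mapping.single m 1) \<in> M" by (rule span_modE[OF assms(1)]) (rule that)
  obtain b where b: "q \<in> polys V" "\<And>m. m \<in> B \<Longrightarrow> b m \<in> polys U"
    "q - (\<Sum>m\<in>B. b m * Poly_Mapping.single m 1) \<in> M" by (rule span_modE[OF assms(2)]) (rule that)
  show ?thesis
  proof (rule span_modI)
    show "p + q \<in> polys V" using a(1) b(1) by (rule polys_closed)
    show "a m + b m \<in> polys U" if "m \<in> B" for m using a(2)[OF that] b(2)[OF that] by (rule polys_closed)
    show "p + q - (\<Sum>m\<in>B. (a m + b m) * Poly_Mapping.single m 1) \<in> M"
      using M_add[OF a(3) b(3)] by (simp add: algebra_simps sum.distrib)
  qed
qed

lemma span_mod_mult:
  assumes "U \<subseteq> V" "c \<in> polys U" "p \<in> span_mod U B"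
  shows "c * p \<in> span_mod U B"
proof -
  have cV: "c \<in> polys V" using assms(1,2) polys_mono by blast
  obtain a where a: "p \<in> polys V" "\<And>m. m \<in> B \<Longrightarrow> a m \<in> polys U"
    "p - (\<Sum>m\<in>B. a m * Poly_Mapping.single m 1) \<in> M" by (rule span_modE[OF assms(3)]) (rule that)
  show ?thesis
  proof (rule span_modI)
    show "c * p \<in> polys V" using cV a(1) by (rule polys_closed)
    show "c * a m \<in> polys U" if "m \<in> B" for m using assms(2) a(2)[OF that] by (rule polys_closed)
    show "c * p - (\<Sum>m\<in>B. (c * a m) * Poly_Mapping.single m 1) \<in> M"
      using M_mult[OF cV a(3)] by (simp add: right_diff_distrib sum_distrib_left mult.assoc)
  qed
qed

lemma span_mod_cong:
  assumes "p \<in> span_mod U B" "q \<in> polys V" "q - p \<in> M"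
  shows "q \<in> span_mod U B"
proof -
  obtain a where a: "p \<in> polys V" "\<And>m. m \<in> B \<Longrightarrow> a m \<in> polys U"
    "p - (\<Sum>m\<in>B. a m * Poly_Mapping.single m 1) \<in> M" by (rule span_modE[OF assms(1)]) (rule that)
  have "q - (\<Sum>m\<in>B. a m * Poly_Mapping.single m 1) \<in> M" using M_add[OF assms(3) a(3)] by simp
  then show ?thesis using a assms(2) by (intro span_modI)
qed

lemma span_mod_zero: "0 \<in> span_mod U B"
  by (rule span_modI[where a = "\<lambda>_. 0"]) (auto simp: polys_closed M_zero)

lemma span_mod_sum: "(\<And>i. i \<in> A \<Longrightarrow> f i \<in> span_mod U B) \<Longrightarrow> sum f A \<in> span_mod U B"
  by (induction A rule: infinite_finite_induct) (auto intro: span_mod_zero span_mod_add)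

lemma span_mod_base:
  assumes "finite B" "m \<in> B" "Poly_Mapping.keys m \<subseteq> V"
  shows "Poly_Mapping.single m 1 \<in> span_mod U B"
proof (rule span_modI[where a = "\<lambda>n. if n = m then 1 else 0"])
  have "(\<Sum>n\<in>B. (if n = m then 1 else 0) * Poly_Mapping.single n 1) =
      (\<Sum>n\<in>B. if n = m then Poly_Mapping.single m (1::'k) else 0)"
    by (intro sum.cong) auto
  also have "\<dots> = Poly_Mapping.single m 1" using assms(1,2) by simp
  finally show "Poly_Mapping.single m 1 -
      (\<Sum>n\<in>B. (if n = m then 1 else 0) * Poly_Mapping.single n 1) \<in> M" using M_zero by simp
qed (use assms in \<open>auto intro: polys_intros\<close>)

text \<open>Multiplication by q only has to be checked on the spanning monomials. Source and target
  sets may differ, because the lemma also serves to pass from a spanning set to an independent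
  subset.\<close>

lemma span_mod_closedI:
  assumes B: "finite B" "U \<subseteq> V" "q \<in> polys V" and p: "p \<in> span_mod U B"
    and base: "\<And>m. m \<in> B \<Longrightarrow> q * Poly_Mapping.single m 1 \<in> span_mod U C"
  shows "q * p \<in> span_mod U C"
proof -
  obtain a where a: "p \<in> polys V" "\<And>m. m \<in> B \<Longrightarrow> a m \<in> polys U"
    "p - (\<Sum>m\<in>B. a m * Poly_Mapping.single m 1) \<in> M" by (rule span_modE[OF p]) (rule that)
  have "(\<Sum>m\<in>B. a m * (q * Poly_Mapping.single m 1)) \<in> span_mod U C"
    by (intro span_mod_sum, rule span_mod_mult[OF B(2)]) (use a(2) base in auto)
  then show ?thesis
  proof (rule span_mod_cong)
    show "q * p \<in> polys V" using B(3) a(1) by (rule polys_closed)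
    show "q * p - (\<Sum>m\<in>B. a m * (q * Poly_Mapping.single m 1)) \<in> M"
      using M_mult[OF B(3) a(3)] by (simp add: right_diff_distrib sum_distrib_left mult.left_commute)
  qed
qed

text \<open>A finite substitute for a transcendence basis of the quotient by \<open>M\<close>: the
  empty set qualifies because \<open>M\<close> is proper, and by maximality each variable outside
  \<open>U\<close> is algebraic over \<open>polys U\<close> modulo \<open>M\<close>.\<close>

lemma maximal_independent_vars:
  obtains U where "U \<subseteq> V" "M \<inter> polys U = {0}"
    "\<And>v. v \<in> V - U \<Longrightarrow> \<exists>h. h \<in> M \<and> h \<in> polys (insert v U) \<and> h \<noteq> 0"
proof -
  let ?F = "{U. U \<subseteq> V \<and> M \<inter> polys U = {0}}"
  have "M \<inter> polys {} = {0}"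
  proof (intro equalityI subsetI)
    fix p assume p: "p \<in> M \<inter> polys {}"
    then obtain c where c: "p = const c" using polys_empty by blast
    show "p \<in> {0}"
    proof (cases "c = 0")
      case False
      then have "const (inverse c) * p = 1" unfolding c by (rule const_inverse)
      moreover have "const (inverse c) * p \<in> M" using p by (intro M_mult polys_closed) auto
      ultimately show ?thesis using proper by simp
    qed (simp add: c)
  qed (use M_zero polys_closed(1) in auto)
  then have ne: "?F \<noteq> {}" by blast
  have fin: "finite ?F" using V by simp
  obtain U where U: "U \<in> ?F" and max: "\<forall>W\<in>?F. U \<subseteq> W \<longrightarrow> U = W"
    using finite_has_maximal[OF fin ne] by (elim bexE)
  show thesis
  proof (rule that)
    show sub: "U \<subseteq> V" "M \<inter> polys U = {0}" using U by simp_all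
    fix v assume v: "v \<in> V - U"
    have "insert v U \<notin> ?F" using bspec[OF max, of "insert v U"] v by auto
    then have ne: "M \<inter> polys (insert v U) \<noteq> {0}" using v sub(1) by simp
    have "0 \<in> M \<inter> polys (insert v U)" using M_zero polys_closed(1) by simp
    then obtain h where "h \<in> M \<inter> polys (insert v U)" "h \<noteq> 0" using ne by auto
    then show "\<exists>h. h \<in> M \<and> h \<in> polys (insert v U) \<and> h \<noteq> 0" by auto
  qed
qed

text \<open>\<open>h\<close> is read as a polynomial in v over \<open>polys U\<close>, with leading
  coefficient t. Its degree is positive, for otherwise it would be a nonzero element of
  \<open>M\<close> inside \<open>polys U\<close>.\<close>

lemma algebraic_relation:
  assumes U: "U \<subseteq> V" "M \<inter> polys U = {0}" and v: "v \<in> V - U"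
    and h: "h \<in> M" "h \<in> polys (insert v U)" "h \<noteq> 0"
  obtains k t r where "k > 0" "t \<in> polys U" "t \<noteq> 0" "\<And>i. r i \<in> polys U"
    "t * vertex_var v ^ k + (\<Sum>i<k. r i * vertex_var v ^ i) \<in> M"
proof -
  obtain N where N: "\<And>m. m \<in> Poly_Mapping.keys h \<Longrightarrow> lookup m v \<le> N"
    "\<And>k. k > N \<Longrightarrow> vcoeff v k h = 0" using vcoeff_degree_bound[of h v] by blast
  define k where "k = Max {k. k \<le> N \<and> vcoeff v k h \<noteq> 0}"
  have ne: "{k. k \<le> N \<and> vcoeff v k h \<noteq> 0} \<noteq> {}"
  proof -
    obtain i where "vcoeff v i h \<noteq> 0" using vcoeff_all_zero[of v h] h(3) by auto
    moreover from this have "i \<le> N" using N(2)[of i] by (cases "i \<le> N") auto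
    ultimately show ?thesis by auto
  qed
  have k: "k \<le> N" "vcoeff v k h \<noteq> 0" using Max_in[OF _ ne] unfolding k_def by auto
  have above: "vcoeff v i h = 0" if "i > k" for i
  proof (rule ccontr)
    assume "vcoeff v i h \<noteq> 0"
    moreover from this have "i \<le> N" using N(2) by (meson not_le_imp_less)
    ultimately have "i \<le> k" unfolding k_def by (intro Max_ge) auto
    then show False using that by simp
  qed
  have co: "vcoeff v i h \<in> polys U" for i
    using vcoeff_polys[OF h(2), of v i] v by simp
  have "h = (\<Sum>i\<le>N. vertex_var v ^ i * vcoeff v i h)" by (rule vcoeff_expansion[OF N(1)])
  also have "\<dots> = (\<Sum>i\<le>k. vertex_var v ^ i * vcoeff v i h)"
    using k(1) above by (intro sum.mono_neutral_right) auto
  also have "\<dots> = vcoeff v k h * vertex_var v ^ k + (\<Sum>i<k. vcoeff v i h * vertex_var v ^ i)"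
    by (simp add: lessThan_Suc_atMost[symmetric] mult.commute)
  finally have eq: "h = vcoeff v k h * vertex_var v ^ k + (\<Sum>i<k. vcoeff v i h * vertex_var v ^ i)" .
  have "k > 0"
  proof (rule ccontr)
    assume "\<not> k > 0"
    then have "h = vcoeff v 0 h" using eq by simp
    then have "h \<in> polys U" using co[of 0] by simp
    then show False using h U(2) by blast
  qed
  then show thesis using that[of k "vcoeff v k h" "\<lambda>i. vcoeff v i h"] co k eq h(1) by metis
qed

text \<open>Multiplying a monomial of the box by v either stays in the box or reaches the exponent
  \<open>k v\<close>; in the latter case the factor t permits the use of the algebraic relation. The
  spare factor \<open>s'\<close> makes room for the leading coefficients of the other
  variables.\<close>

lemma monomial_reduction:
  assumes U: "U \<subseteq> V" and v: "v \<in> V - U" and B: "finite B"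
    and Bdef: "B = {m. Poly_Mapping.keys m \<subseteq> V - U \<and> (\<forall>v\<in>V - U. lookup m v < k v)}"
    and t: "t \<in> polys U" and r: "\<And>i. r i \<in> polys U"
    and rel: "t * vertex_var v ^ k v + (\<Sum>i<k v. r i * vertex_var v ^ i) \<in> M"
    and s: "s' \<in> polys U" and m: "m \<in> B"
  shows "(s' * t * vertex_var v) * Poly_Mapping.single m 1 \<in> span_mod U B"
proof (cases "lookup m v + 1 < k v")
  case True
  have eq: "(s' * t * vertex_var v) * Poly_Mapping.single m 1 =
      (s' * t) * Poly_Mapping.single (Poly_Mapping.single v 1 + m) 1"
    by (simp add: vertex_var_def mult.assoc mult_single)
  have mB: "Poly_Mapping.single v 1 + m \<in> B"
    using m v True by (auto simp: Bdef keys_plus_nat lookup_add lookup_single when_def)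
  moreover from this have "Poly_Mapping.keys (Poly_Mapping.single v 1 + m) \<subseteq> V" by (auto simp: Bdef)
  ultimately show ?thesis
    unfolding eq using s t by (intro span_mod_mult U span_mod_base B polys_closed)
next
  case False
  have mk: "lookup m v < k v" "Poly_Mapping.keys m \<subseteq> V - U" using m v by (auto simp: Bdef)
  then have kv: "k v = Suc (lookup m v)" using False by simp
  \<comment> \<open>\<open>m'\<close> is m without its power of v, which is here the largest power
    that the box allows.\<close>
  define m' where "m' = m - Poly_Mapping.single v (lookup m v)"
  have m_eq: "m = Poly_Mapping.single v (lookup m v) + m'"
    unfolding m'_def
    by (rule poly_mapping_eqI) (auto simp: lookup_add lookup_minus lookup_single when_def)
  have m'v: "lookup m' v = 0" unfolding m'_def by (simp add: lookup_minus)
  have m'le: "lookup m' u \<le> lookup m u" for u unfolding m'_def by (simp add: lookup_minus)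
  have m'keys: "Poly_Mapping.keys m' \<subseteq> Poly_Mapping.keys m"
    using m'le by (metis in_keys_iff le_zero_eq subsetI)
  let ?x = "Poly_Mapping.single m' (1::'k)"
  have "vertex_var v ^ lookup m v * ?x = Poly_Mapping.single (Poly_Mapping.single v (lookup m v) + m') 1"
    by (simp add: single_var_power mult_single)
  also have "\<dots> = Poly_Mapping.single m 1" by (simp only: m_eq[symmetric])
  finally have "vertex_var v * Poly_Mapping.single m 1 = vertex_var v ^ k v * ?x"
    by (simp add: kv mult.assoc)
  then have eq: "(s' * t * vertex_var v) * Poly_Mapping.single m 1 = s' * (t * vertex_var v ^ k v) * ?x"
    by (simp add: mult.assoc)
  let ?q = "- (\<Sum>i<k v. r i * vertex_var v ^ i)"
  have Bi: "Poly_Mapping.single v i + m' \<in> B" if "i < k v" for i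
  proof -
    have mB: "\<forall>u\<in>V - U. lookup m u < k u" using m unfolding Bdef by simp
    have "lookup (Poly_Mapping.single v i + m') u < k u" if u: "u \<in> V - U" for u
    proof (cases "u = v")
      case True
      then show ?thesis using \<open>i < k v\<close> m'v by (simp add: lookup_add)
    next
      case False
      then have "lookup (Poly_Mapping.single v i + m') u = lookup m' u"
        by (simp add: lookup_add lookup_single_not_eq)
      also have "\<dots> < k u" using m'le[of u] bspec[OF mB u] by simp
      finally show ?thesis .
    qed
    moreover have "Poly_Mapping.keys (Poly_Mapping.single v i) \<subseteq> {v}" by simp
    then have "Poly_Mapping.keys (Poly_Mapping.single v i + m') \<subseteq> V - U"
      unfolding keys_plus_nat using v mk(2) m'keys by blast
    ultimately show ?thesis unfolding Bdef by simp
  qed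
  have "s' * (\<Sum>i<k v. (- r i) * Poly_Mapping.single (Poly_Mapping.single v i + m') 1) \<in> span_mod U B"
  proof (intro span_mod_mult[OF U s] span_mod_sum)
    fix i assume "i \<in> {..<k v}"
    then have "Poly_Mapping.single v i + m' \<in> B" using Bi by simp
    moreover from this have "Poly_Mapping.keys (Poly_Mapping.single v i + m') \<subseteq> V" by (auto simp: Bdef)
    ultimately show "- r i * Poly_Mapping.single (Poly_Mapping.single v i + m') 1 \<in> span_mod U B"
      using r by (intro span_mod_mult[OF U] span_mod_base B polys_closed)
  qed
  also have "s' * (\<Sum>i<k v. (- r i) * Poly_Mapping.single (Poly_Mapping.single v i + m') 1) = s' * ?q * ?x"
    by (simp add: sum_distrib_right sum_distrib_left sum_negf single_var_power mult_single mult.assoc)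
  finally show ?thesis
  proof (rule span_mod_cong)
    have xV: "?x \<in> polys V" using m'keys mk(2) by (intro polys_single) auto
    have sV: "s' \<in> polys V" "t \<in> polys V" using s t polys_mono[OF U] by auto
    show "(s' * t * vertex_var v) * Poly_Mapping.single m 1 \<in> polys V"
      using sV v mk(2) by (intro polys_closed polys_var polys_single) auto
    have "(s' * ?x) * (t * vertex_var v ^ k v + (\<Sum>i<k v. r i * vertex_var v ^ i)) \<in> M"
      using sV xV rel by (intro M_mult polys_closed)
    then show "(s' * t * vertex_var v) * Poly_Mapping.single m 1 - s' * ?q * ?x \<in> M"
      unfolding eq by (simp add: algebra_simps)
  qed
qed

text \<open>
  With \<open>U\<close> maximal such that \<open>M\<close> meets \<open>polys U\<close> in \<open>0\<close>, all polynomials become, after multiplication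
  by a power of a fixed \<open>s \<in> polys U\<close>, combinations of finitely many monomials over \<open>polys U\<close> modulo
  \<open>M\<close>. If \<open>U\<close> contained a variable \<open>v\<close>, the inverses of all powers of \<open>1 + s * v\<close> would have bounded
  denominators, which is impossible. So the quotient by \<open>M\<close> is finite dimensional.
\<close>

theorem nullstellensatz:
  assumes \<theta>: "\<theta> \<in> polys V"
  obtains c N where "c N \<noteq> 0" "(\<Sum>k\<le>N. const (c k) * \<theta> ^ k) \<in> M"
proof -
  obtain U where U: "U \<subseteq> V" "M \<inter> polys U = {0}"
    and dep: "\<And>v. v \<in> V - U \<Longrightarrow> \<exists>h. h \<in> M \<and> h \<in> polys (insert v U) \<and> h \<noteq> 0"
    using maximal_independent_vars by blast
  have UV: "polys U \<subseteq> polys V" by (rule polys_mono[OF U(1)])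
  have finU: "finite U" using U(1) V by (rule finite_subset)
  have unit_notin: "a \<notin> M" if "a \<in> polys U" "a \<noteq> 0" for a using that U(2) by blast
  define G where "G v k t r \<longleftrightarrow> k > 0 \<and> t \<in> polys U \<and> t \<noteq> 0 \<and> (\<forall>i. r i \<in> polys U) \<and>
      t * vertex_var v ^ k + (\<Sum>i<k. r i * vertex_var v ^ i) \<in> M"
    for v k t and r :: "nat \<Rightarrow> ('v, 'k) vpoly"
  have "\<exists>k t r. G v k t r" if v: "v \<in> V - U" for v
  proof -
    obtain h where h: "h \<in> M" "h \<in> polys (insert v U)" "h \<noteq> 0" using dep[OF v] by blast
    show ?thesis unfolding G_def by (rule algebraic_relation[OF U v h]) blast
  qed
  then obtain k t r where G: "\<And>v. v \<in> V - U \<Longrightarrow> G v (k v) (t v) (r v)" by metis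
  have k: "\<And>v. v \<in> V - U \<Longrightarrow> k v > 0" and t: "\<And>v. v \<in> V - U \<Longrightarrow> t v \<in> polys U"
    "\<And>v. v \<in> V - U \<Longrightarrow> t v \<noteq> 0" and r: "\<And>v i. v \<in> V - U \<Longrightarrow> r v i \<in> polys U"
    and rel: "\<And>v. v \<in> V - U \<Longrightarrow> t v * vertex_var v ^ k v + (\<Sum>i<k v. r v i * vertex_var v ^ i) \<in> M"
    using G unfolding G_def by simp_all
  \<comment> \<open>A common denominator: multiplication by s times any remaining variable preserves
    the span of \<open>B\<close>.\<close>
  define s where "s = (\<Prod>v\<in>V - U. t v)"
  have sU: "s \<in> polys U" unfolding s_def using t by (intro polys_prod)
  have prod_ne: "prod f A \<noteq> 0" if "\<And>i. i \<in> A \<Longrightarrow> f i \<in> polys U \<and> f i \<noteq> 0" "finite A"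
    for f :: "'i \<Rightarrow> ('v, 'k) vpoly" and A
    using that(2,1)
  proof (induction A rule: finite_induct)
    case (insert i A)
    then have "f i * prod f A \<noteq> 0"
      by (intro polys_no_zero_divisors[OF finU] polys_prod) auto
    then show ?case using insert by simp
  qed simp
  have s0: "s \<noteq> 0" unfolding s_def using t V by (intro prod_ne) auto
  define B where "B = {m. Poly_Mapping.keys m \<subseteq> V - U \<and> (\<forall>v\<in>V - U. lookup m v < k v)}"
  have B: "finite B"
  proof (rule finite_subset)
    show "B \<subseteq> exponent_box (V - U) (\<Sum>v\<in>V - U. k v)"
    proof
      fix m assume m: "m \<in> B"
      have "lookup m v \<le> (\<Sum>v\<in>V - U. k v)" if v: "v \<in> V - U" for v
      proof -
        have "lookup m v \<le> k v" using m v unfolding B_def by (auto intro: less_imp_le)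
        also have "\<dots> \<le> (\<Sum>v\<in>V - U. k v)" using v V by (intro member_le_sum) auto
        finally show ?thesis .
      qed
      then show "m \<in> exponent_box (V - U) (\<Sum>v\<in>V - U. k v)"
        using m unfolding B_def exponent_box_def by blast
    qed
  qed (use V in \<open>auto intro: exponent_box_finite\<close>)
  have BV: "Poly_Mapping.keys m \<subseteq> V" if "m \<in> B" for m using that unfolding B_def by blast
  have zeroB: "0 \<in> B" using k unfolding B_def by simp
  have step: "s * vertex_var v * p \<in> span_mod U B" if v: "v \<in> V - U" and p: "p \<in> span_mod U B" for v p
  proof (rule span_mod_closedI[OF B U(1) _ p])
    show "s * vertex_var v \<in> polys V" using sU UV v by (intro polys_closed polys_var) auto
    fix m assume m: "m \<in> B"
    have "s = prod t (V - U - {v}) * t v"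
      unfolding s_def using v V by (subst prod.remove[of _ v]) (auto simp: mult.commute)
    moreover have "prod t (V - U - {v}) \<in> polys U" using t by (intro polys_prod) auto
    ultimately show "s * vertex_var v * Poly_Mapping.single m 1 \<in> span_mod U B"
      using monomial_reduction[OF U(1) v B B_def t(1)[OF v] r[OF v] rel[OF v] _ m] by simp
  qed
  \<comment> \<open>Each factor from outside \<open>U\<close> costs one factor s.\<close>
  have gen: "\<exists>N. s ^ N * p \<in> span_mod U B" if "p \<in> polys V" for p
    using that
  proof (induction rule: polys_induct)
    case one
    have "1 \<in> span_mod U B" using span_mod_base[OF B zeroB] by simp
    then show ?case by (intro exI[of _ 0]) simp
  next
    case (add p q)
    then obtain N1 N2 where N: "s ^ N1 * p \<in> span_mod U B" "s ^ N2 * q \<in> span_mod U B" by blast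
    have "s ^ N2 * (s ^ N1 * p) + s ^ N1 * (s ^ N2 * q) \<in> span_mod U B"
      by (rule span_mod_add[OF span_mod_mult[OF U(1) polys_power[OF sU] N(1)]
            span_mod_mult[OF U(1) polys_power[OF sU] N(2)]])
    then have "s ^ (N1 + N2) * (p + q) \<in> span_mod U B"
      by (simp add: power_add algebra_simps)
    then show ?case by blast
  next
    case (const c p)
    then obtain N where "s ^ N * p \<in> span_mod U B" by blast
    then have "const c * (s ^ N * p) \<in> span_mod U B" by (rule span_mod_mult[OF U(1) polys_closed(3)])
    then show ?case by (intro exI[of _ N]) (simp add: mult.left_commute)
  next
    case (var v p)
    then obtain N where N: "s ^ N * p \<in> span_mod U B" by blast
    show ?case
    proof (cases "v \<in> U")
      case True
      then have "vertex_var v * (s ^ N * p) \<in> span_mod U B"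
        by (rule span_mod_mult[OF U(1) polys_var N])
      then show ?thesis by (intro exI[of _ N]) (simp add: mult.left_commute)
    next
      case False
      then have "s * vertex_var v * (s ^ N * p) \<in> span_mod U B" using step N var(1) by blast
      then show ?thesis by (intro exI[of _ "Suc N"]) (simp add: mult_ac)
    qed
  qed (use span_mod_zero in auto)
  have "U = {}"
  proof (rule ccontr)
    assume "U \<noteq> {}"
    then obtain v0 where v0: "v0 \<in> U" by blast
    \<comment> \<open>Linear independence over \<open>polys U\<close> modulo \<open>M\<close>. The
      maximal independent subset of \<open>B\<close> is taken to contain the exponent 0, that is the
      monomial 1, so that coefficients of 1 can be compared.\<close>
    define indep where "indep C \<longleftrightarrow> (\<forall>a. (\<forall>m\<in>C. a m \<in> polys U) \<longrightarrow>
        (\<Sum>m\<in>C. a m * Poly_Mapping.single m 1) \<in> M \<longrightarrow> (\<forall>m\<in>C. a m = 0))"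
      for C :: "('v \<Rightarrow>\<^sub>0 nat) set"
    let ?F = "{C. C \<subseteq> B \<and> 0 \<in> C \<and> indep C}"
    have "indep {0}" unfolding indep_def using U(2) by auto
    then have "{0} \<in> ?F" using zeroB by simp
    then have ne: "?F \<noteq> {}" by (metis empty_iff)
    have fin: "finite ?F" using B by simp
    obtain C where CF: "C \<in> ?F" and max: "\<forall>D\<in>?F. C \<subseteq> D \<longrightarrow> C = D"
      using finite_has_maximal[OF fin ne] by (elim bexE)
    then have C: "C \<subseteq> B" "0 \<in> C" "indep C" by simp_all
    have finC: "finite C" using C(1) B by (rule finite_subset)
    have "\<exists>e. e \<in> polys U \<and> e \<noteq> 0 \<and> e * Poly_Mapping.single m 1 \<in> span_mod U C" if m: "m \<in> B" for m
    proof (cases "m \<in> C")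
      case True
      then have "1 * Poly_Mapping.single m 1 \<in> span_mod U C"
        using span_mod_base[OF finC True BV[OF m]] by simp
      then show ?thesis using polys_closed(2) by (intro exI[of _ 1]) auto
    next
      case False
      have "\<not> indep (insert m C)"
      proof
        assume "indep (insert m C)"
        then have "insert m C \<in> ?F" using C m by simp
        then have "C = insert m C" using max by (meson subset_insertI)
        then show False using False by blast
      qed
      then obtain a where a: "\<forall>n\<in>insert m C. a n \<in> polys U"
        "(\<Sum>n\<in>insert m C. a n * Poly_Mapping.single n 1) \<in> M" "\<exists>n\<in>insert m C. a n \<noteq> 0"
        unfolding indep_def by blast
      have sum: "a m * Poly_Mapping.single m 1 + (\<Sum>n\<in>C. a n * Poly_Mapping.single n 1) \<in> M"
        using a(2) False finC by simp
      have "a m \<noteq> 0"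
      proof
        assume "a m = 0"
        then have "(\<Sum>n\<in>C. a n * Poly_Mapping.single n 1) \<in> M" using sum by simp
        then have "\<forall>n\<in>C. a n = 0" using C(3) a(1) unfolding indep_def by simp
        then show False using a(3) \<open>a m = 0\<close> by auto
      qed
      moreover have "a m * Poly_Mapping.single m 1 \<in> span_mod U C"
      proof (rule span_modI[where a = "\<lambda>n. - a n"])
        show "a m * Poly_Mapping.single m 1 \<in> polys V"
          using a(1) UV BV[OF m] by (intro polys_closed polys_single) auto
        show "- a n \<in> polys U" if "n \<in> C" for n using a(1) that by (intro polys_closed) auto
        show "a m * Poly_Mapping.single m 1 - (\<Sum>n\<in>C. - a n * Poly_Mapping.single n 1) \<in> M"
          using sum by (simp add: sum_negf)
      qed
      ultimately show ?thesis using a(1) by blast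
    qed
    then obtain e' where e': "\<And>m. m \<in> B \<Longrightarrow> e' m \<in> polys U" "\<And>m. m \<in> B \<Longrightarrow> e' m \<noteq> 0"
      "\<And>m. m \<in> B \<Longrightarrow> e' m * Poly_Mapping.single m 1 \<in> span_mod U C" by metis
    \<comment> \<open>A second common denominator, for rewriting \<open>B\<close> in terms of
      \<open>C\<close>. It is fixed before the power of 1 + s v is chosen; this is the bound on
      denominators that leads to the contradiction.\<close>
    define e where "e = prod e' B"
    have eU: "e \<in> polys U" unfolding e_def using e' by (intro polys_prod)
    have e0: "e \<noteq> 0" unfolding e_def using e' B by (intro prod_ne) auto
    have e: "e * p \<in> span_mod U C" if "p \<in> span_mod U B" for p
    proof (rule span_mod_closedI[OF B U(1) _ that])
      show "e \<in> polys V" using eU UV by blast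
      fix m assume m: "m \<in> B"
      have "e = prod e' (B - {m}) * e' m"
        unfolding e_def using m B by (subst prod.remove[of _ m]) (auto simp: mult.commute)
      then have "e * Poly_Mapping.single m 1 = prod e' (B - {m}) * (e' m * Poly_Mapping.single m 1)"
        by (simp add: mult.assoc)
      also have "\<dots> \<in> span_mod U C" 
        by (rule span_mod_mult[OF U(1) polys_prod e'(3)[OF m]]) (use e'(1) in auto)
      finally show "e * Poly_Mapping.single m 1 \<in> span_mod U C" .
    qed
    let ?p = "1 + s * vertex_var v0"
    have pU: "?p \<in> polys U" using sU v0 by (intro polys_intros)
    note bound = bounded_power_divisor[OF finU v0 eU e0 sU s0]
    obtain j where j: "\<And>N a. e * s ^ N \<noteq> ?p ^ j * a" using bound(2) by blast
    have pjU: "?p ^ j \<in> polys U" using pU by (rule polys_power)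
    have "?p ^ j \<noteq> 0" using prod_ne[of "{..<j}" "\<lambda>_. ?p"] pU bound(1) by simp
    then have "?p ^ j \<notin> M" using unit_notin pjU by blast
    then obtain q where q: "q \<in> polys V" "?p ^ j * q - 1 \<in> M" using inverse_mod pjU UV by blast
    obtain N where "s ^ N * q \<in> span_mod U B" using gen[OF q(1)] by blast
    then have "e * (s ^ N * q) \<in> span_mod U C" by (rule e)
    then obtain a where a: "\<And>m. m \<in> C \<Longrightarrow> a m \<in> polys U"
      "e * (s ^ N * q) - (\<Sum>m\<in>C. a m * Poly_Mapping.single m 1) \<in> M"
      by (rule span_modE) blast
    have esU: "e * s ^ N \<in> polys U" by (rule polys_closed(5)[OF eU polys_power[OF sU]])
    have esV: "e * s ^ N \<in> polys V" "?p ^ j \<in> polys V" using UV esU pjU by blast+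
    \<comment> \<open>The inverse q is eliminated. The result expresses e s^N through
      \<open>C\<close> with all coefficients divisible by the j-th power of 1 + s v, and comparing
      coefficients of the monomial 1 contradicts the choice of j.\<close>
    have "?p ^ j * (e * (s ^ N * q) - (\<Sum>m\<in>C. a m * Poly_Mapping.single m 1)) -
        (e * s ^ N) * (?p ^ j * q - 1) \<in> M"
      by (intro M_diff M_mult a(2) q(2) esV)
    also have "?p ^ j * (e * (s ^ N * q) - (\<Sum>m\<in>C. a m * Poly_Mapping.single m 1)) -
        (e * s ^ N) * (?p ^ j * q - 1) =
        e * s ^ N - ?p ^ j * (\<Sum>m\<in>C. a m * Poly_Mapping.single m 1)"
      by (simp add: algebra_simps)
    also have "\<dots> = (\<Sum>m\<in>C. ((if m = 0 then e * s ^ N else 0) - ?p ^ j * a m) * Poly_Mapping.single m 1)"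
    proof -
      have "(\<Sum>m\<in>C. (if m = 0 then e * s ^ N else 0) * Poly_Mapping.single m 1) =
          (\<Sum>m\<in>C. if m = 0 then e * s ^ N else 0)"
        by (intro sum.cong) auto
      also have "\<dots> = e * s ^ N" using finC C(2) by simp
      finally show ?thesis
        by (simp only: left_diff_distrib sum_subtractf sum_distrib_left mult.assoc)
    qed
    finally have rel: "(\<Sum>m\<in>C. ((if m = 0 then e * s ^ N else 0) - ?p ^ j * a m) *
        Poly_Mapping.single m 1) \<in> M" .
    have "(if m = 0 then e * s ^ N else 0) - ?p ^ j * a m \<in> polys U" if "m \<in> C" for m
      using esU polys_closed(1) by (intro polys_closed(7)[OF _ polys_closed(5)[OF pjU a(1)[OF that]]]) auto
    then have "\<forall>m\<in>C. (if m = 0 then e * s ^ N else 0) - ?p ^ j * a m = 0"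
      using C(3)[unfolded indep_def, THEN spec,
        of "\<lambda>m. (if m = 0 then e * s ^ N else 0) - ?p ^ j * a m"] rel by blast
    then have "e * s ^ N = ?p ^ j * a 0" using C(2) by auto
    then show False using j by blast
  qed
  \<comment> \<open>Without free variables s is a nonzero constant, and the denominators
    disappear.\<close>
  obtain d where d: "s = const d" "d \<noteq> 0"
    using sU s0 polys_empty[of s] unfolding \<open>U = {}\<close> by (metis single_zero)
  have inv_s: "const (inverse d) * s = 1" unfolding d(1) using d(2) by (rule const_inverse)
  let ?W = "(\<lambda>m. Poly_Mapping.single m (1::'k)) ` B"
  have "\<exists>u. u \<in> vpoly_space.span ?W \<and> \<theta> ^ i - u \<in> M" for i
  proof -
    obtain N where N: "s ^ N * \<theta> ^ i \<in> span_mod U B" using gen[OF polys_power[OF \<theta>]] by blast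
    have "const (inverse d) ^ N * (s ^ N * \<theta> ^ i) \<in> span_mod U B"
      by (rule span_mod_mult[OF U(1) polys_power[OF polys_closed(3)] N])
    moreover have "const (inverse d) ^ N * (s ^ N * \<theta> ^ i) = \<theta> ^ i"
      by (simp add: mult.assoc[symmetric] power_mult_distrib[symmetric] inv_s)
    ultimately have "\<theta> ^ i \<in> span_mod U B" by simp
    then obtain a where a: "\<And>m. m \<in> B \<Longrightarrow> a m \<in> polys {}"
      "\<theta> ^ i - (\<Sum>m\<in>B. a m * Poly_Mapping.single m 1) \<in> M"
      unfolding \<open>U = {}\<close> by (rule span_modE) blast
    have "a m * Poly_Mapping.single m 1 \<in> vpoly_space.span ?W" if "m \<in> B" for m
    proof -
      have "a m = const (lookup (a m) 0)" using a(1)[OF that] polys_empty by blast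
      then show ?thesis
        using that vpoly_space.span_scale[OF vpoly_space.span_base, of "Poly_Mapping.single m 1" ?W]
        by (metis imageI)
    qed
    then have "(\<Sum>m\<in>B. a m * Poly_Mapping.single m 1) \<in> vpoly_space.span ?W"
      by (rule vpoly_space.span_sum)
    then show ?thesis using a(2) by blast
  qed
  then obtain u where u: "\<And>i. u i \<in> vpoly_space.span ?W" "\<And>i. \<theta> ^ i - u i \<in> M" by metis
  let ?n = "card ?W"
  have finW: "finite ?W" using B by simp
  \<comment> \<open>The exponents 0 to \<open>card ?W\<close> give one more representative of a
    power of \<theta> than there are spanning elements.\<close>
  obtain c where c: "\<exists>i\<in>{..?n}. c i \<noteq> 0" "(\<Sum>i\<in>{..?n}. const (c i) * u i) = 0"
    by (rule vpoly_linear_relation[of "{..?n}" ?W u, OF _ finW]) (use u in auto)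
  have "(\<Sum>i\<le>?n. const (c i) * (\<theta> ^ i - u i)) \<in> M"
    by (intro M_sum M_mult u polys_closed)
  then have all: "(\<Sum>i\<le>?n. const (c i) * \<theta> ^ i) \<in> M"
    using c(2) by (simp add: right_diff_distrib sum_subtractf)
  \<comment> \<open>The relation is cut at its last nonzero coefficient: a nonzero leading
    coefficient is what regularity of the sequence will need.\<close>
  define N where "N = Max {i. i \<le> ?n \<and> c i \<noteq> 0}"
  have ne: "{i. i \<le> ?n \<and> c i \<noteq> 0} \<noteq> {}" using c(1) by auto
  have N: "N \<le> ?n" "c N \<noteq> 0" using Max_in[OF _ ne] unfolding N_def by auto
  have above: "c i = 0" if "i \<le> ?n" "i > N" for i
  proof (rule ccontr)
    assume "c i \<noteq> 0"
    then have "i \<le> N" unfolding N_def using that(1) by (intro Max_ge) auto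
    then show False using that(2) by simp
  qed
  have "(\<Sum>i\<le>?n. const (c i) * \<theta> ^ i) = (\<Sum>i\<le>N. const (c i) * \<theta> ^ i)"
    using N(1) above by (intro sum.mono_neutral_right) auto
  with all N(2) show thesis by (intro that) auto
qed

end

section \<open>Squarefree monomial ideals\<close>

text \<open>
  A squarefree monomial ideal is encoded by the monotone predicate that recognizes the nonfaces of its
  Stanley-Reisner complex.
\<close>

definition sr_ideal :: "'v set \<Rightarrow> ('v set \<Rightarrow> bool) \<Rightarrow> ('v, 'k::field) vpoly set" where
  "sr_ideal V B = {p \<in> polys V. \<forall>m\<in>Poly_Mapping.keys p. B (Poly_Mapping.keys m)}"

lemma sr_ideal_ideal:
  assumes "mono B"
  shows "ideal (sr_ideal V B :: ('v, 'k::field) vpoly set) (vertex_ring V)"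
  unfolding vertex_ring_ideal_iff
proof (intro conjI ballI)
  show "sr_ideal V B \<subseteq> polys V" "0 \<in> sr_ideal V B" by (auto simp: sr_ideal_def polys_closed)
  show "p + q \<in> sr_ideal V B" if "p \<in> sr_ideal V B" "q \<in> sr_ideal V B" for p q :: "('v, 'k) vpoly"
    using that keys_add[of p q] polys_closed(4)[of p V q] unfolding sr_ideal_def by blast
  show "a * p \<in> sr_ideal V B" if a: "a \<in> polys V" and p: "p \<in> sr_ideal V B" for a p :: "('v, 'k) vpoly"
    unfolding sr_ideal_def
  proof (intro CollectI conjI ballI)
    show "a * p \<in> polys V" using a p by (intro polys_closed) (auto simp: sr_ideal_def)
    fix m assume "m \<in> Poly_Mapping.keys (a * p)"
    then obtain m1 m2 where m: "m = m1 + m2" "m2 \<in> Poly_Mapping.keys p" using keys_mult[of a p] by blast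
    then have "B (Poly_Mapping.keys m2)" using p by (auto simp: sr_ideal_def)
    moreover have "Poly_Mapping.keys m2 \<subseteq> Poly_Mapping.keys m" unfolding m by (simp add: keys_plus_nat)
    ultimately show "B (Poly_Mapping.keys m)" using monoD[OF assms] by (metis le_boolE)
  qed
qed

lemma single_in_sr_ideal:
  assumes "Poly_Mapping.keys m \<subseteq> V" "B (Poly_Mapping.keys m)"
  shows "Poly_Mapping.single m c \<in> sr_ideal V B"
  using assms polys_single[of m V c] by (auto simp: sr_ideal_def)

lemma lookup_single_mult:
  fixes p :: "('v, 'k::field) vpoly"
  shows "lookup (Poly_Mapping.single n 1 * p) (n + m) = lookup p m"
proof (induction p rule: poly_mapping_single_induct)
  case (single k c)
  show ?case by (simp add: mult_single lookup_single when_def)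
qed (simp_all add: lookup_add algebra_simps)

text \<open>Multiplication by x adds x to the support of each monomial and is injective on
  monomials, so no terms cancel.\<close>

lemma sr_ideal_colon:
  fixes p :: "('v, 'k::field) vpoly"
  assumes x: "x \<in> V" and p: "p \<in> polys V"
  shows "vertex_var x * p \<in> sr_ideal V B \<longleftrightarrow> p \<in> sr_ideal V (\<lambda>U. B (insert x U))"
proof -
  let ?e = "Poly_Mapping.single x (1::nat)"
  have xp: "vertex_var x * p \<in> polys V" using x p by (intro polys_closed polys_var)
  have keys_x: "Poly_Mapping.keys (?e + m) = insert x (Poly_Mapping.keys m)" for m
    unfolding keys_plus_nat by simp
  have "Poly_Mapping.keys (vertex_var x * p) = (+) ?e ` Poly_Mapping.keys p"
  proof
    show "Poly_Mapping.keys (vertex_var x * p) \<subseteq> (+) ?e ` Poly_Mapping.keys p"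
      using keys_mult[of "vertex_var x" p] by (fastforce simp: vertex_var_def)
    show "(+) ?e ` Poly_Mapping.keys p \<subseteq> Poly_Mapping.keys (vertex_var x * p)"
      by (auto simp: in_keys_iff vertex_var_def lookup_single_mult[of ?e, simplified])
  qed
  then show ?thesis using xp p by (simp add: sr_ideal_def keys_x del: One_nat_def)
qed

lemma sr_ideal_add_var:
  fixes p :: "('v, 'k::field) vpoly"
  assumes x: "x \<in> V" and B: "mono B" and p: "p \<in> sr_ideal V (\<lambda>U. B U \<or> x \<in> U)"
  shows "\<exists>q\<in>sr_ideal V B. \<exists>a\<in>polys V. p = q + a * vertex_var x"
proof (induction p rule: poly_mapping_single_induct)
  case zero
  then show ?case using vertex_ring_idealD(3)[OF sr_ideal_ideal[OF B]] polys_closed(1)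
    by (intro bexI[of _ 0]) auto
next
  case (add p q)
  then obtain p' q' a b where *: "p' \<in> sr_ideal V B" "a \<in> polys V" "p = p' + a * vertex_var x"
    "q' \<in> sr_ideal V B" "b \<in> polys V" "q = q' + b * vertex_var x" by blast
  have "p + q = (p' + q') + (a + b) * vertex_var x" using * by (simp add: algebra_simps)
  then show ?case
    using vertex_ring_idealD(4)[OF sr_ideal_ideal[OF B] *(1,4)] polys_closed(4)[OF *(2,5)] by blast
next
  case (single m c)
  then have m: "Poly_Mapping.keys m \<subseteq> V" "B (Poly_Mapping.keys m) \<or> x \<in> Poly_Mapping.keys m"
    using p by (auto simp: sr_ideal_def polys_def)
  show ?case
  proof (cases "B (Poly_Mapping.keys m)")
    case True
    then show ?thesis using single_in_sr_ideal[of m V B c] m(1) polys_closed(1)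
      by (intro bexI[of _ "Poly_Mapping.single m c"] bexI[of _ 0]) auto
  next
    case False
    then have x: "x \<in> Poly_Mapping.keys m" using m by blast
    let ?n = "m - Poly_Mapping.single x 1"
    have "?n + Poly_Mapping.single x 1 = m"
      using x by (intro poly_mapping_eqI)
        (auto simp: lookup_add lookup_minus lookup_single when_def in_keys_iff)
    then have "Poly_Mapping.single m c = 0 + Poly_Mapping.single ?n c * vertex_var x"
      by (simp add: vertex_var_def mult_single)
    moreover have "Poly_Mapping.keys ?n \<subseteq> V" using m(1) by (auto simp: in_keys_iff lookup_minus)
    ultimately show ?thesis
      using vertex_ring_idealD(3)[OF sr_ideal_ideal[OF B]] polys_single[of ?n V c] by metis
  qed
qed

text \<open>Turns membership into a condition on supports, so that colons by variables and sums with
  variables become operations on predicates.\<close>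

lemma edge_ideal_eq_sr_ideal:
  assumes "simple_graph V E"
  shows "(edge_ideal V E :: ('v, 'k::field) vpoly set) = sr_ideal V (\<lambda>U. \<exists>e\<in>E. e \<subseteq> U)"
proof -
  interpret S: cring "vertex_ring V :: ('v, 'k) vpoly ring" by (rule vertex_ring_cring)
  let ?G = "{vertex_var u * vertex_var v |u v. {u, v} \<in> E} :: ('v, 'k) vpoly set"
  let ?B = "\<lambda>U. \<exists>e\<in>E. e \<subseteq> U"
  have mono: "mono ?B" by (rule monoI) (auto simp: le_bool_def)
  have edge: "u \<in> V \<and> v \<in> V \<and> u \<noteq> v" if "{u, v} \<in> E" for u v
    using assms that unfolding simple_graph_def by (cases "u = v") auto
  have Gc: "?G \<subseteq> carrier (vertex_ring V)"
    using edge by (auto simp: vertex_ring_simps intro!: polys_closed polys_var)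
  have K: "ideal (edge_ideal V E :: ('v, 'k) vpoly set) (vertex_ring V)"
    unfolding edge_ideal_def by (rule S.genideal_ideal[OF Gc])
  show ?thesis
  proof
    show "(edge_ideal V E :: ('v, 'k) vpoly set) \<subseteq> sr_ideal V ?B"
      unfolding edge_ideal_def
    proof (rule S.genideal_minimal[OF sr_ideal_ideal[OF mono]], clarify)
      fix u v assume uv: "{u, v} \<in> E"
      let ?m = "Poly_Mapping.single u (1::nat) + Poly_Mapping.single v 1"
      have k: "Poly_Mapping.keys ?m = {u, v}" unfolding keys_plus_nat by auto
      have eq: "vertex_var u * vertex_var v = Poly_Mapping.single ?m (1::'k)"
        by (simp add: vertex_var_def mult_single)
      show "vertex_var u * vertex_var v \<in> (sr_ideal V ?B :: ('v, 'k) vpoly set)"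
        unfolding eq
      proof (rule single_in_sr_ideal)
        show "Poly_Mapping.keys ?m \<subseteq> V" unfolding k using edge[OF uv] by simp
        show "\<exists>e\<in>E. e \<subseteq> Poly_Mapping.keys ?m" unfolding k using uv by blast
      qed
    qed
    show "sr_ideal V ?B \<subseteq> (edge_ideal V E :: ('v, 'k) vpoly set)"
    proof
      fix p :: "('v, 'k) vpoly" assume p: "p \<in> sr_ideal V ?B"
      show "p \<in> edge_ideal V E"
      proof (induction p rule: poly_mapping_single_induct)
        case (single m c)
        then obtain e where e: "e \<in> E" "e \<subseteq> Poly_Mapping.keys m" "Poly_Mapping.keys m \<subseteq> V"
          using p by (auto simp: sr_ideal_def polys_def)
        then have "card e = 2" using assms unfolding simple_graph_def by blast
        then obtain u v where uv: "e = {u, v}" "u \<noteq> v" by (metis card_2_iff)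
        let ?n = "m - Poly_Mapping.single u 1 - Poly_Mapping.single v 1"
        have "?n + (Poly_Mapping.single u 1 + Poly_Mapping.single v 1) = m"
          using e uv by (intro poly_mapping_eqI)
            (auto simp: lookup_add lookup_minus lookup_single when_def in_keys_iff)
        then have "Poly_Mapping.single m c = Poly_Mapping.single ?n c * (vertex_var u * vertex_var v)"
          by (simp add: vertex_var_def mult_single)
        moreover have "Poly_Mapping.keys ?n \<subseteq> V" using e(3) by (auto simp: in_keys_iff lookup_minus)
        moreover have "vertex_var u * vertex_var v \<in> (edge_ideal V E :: ('v, 'k) vpoly set)"
          using S.genideal_self[OF Gc] e(1) uv unfolding edge_ideal_def by blast
        ultimately show ?case using vertex_ring_idealD(5)[OF K polys_single] by simp
      qed (use vertex_ring_idealD(3,4)[OF K] in auto)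
    qed
  qed
qed

text \<open>Modulo the variables in \<open>C\<close> every polynomial is congruent to one free of
  them; such polynomials form a domain and meet the ideal only in 0.\<close>

lemma vars_prime:
  assumes "finite V"
  shows "primeideal (sr_ideal V (\<lambda>U. U \<inter> C \<noteq> {}) :: ('v, 'k::field) vpoly set) (vertex_ring V)"
proof -
  let ?J = "sr_ideal V (\<lambda>U. U \<inter> C \<noteq> {}) :: ('v, 'k) vpoly set"
  have mono: "mono (\<lambda>U. U \<inter> C \<noteq> {})" by (rule monoI) (auto simp: le_bool_def)
  note J = sr_ideal_ideal[OF mono, of V, where 'k = 'k] and J' = vertex_ring_idealD[OF sr_ideal_ideal[OF mono, of V, where 'k = 'k]]
  have var: "vertex_var v \<in> ?J" if "v \<in> C \<inter> V" for v
    unfolding vertex_var_def using that by (intro single_in_sr_ideal) auto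
  have J0: "p = 0" if "p \<in> ?J" "p \<in> polys (V - C)" for p
  proof -
    have "m \<notin> Poly_Mapping.keys p" for m using that by (fastforce simp: sr_ideal_def polys_def)
    then show ?thesis by (metis all_not_in_conv keys_eq_empty)
  qed
  show ?thesis
  proof (rule primeidealI[OF J vertex_ring_cring])
    have "(1 :: ('v, 'k) vpoly) \<notin> ?J" by (simp add: sr_ideal_def)
    then show "carrier (vertex_ring V) \<noteq> ?J" using polys_closed(2) by (auto simp: vertex_ring_simps)
    fix p q assume "p \<in> carrier (vertex_ring V)" "q \<in> carrier (vertex_ring V)"
      "p \<otimes>\<^bsub>vertex_ring V\<^esub> q \<in> ?J"
    then have pq: "p \<in> polys V" "q \<in> polys V" "p * q \<in> ?J" by (simp_all add: vertex_ring_simps)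
    have VC: "V - C \<inter> V = V - C" by blast
    have split: "\<exists>r'\<in>polys (V - C). r - r' \<in> ?J" if "r \<in> polys V" for r
      using polys_mod_vars[OF J, of "C \<inter> V" r] var that by (simp only: VC)
    obtain p' where p': "p' \<in> polys (V - C)" "p - p' \<in> ?J" using split[OF pq(1)] by (elim bexE)
    obtain q' where q': "q' \<in> polys (V - C)" "q - q' \<in> ?J" using split[OF pq(2)] by (elim bexE)
    have V': "p' \<in> polys V" using p'(1) polys_mono[of "V - C" V] by blast
    have "p * q - (q * (p - p') + p' * (q - q')) \<in> ?J"
      by (rule J'(7)[OF pq(3) J'(4)[OF J'(5)[OF pq(2) p'(2)] J'(5)[OF V' q'(2)]]])
    then have "p' * q' \<in> ?J" by (simp add: algebra_simps)
    then have "p' * q' = 0" by (rule J0[OF _ polys_closed(5)[OF p'(1) q'(1)]])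
    moreover have "finite (V - C)" using assms by simp
    ultimately have "p' = 0 \<or> q' = 0" using polys_no_zero_divisors p'(1) q'(1) by metis
    then show "p \<in> ?J \<or> q \<in> ?J" using p'(2) q'(2) by auto
  qed
qed

subsection \<open>Weakly regular sequences modulo an ideal\<close>

definition seq_ideal :: "'v set \<Rightarrow> ('v, 'k::field) vpoly set \<Rightarrow> (nat \<Rightarrow> ('v, 'k) vpoly) \<Rightarrow> nat \<Rightarrow>
    ('v, 'k) vpoly set" where
  "seq_ideal V J g i = Idl\<^bsub>vertex_ring V\<^esub> (J \<union> g ` {..<i})"

text \<open>Properness is left out because it depends on the chosen polynomials f_i; it is supplied
  in the local ring, where the sequence lies in the maximal ideal.\<close>

definition weakly_regular :: "'v set \<Rightarrow> ('v, 'k::field) vpoly set \<Rightarrow> (nat \<Rightarrow> ('v, 'k) vpoly) \<Rightarrow> nat \<Rightarrow>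
    bool" where
  "weakly_regular V J g n \<longleftrightarrow>
    (\<forall>i<n. \<forall>a\<in>polys V. g i * a \<in> seq_ideal V J g i \<longrightarrow> a \<in> seq_ideal V J g i)"

context
  fixes V :: "'v set" and g :: "nat \<Rightarrow> ('v, 'k::field) vpoly" and n :: nat
  assumes g: "\<And>i. i < n \<Longrightarrow> g i \<in> polys V"
begin

interpretation S: cring "vertex_ring V :: ('v, 'k) vpoly ring" by (rule vertex_ring_cring)

lemma seq_gens:
  assumes "ideal J (vertex_ring V)" "i \<le> n"
  shows "J \<union> g ` {..<i} \<subseteq> carrier (vertex_ring V)"
  using vertex_ring_idealD(1)[OF assms(1)] g assms(2) by (auto simp: vertex_ring_simps)

lemma seq_ideal_ideal:
  assumes "ideal J (vertex_ring V)" "i \<le> n"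
  shows "ideal (seq_ideal V J g i) (vertex_ring V)"
  unfolding seq_ideal_def by (rule S.genideal_ideal[OF seq_gens[OF assms]])

lemma seq_ideal_superset:
  assumes "ideal J (vertex_ring V)" "i \<le> n"
  shows "J \<subseteq> seq_ideal V J g i" "k < i \<Longrightarrow> g k \<in> seq_ideal V J g i"
  using S.genideal_self[OF seq_gens[OF assms]] unfolding seq_ideal_def by auto

lemma seq_ideal_minimal:
  assumes "ideal K (vertex_ring V)" "J \<subseteq> K" "\<And>k. k < i \<Longrightarrow> g k \<in> K"
  shows "seq_ideal V J g i \<subseteq> K"
  unfolding seq_ideal_def using assms by (intro S.genideal_minimal) auto

lemma seq_ideal_mono:
  assumes "ideal K (vertex_ring V)" "J \<subseteq> K" "i \<le> n"
  shows "seq_ideal V J g i \<subseteq> seq_ideal V K g i"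
  using assms seq_ideal_superset[OF assms(1,3)]
  by (intro seq_ideal_minimal seq_ideal_ideal) auto

lemma seq_ideal_zero: "ideal J (vertex_ring V) \<Longrightarrow> seq_ideal V J g 0 = J"
  using seq_ideal_minimal[of J J 0] seq_ideal_superset[of J 0] by auto

lemma seq_ideal_Suc:
  assumes "ideal J (vertex_ring V)" "Suc i \<le> n"
  shows "p \<in> seq_ideal V J g (Suc i) \<longleftrightarrow> (\<exists>h\<in>seq_ideal V J g i. \<exists>a\<in>polys V. p = h + a * g i)"
proof -
  have "J \<union> g ` {..<Suc i} = insert (g i) (J \<union> g ` {..<i})" by (auto simp: lessThan_Suc)
  then have "seq_ideal V J g (Suc i) = S.adjoin (seq_ideal V J g i) (g i)"
    unfolding seq_ideal_def using seq_gens[OF assms(1), of i] g[of i] assms(2)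
    by (simp add: S.Idl_insert vertex_ring_simps)
  then show ?thesis by (auto simp: S.adjoin_def vertex_ring_simps)
qed

context
  fixes J Jc Js :: "('v, 'k) vpoly set" and x :: "('v, 'k) vpoly"
  assumes J: "ideal J (vertex_ring V)" and Jc: "ideal Jc (vertex_ring V)"
    and Js: "ideal Js (vertex_ring V)" and x: "x \<in> polys V"
    and colon: "\<And>p. p \<in> polys V \<Longrightarrow> p \<in> Jc \<longleftrightarrow> x * p \<in> J"
    and sum: "\<And>p. p \<in> Js \<Longrightarrow> \<exists>h\<in>J. \<exists>a\<in>polys V. p = h + a * x"
    and sub: "J \<subseteq> Js" "x \<in> Js"
    and reg1: "weakly_regular V Jc g n" and reg2: "weakly_regular V Js g n"
begin

lemma seq_ideal_sum:
  assumes "i \<le> n" "p \<in> seq_ideal V Js g i"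
  obtains h a where "h \<in> seq_ideal V J g i" "a \<in> polys V" "p = h + a * x"
proof -
  let ?K = "S.adjoin (seq_ideal V J g i) x"
  note I = seq_ideal_ideal[OF J assms(1)]
  have K: "ideal ?K (vertex_ring V)"
    using S.adjoin_ideal[OF I] x by (simp add: vertex_ring_simps)
  have mem: "h + a * x \<in> ?K" if "h \<in> seq_ideal V J g i" "a \<in> polys V" for h a
    unfolding S.adjoin_def using that by (auto simp: vertex_ring_simps)
  have "seq_ideal V Js g i \<subseteq> ?K"
  proof (rule seq_ideal_minimal[OF K])
    show "Js \<subseteq> ?K" using sum mem seq_ideal_superset(1)[OF J assms(1)] by blast
    show "g k \<in> ?K" if "k < i" for k
      using mem[OF seq_ideal_superset(2)[OF J assms(1) that] polys_closed(1)] by simp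
  qed
  then have "p \<in> ?K" using assms(2) by blast
  then show thesis using that unfolding S.adjoin_def by (auto simp: vertex_ring_simps)
qed

lemma seq_ideal_colon_mult:
  assumes "i \<le> n" "b \<in> seq_ideal V Jc g i"
  shows "x * b \<in> seq_ideal V J g i"
proof -
  note I = seq_ideal_ideal[OF J assms(1)]
  have K: "ideal (S.colon (seq_ideal V J g i) x) (vertex_ring V)"
    using S.colon_ideal[OF I] x by (simp add: vertex_ring_simps)
  have mem: "p \<in> S.colon (seq_ideal V J g i) x \<longleftrightarrow> p \<in> polys V \<and> x * p \<in> seq_ideal V J g i" for p
    by (simp add: S.colon_def vertex_ring_simps mult.commute)
  have "seq_ideal V Jc g i \<subseteq> S.colon (seq_ideal V J g i) x"
  proof (rule seq_ideal_minimal[OF K])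
    show "Jc \<subseteq> S.colon (seq_ideal V J g i) x"
      using mem colon vertex_ring_idealD(2)[OF Jc] seq_ideal_superset(1)[OF J assms(1)] by blast
    show "g k \<in> S.colon (seq_ideal V J g i) x" if "k < i" for k
      using mem g that assms(1) vertex_ring_idealD(5)[OF I x] seq_ideal_superset(2)[OF J assms(1)] by simp
  qed
  then show ?thesis using assms(2) mem by blast
qed

text \<open>The colon by x commutes with adding members of the sequence. If x c = h + a g_i, then
  g_i a vanishes modulo \<open>seq_ideal V Js g i\<close>, so regularity there gives a = h' + d x.
  Thus x (c - d g_i) lies in \<open>seq_ideal V J g i\<close>, and induction applies to c - d
  g_i.\<close>

lemma seq_ideal_colon:
  assumes "i \<le> n" "c \<in> polys V" "x * c \<in> seq_ideal V J g i"
  shows "c \<in> seq_ideal V Jc g i"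
  using assms
proof (induction i arbitrary: c)
  case 0
  then show ?case using seq_ideal_zero J Jc colon by simp
next
  case (Suc i)
  have i: "i \<le> n" "i < n" using Suc.prems(1) by auto
  note I = vertex_ring_idealD[OF seq_ideal_ideal[OF J i(1)]]
  obtain h a where ha: "h \<in> seq_ideal V J g i" "a \<in> polys V" "x * c = h + a * g i"
    using Suc.prems seq_ideal_Suc[OF J Suc.prems(1)] by blast
  have "x * c \<in> seq_ideal V Js g i"
    using vertex_ring_idealD(5)[OF Js Suc.prems(2) sub(2)] seq_ideal_superset(1)[OF Js i(1)]
    by (auto simp: mult.commute)
  moreover have "h \<in> seq_ideal V Js g i" using seq_ideal_mono[OF Js sub(1) i(1)] ha(1) by blast
  ultimately have "x * c - h \<in> seq_ideal V Js g i"
    by (rule vertex_ring_idealD(7)[OF seq_ideal_ideal[OF Js i(1)]])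
  then have "g i * a \<in> seq_ideal V Js g i" using ha(3) by (simp add: mult.commute)
  then have "a \<in> seq_ideal V Js g i" using reg2 ha(2) i(2) unfolding weakly_regular_def by blast
  then obtain h' d where d: "h' \<in> seq_ideal V J g i" "d \<in> polys V" "a = h' + d * x"
    using seq_ideal_sum[OF i(1)] by blast
  have "x * (c - d * g i) = h + g i * h'" using ha(3) d(3) by (simp add: algebra_simps)
  also have "\<dots> \<in> seq_ideal V J g i" using I(4)[OF ha(1) I(5)[OF g[OF i(2)] d(1)]] .
  finally have "c - d * g i \<in> seq_ideal V Jc g i"
    using d(2) g[OF i(2)] Suc.prems(2) by (intro Suc.IH[OF i(1)] polys_closed)
  moreover have "c = (c - d * g i) + d * g i" by simp
  ultimately show ?case using seq_ideal_Suc[OF Jc Suc.prems(1)] d(2) by blast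
qed

text \<open>Multiplication by x gives an exact sequence with outer terms S/Jc and S/Js and middle
  term S/J. An element killed by g_i in the middle vanishes in the quotient of S/Js, so it is a
  multiple of x, and its cofactor is treated in the quotient of S/Jc.\<close>

theorem weakly_regular_split: "weakly_regular V J g n"
  unfolding weakly_regular_def
proof (intro allI impI ballI)
  fix i a assume i: "i < n" and a: "a \<in> polys V" and ga: "g i * a \<in> seq_ideal V J g i"
  have i': "i \<le> n" using i by simp
  note I = vertex_ring_idealD[OF seq_ideal_ideal[OF J i']]
  have "g i * a \<in> seq_ideal V Js g i" using seq_ideal_mono[OF Js sub(1) i'] ga by blast
  then have "a \<in> seq_ideal V Js g i" using reg2 a i unfolding weakly_regular_def by blast
  then obtain h b where b: "h \<in> seq_ideal V J g i" "b \<in> polys V" "a = h + b * x"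
    using seq_ideal_sum[OF i'] by blast
  have "g i * a - g i * h \<in> seq_ideal V J g i" using I(7)[OF ga I(5)[OF g[OF i] b(1)]] .
  then have "x * (g i * b) \<in> seq_ideal V J g i" using b(3) by (simp add: algebra_simps)
  then have "g i * b \<in> seq_ideal V Jc g i"
    using polys_closed(5)[OF g[OF i] b(2)] by (intro seq_ideal_colon i')
  then have "b \<in> seq_ideal V Jc g i" using reg1 b(2) i unfolding weakly_regular_def by blast
  then have "x * b \<in> seq_ideal V J g i" by (rule seq_ideal_colon_mult[OF i'])
  then show "a \<in> seq_ideal V J g i" using I(4)[OF b(1)] b(3) by (simp add: mult.commute)
qed

end

end

text \<open>Coefficients and degree bound are kept apart, as the Nullstellensatz delivers them, so
  that the leading coefficient \<open>c N\<close> can be addressed directly.\<close>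

definition uni_eval :: "(nat \<Rightarrow> 'k::field) \<Rightarrow> nat \<Rightarrow> ('v, 'k) vpoly \<Rightarrow> ('v, 'k) vpoly" where
  "uni_eval c N \<theta> = (\<Sum>k\<le>N. const (c k) * \<theta> ^ k)"

lemma uni_eval_polys: "\<theta> \<in> polys V \<Longrightarrow> uni_eval c N \<theta> \<in> polys V"
  unfolding uni_eval_def by (intro polys_sum polys_closed polys_power)

lemma uni_eval_cong_mod:
  assumes J: "ideal J (vertex_ring V)" and "\<theta> \<in> polys V" "\<eta> \<in> polys V" "\<theta> - \<eta> \<in> J"
  shows "uni_eval c N \<theta> - uni_eval c N \<eta> \<in> J"
proof -
  note J' = vertex_ring_idealD[OF J]
  have pow: "\<theta> ^ k - \<eta> ^ k \<in> J" for k
  proof (induction k)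
    case (Suc k)
    have "\<theta> * (\<theta> ^ k - \<eta> ^ k) + \<eta> ^ k * (\<theta> - \<eta>) \<in> J"
      using assms Suc by (intro J'(4) J'(5) polys_power)
    then show ?case by (simp add: algebra_simps)
  qed (simp add: J'(3))
  have "(\<Sum>k\<le>N. const (c k) * (\<theta> ^ k - \<eta> ^ k)) \<in> J"
    by (intro J'(8) J'(5) polys_closed pow)
  then show ?thesis unfolding uni_eval_def by (simp add: right_diff_distrib sum_subtractf)
qed

lemma vcoeff_mult:
  assumes "\<And>k. k > N \<Longrightarrow> vcoeff v k a = 0" "\<And>m. m \<in> Poly_Mapping.keys a \<Longrightarrow> lookup m v \<le> N"
  shows "vcoeff v k (a * p) = (\<Sum>j\<le>N. if j \<le> k then vcoeff v j a * vcoeff v (k - j) p else 0)"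
proof -
  have "a * p = (\<Sum>j\<le>N. vertex_var v ^ j * (vcoeff v j a * p))"
    by (subst vcoeff_expansion[OF assms(2)]) (simp_all add: sum_distrib_right mult.assoc)
  then have "vcoeff v k (a * p) = (\<Sum>j\<le>N. if j \<le> k then vcoeff v (k - j) (vcoeff v j a * p) else 0)"
    by (simp add: vcoeff_sum vcoeff_var_power_mult)
  moreover have "vcoeff v l (vcoeff v j a * p) = vcoeff v j a * vcoeff v l p" for l j
    using vcoeff_polys[of a UNIV v j] by (intro vcoeff_mult_left[of _ "UNIV - {v}"]) (auto simp: polys_def)
  ultimately show ?thesis by (simp cong: if_cong)
qed

text \<open>Because the set is an ideal, \<open>K\<close> is closed under taking coefficients of v
  as soon as its generators have their coefficients in \<open>K\<close>.\<close>

lemma vcoeff_closed_ideal: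
  assumes K: "ideal K (vertex_ring V)"
  shows "ideal {p \<in> K. \<forall>k. vcoeff v k p \<in> K} (vertex_ring V)"
  unfolding vertex_ring_ideal_iff
proof (intro conjI ballI)
  note K' = vertex_ring_idealD[OF K]
  show "{p \<in> K. \<forall>k. vcoeff v k p \<in> K} \<subseteq> polys V" using K'(1) by blast
  show "0 \<in> {p \<in> K. \<forall>k. vcoeff v k p \<in> K}" using K'(3) by (simp add: vcoeff_zero)
  show "p + q \<in> {p \<in> K. \<forall>k. vcoeff v k p \<in> K}"
    if "p \<in> {p \<in> K. \<forall>k. vcoeff v k p \<in> K}" "q \<in> {p \<in> K. \<forall>k. vcoeff v k p \<in> K}" for p q
    using that K'(4) by (simp add: vcoeff_add)
  show "a * p \<in> {p \<in> K. \<forall>k. vcoeff v k p \<in> K}"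
    if a: "a \<in> polys V" and p: "p \<in> {p \<in> K. \<forall>k. vcoeff v k p \<in> K}" for a p
  proof -
    obtain N where N: "\<And>m. m \<in> Poly_Mapping.keys a \<Longrightarrow> lookup m v \<le> N" "\<And>k. k > N \<Longrightarrow> vcoeff v k a = 0"
      by (rule vcoeff_degree_bound[of a v]) blast
    have "vcoeff v j a \<in> polys V" for j
      using vcoeff_polys[OF a, of v j] polys_mono[of "V - {v}" V] by blast
    then have "vcoeff v j a * vcoeff v l p \<in> K" for j l using K'(5) p by simp
    then have "(\<Sum>j\<le>N. if j \<le> k then vcoeff v j a * vcoeff v (k - j) p else 0) \<in> K" for k
      using K'(3) by (intro K'(8)) auto
    then have "vcoeff v k (a * p) \<in> K" for k
      using vcoeff_mult[of N v a k p] N by simp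
    then show ?thesis using K'(5) a p by simp
  qed
qed

text \<open>
  Modulo the variables in \<open>C\<close> the sequence consists of polynomials in distinct variables \<open>z i\<close>;
  comparing coefficients of \<open>z i\<close> from the top shows that \<open>g i\<close> is a nonzerodivisor, because its
  leading coefficient is a unit.
\<close>

lemma weakly_regular_vars:
  fixes V C :: "'v set" and \<theta> :: "nat \<Rightarrow> ('v, 'k::field) vpoly"
  defines "J \<equiv> sr_ideal V (\<lambda>U. U \<inter> C \<noteq> {})"
  assumes z: "\<And>i. i < n \<Longrightarrow> z i \<in> V - C" "inj_on z {..<n}"
    and \<theta>: "\<And>i. i < n \<Longrightarrow> \<theta> i \<in> polys V" "\<And>i. i < n \<Longrightarrow> \<theta> i - vertex_var (z i) \<in> J"
    and c: "\<And>i. i < n \<Longrightarrow> c i (N i) \<noteq> 0"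
  shows "weakly_regular V J (\<lambda>i. uni_eval (c i) (N i) (\<theta> i)) n"
  unfolding weakly_regular_def
proof (intro allI impI ballI)
  let ?g = "\<lambda>i. uni_eval (c i) (N i) (\<theta> i)"
  let ?f = "\<lambda>i. uni_eval (c i) (N i) (vertex_var (z i)) :: ('v, 'k) vpoly"
  have mono: "mono (\<lambda>U. U \<inter> C \<noteq> {})" by (rule monoI) (auto simp: le_bool_def)
  have J: "ideal J (vertex_ring V)" unfolding J_def by (rule sr_ideal_ideal[OF mono])
  note J' = vertex_ring_idealD[OF J]
  have zV: "vertex_var (z i) \<in> polys V" if "i < n" for i using z(1)[OF that] by (intro polys_var) auto
  have gf: "?g i - ?f i \<in> J" if "i < n" for i
    by (rule uni_eval_cong_mod[OF J \<theta>(1)[OF that] zV[OF that] \<theta>(2)[OF that]])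
  have gV: "?g i \<in> polys V" if "i < n" for i using uni_eval_polys[OF \<theta>(1)[OF that]] .
  fix i a assume i: "i < n" and a: "a \<in> polys V" and ga: "?g i * a \<in> seq_ideal V J ?g i"
  let ?H = "seq_ideal V J ?g i"
  let ?v = "z i"
  have i': "i \<le> n" using i by simp
  have H: "ideal ?H (vertex_ring V)" by (rule seq_ideal_ideal[OF gV J i'])
  note H' = vertex_ring_idealD[OF H]
  have JH: "J \<subseteq> ?H" using seq_ideal_superset(1)[OF gV J i'] .
  \<comment> \<open>Removing a power of \<open>z i\<close> from a monomial keeps its variables from
    \<open>C\<close>, since \<open>z i\<close> is not in \<open>C\<close>.\<close>
  have Jv: "vcoeff ?v k p \<in> J" if p: "p \<in> J" for p k
    unfolding J_def sr_ideal_def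
  proof (intro CollectI conjI ballI)
    show "vcoeff ?v k p \<in> polys V"
      using vcoeff_polys[OF J'(2)[OF p], of ?v k] polys_mono[of "V - {?v}" V] by blast
    fix m assume "m \<in> Poly_Mapping.keys (vcoeff ?v k p)"
    then have "m + Poly_Mapping.single ?v k \<in> Poly_Mapping.keys p"
      by (auto simp: in_keys_iff lookup_vcoeff when_def split: if_splits)
    then have "Poly_Mapping.keys (m + Poly_Mapping.single ?v k) \<inter> C \<noteq> {}"
      using p by (auto simp: J_def sr_ideal_def)
    moreover have "Poly_Mapping.keys (Poly_Mapping.single ?v k) \<subseteq> {?v}" by simp
    ultimately show "Poly_Mapping.keys m \<inter> C \<noteq> {}" using z(1)[OF i] unfolding keys_plus_nat by blast
  qed
  have "?H \<subseteq> {p \<in> ?H. \<forall>k. vcoeff ?v k p \<in> ?H}"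
  proof (rule seq_ideal_minimal[OF gV vcoeff_closed_ideal[OF H]])
    show "J \<subseteq> {p \<in> ?H. \<forall>k. vcoeff ?v k p \<in> ?H}" using Jv JH by blast
    fix l assume l: "l < i"
    have gl: "?g l \<in> ?H" using seq_ideal_superset(2)[OF gV J i' l] .
    have "vcoeff ?v k (?g l) \<in> ?H" for k
    proof -
      have d: "?g l - ?f l \<in> J" using gf[of l] l i by simp
      have "?g l - (?g l - ?f l) \<in> ?H" using H'(7)[OF gl] d JH by blast
      then have fl: "?f l \<in> ?H" by simp
      \<comment> \<open>Modulo \<open>J\<close> an earlier member of the sequence is a polynomial in
        another variable, so its coefficients with respect to \<open>z i\<close> are multiples of
        itself.\<close>
      have "z i \<noteq> z l" using inj_onD[OF z(2), of i l] l i by auto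
      then have "vcoeff ?v k (?f l * 1) = ?f l * vcoeff ?v k 1"
        by (intro vcoeff_mult_left[of _ "{z l}"] uni_eval_polys polys_var) auto
      moreover have "vcoeff ?v k 1 * ?f l \<in> ?H"
        using vcoeff_polys[OF polys_closed(2)[of V], of ?v k] polys_mono[of "V - {?v}" V] fl
        by (intro H'(5)) auto
      ultimately have "vcoeff ?v k (?f l) \<in> ?H" by (simp add: mult.commute)
      moreover have "vcoeff ?v k (?g l - ?f l) \<in> ?H" using Jv[OF d] JH by blast
      ultimately have "vcoeff ?v k (?f l) + vcoeff ?v k (?g l - ?f l) \<in> ?H" by (rule H'(4))
      then show ?thesis by (simp add: vcoeff_diff)
    qed
    then show "?g l \<in> {p \<in> ?H. \<forall>k. vcoeff ?v k p \<in> ?H}" using gl by blast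
  qed
  then have Hv: "vcoeff ?v k p \<in> ?H" if "p \<in> ?H" for p k using that by blast
  have "a * (?g i - ?f i) \<in> ?H" using H'(5)[OF a] gf[OF i] JH by blast
  then have "?g i * a - a * (?g i - ?f i) \<in> ?H" by (rule H'(7)[OF ga])
  then have fa: "?f i * a \<in> ?H" by (simp add: algebra_simps)
  have expand: "vcoeff ?v k (?f i * a) = (\<Sum>l\<le>N i. if l \<le> k then const (c i l) * vcoeff ?v (k - l) a else 0)" for k
  proof -
    have "?f i * a = (\<Sum>l\<le>N i. vertex_var ?v ^ l * (const (c i l) * a))"
      unfolding uni_eval_def sum_distrib_right by (intro sum.cong) (simp_all add: mult_ac)
    moreover have "vcoeff ?v j (const (c i l) * a) = const (c i l) * vcoeff ?v j a" for j l
      by (rule vcoeff_mult_left[OF polys_closed(3), of ?v "{}"]) simp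
    ultimately show ?thesis by (simp add: vcoeff_sum vcoeff_var_power_mult cong: if_cong)
  qed
  obtain D where D: "\<And>m. m \<in> Poly_Mapping.keys a \<Longrightarrow> lookup m ?v \<le> D" "\<And>k. k > D \<Longrightarrow> vcoeff ?v k a = 0"
    by (rule vcoeff_degree_bound[of a ?v]) blast
  \<comment> \<open>Descending induction on the exponent: after d steps all coefficients with index
    above D - d are known to lie in \<open>?H\<close>.\<close>
  have "\<forall>k. k + d > D \<longrightarrow> vcoeff ?v k a \<in> ?H" for d
  proof (induction d)
    case 0
    then show ?case using D(2) H'(3) by simp
  next
    case (Suc d)
    show ?case
    proof (intro allI impI)
      fix k assume k: "k + Suc d > D"
      \<comment> \<open>In the coefficient of index k + N i, all terms except the leading one
        involve coefficients of a with index above k.\<close>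
      have "vcoeff ?v (k + N i) (?f i * a) =
          (\<Sum>l\<le>N i. const (c i l) * vcoeff ?v (k + N i - l) a)"
        unfolding expand by (intro sum.cong) auto
      also have "\<dots> = (\<Sum>l<N i. const (c i l) * vcoeff ?v (k + N i - l) a) +
          const (c i (N i)) * vcoeff ?v k a"
        by (simp add: lessThan_Suc_atMost[symmetric])
      finally have eq: "const (c i (N i)) * vcoeff ?v k a = vcoeff ?v (k + N i) (?f i * a) -
          (\<Sum>l<N i. const (c i l) * vcoeff ?v (k + N i - l) a)" by simp
      have "(\<Sum>l<N i. const (c i l) * vcoeff ?v (k + N i - l) a) \<in> ?H"
        using Suc.IH k by (intro H'(8) H'(5) polys_closed) auto
      then have "const (c i (N i)) * vcoeff ?v k a \<in> ?H"
        unfolding eq by (rule H'(7)[OF Hv[OF fa]])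
      then have "const (inverse (c i (N i))) * (const (c i (N i)) * vcoeff ?v k a) \<in> ?H"
        by (rule H'(5)[OF polys_closed(3)])
      then show "vcoeff ?v k a \<in> ?H"
        by (simp only: mult.assoc[symmetric] const_inverse[OF c[OF i]] mult_1_left)
    qed
  qed
  then have all: "vcoeff ?v k a \<in> ?H" for k by (metis add.commute less_add_Suc1 add_Suc_right)
  have "(\<Sum>k\<le>D. vertex_var ?v ^ k * vcoeff ?v k a) \<in> ?H"
    using zV[OF i] by (intro H'(8) H'(5) polys_power all)
  then show "a \<in> ?H" using vcoeff_expansion[of a ?v D] D(1) by simp
qed

section \<open>Vertex covers of graphs with a perfect matching\<close>

lemma minimal_vertex_cover_exists:
  assumes "finite V" "vertex_cover V E C"
  obtains D where "D \<subseteq> C" "minimal_vertex_cover V E D"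
proof -
  have "finite C" using assms by (auto simp: vertex_cover_def intro: finite_subset)
  have "\<exists>D. (D \<subseteq> C \<and> vertex_cover V E D) \<and> (\<forall>D'. D' \<subseteq> C \<and> vertex_cover V E D' \<longrightarrow> card D \<le> card D')"
    using assms(2) by (intro exI[of _ "arg_min card (\<lambda>D. D \<subseteq> C \<and> vertex_cover V E D)"])
      (metis (mono_tags, lifting) arg_min_nat_lemma subset_refl)
  then obtain D where D: "D \<subseteq> C" "vertex_cover V E D"
    "\<And>D'. D' \<subseteq> C \<Longrightarrow> vertex_cover V E D' \<Longrightarrow> card D \<le> card D'" by blast
  have "minimal_vertex_cover V E D"
    unfolding minimal_vertex_cover_def
    using D \<open>finite C\<close> by (metis finite_subset leD psubset_card_mono psubset_imp_subset subset_trans)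
  with D(1) show thesis by (rule that)
qed

lemma minimal_vertex_cover_private_edge:
  assumes "minimal_vertex_cover V E D" "c \<in> D"
  obtains e where "e \<in> E" "e \<inter> D = {c}"
proof -
  have vc: "vertex_cover V E D" using assms(1) by (simp add: minimal_vertex_cover_def)
  have "\<not> vertex_cover V E (D - {c})"
    using assms unfolding minimal_vertex_cover_def by blast
  moreover have "D - {c} \<subseteq> V" using vc by (auto simp: vertex_cover_def)
  ultimately obtain e where e: "e \<in> E" "e \<inter> (D - {c}) = {}"
    unfolding vertex_cover_def by meson
  moreover have "e \<inter> D \<noteq> {}"
    using vc e(1) unfolding vertex_cover_def by (elim conjE) (drule bspec)
  ultimately have "e \<inter> D = {c}" by blast
  with e(1) show thesis by (rule that)
qed

lemma simple_graph_edgeE: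
  assumes "simple_graph V E" "e \<in> E" "v \<in> e"
  obtains u where "e = {u, v}" "u \<noteq> v" "u \<in> V" "v \<in> V"
proof -
  have "card e = 2" "e \<subseteq> V" using assms unfolding simple_graph_def by auto
  then obtain a b where ab: "e = {a, b}" "a \<noteq> b" by (metis card_2_iff)
  show thesis
  proof (cases "v = a")
    case True
    with ab \<open>e \<subseteq> V\<close> show thesis by (intro that[of b]) auto
  next
    case False
    with ab \<open>e \<subseteq> V\<close> assms(3) show thesis by (intro that[of a]) auto
  qed
qed

lemma minimal_vertex_cover_neighbour:
  assumes "simple_graph V E" "minimal_vertex_cover V E D" "c \<in> D"
  obtains u where "{u, c} \<in> E" "u \<notin> D" "u \<in> V"
proof -
  obtain e where e: "e \<in> E" "e \<inter> D = {c}"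
    using minimal_vertex_cover_private_edge[OF assms(2,3)] by blast
  then have "c \<in> e" by blast
  then obtain u where "e = {u, c}" "u \<noteq> c" "u \<in> V"
    using simple_graph_edgeE[OF assms(1) e(1)] by blast
  with e show thesis by (intro that[of u]) auto
qed

section \<open>Minimal covers, pairs and condition (3)\<close>

locale paired_graph =
  fixes V :: "'v set" and E :: "'v set set" and n :: nat and x y :: "nat \<Rightarrow> 'v"
  assumes graph: "simple_graph V E"
    and card_V: "card V = 2 * n"
    and V_eq: "V = x ` {1..n} \<union> y ` {1..n}"
    and disjoint: "x ` {1..n} \<inter> y ` {1..n} = {}"
    and X_cover: "minimal_vertex_cover V E (x ` {1..n})"
    and Y_indep: "independent_set V E (y ` {1..n})"
    and matching: "\<forall>i\<in>{1..n}. {x i, y i} \<in> E"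
    and order: "\<forall>i\<in>{1..n}. \<forall>j\<in>{1..n}. {x i, y j} \<in> E \<longrightarrow> i \<le> j"
begin

definition transitive_pairs :: bool where
  "transitive_pairs \<longleftrightarrow>
    (\<forall>i\<in>{1..n}. \<forall>j\<in>{1..n}. \<forall>k\<in>{1..n}. i \<noteq> j \<and> j \<noteq> k \<and> i \<noteq> k \<longrightarrow>
      (\<forall>z\<in>{x i, y i}. {z, x j} \<in> E \<and> {y j, x k} \<in> E \<longrightarrow> {z, x k} \<in> E)) \<and>
    (\<forall>i\<in>{1..n}. \<forall>j\<in>{1..n}. {x i, y j} \<in> E \<longrightarrow> {x i, x j} \<notin> E)"

lemma transitive_pairsD:
  assumes "transitive_pairs" "i \<in> {1..n}" "j \<in> {1..n}"
  shows "k \<in> {1..n} \<Longrightarrow> i \<noteq> j \<Longrightarrow> j \<noteq> k \<Longrightarrow> i \<noteq> k \<Longrightarrow> z \<in> {x i, y i} \<Longrightarrow> {z, x j} \<in> E \<Longrightarrow>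
      {y j, x k} \<in> E \<Longrightarrow> {z, x k} \<in> E"
    and "{x i, y j} \<in> E \<Longrightarrow> {x i, x j} \<notin> E"
  using assms(1)[unfolded transitive_pairs_def, THEN conjunct1, rule_format, OF assms(2,3)]
    assms(1)[unfolded transitive_pairs_def, THEN conjunct2, rule_format, OF assms(2,3)] by simp_all

lemma finite_V: "finite V"
  using graph unfolding simple_graph_def by simp

lemma card_xy: "card (x ` {1..n}) = n" "card (y ` {1..n}) = n"
proof -
  have "card (x ` {1..n}) + card (y ` {1..n}) = 2 * n"
    using card_V V_eq disjoint by (metis card_Un_disjoint finite_atLeastAtMost finite_imageI)
  moreover have "card (x ` {1..n}) \<le> n" "card (y ` {1..n}) \<le> n"
    using card_image_le[of "{1..n}"] by auto
  ultimately show "card (x ` {1..n}) = n" "card (y ` {1..n}) = n" by auto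
qed

lemma inj_x: "inj_on x {1..n}" and inj_y: "inj_on y {1..n}"
  using card_xy by (auto intro: eq_card_imp_inj_on)

lemma x_eq_iff: "i \<in> {1..n} \<Longrightarrow> j \<in> {1..n} \<Longrightarrow> x i = x j \<longleftrightarrow> i = j"
  using inj_x by (auto dest: inj_onD)

lemma y_eq_iff: "i \<in> {1..n} \<Longrightarrow> j \<in> {1..n} \<Longrightarrow> y i = y j \<longleftrightarrow> i = j"
  using inj_y by (auto dest: inj_onD)

lemma x_neq_y: "i \<in> {1..n} \<Longrightarrow> j \<in> {1..n} \<Longrightarrow> x i \<noteq> y j"
  using disjoint by blast

lemma xy_in_V: "i \<in> {1..n} \<Longrightarrow> x i \<in> V" "i \<in> {1..n} \<Longrightarrow> y i \<in> V"
  using V_eq by auto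

lemma V_cases:
  assumes "v \<in> V"
  obtains i where "i \<in> {1..n}" "v = x i" | i where "i \<in> {1..n}" "v = y i"
  using assms V_eq by auto

lemma no_loop: "{v, v} \<notin> E"
  using graph unfolding simple_graph_def by force

lemma edge_in_V: "{u, v} \<in> E \<Longrightarrow> u \<in> V \<and> v \<in> V"
  using graph unfolding simple_graph_def by blast

lemma yy_nonedge: "i \<in> {1..n} \<Longrightarrow> j \<in> {1..n} \<Longrightarrow> {y i, y j} \<notin> E"
  using Y_indep unfolding independent_set_def by blast

lemma edgeE:
  assumes "e \<in> E"
  obtains u v where "e = {u, v}" "{u, v} \<in> E" "u \<in> V" "v \<in> V" "u \<noteq> v"
proof -
  have "card e = 2" using graph assms unfolding simple_graph_def by auto
  then obtain u v where "e = {u, v}" "u \<noteq> v" by (metis card_2_iff)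
  with assms edge_in_V show thesis by (intro that[of u v]) auto
qed

lemma vertex_cover_pair:
  assumes "vertex_cover V E D" "i \<in> {1..n}"
  shows "x i \<in> D \<or> y i \<in> D"
  using assms matching unfolding vertex_cover_def by fastforce

lemma card_eq_pairs:
  assumes "D \<subseteq> V"
  shows "card D = card {i\<in>{1..n}. x i \<in> D} + card {i\<in>{1..n}. y i \<in> D}"
proof -
  have *: "D = x ` {i\<in>{1..n}. x i \<in> D} \<union> y ` {i\<in>{1..n}. y i \<in> D}"
    using assms V_eq by auto
  have "card D = card (x ` {i\<in>{1..n}. x i \<in> D}) + card (y ` {i\<in>{1..n}. y i \<in> D})"
    by (subst *, rule card_Un_disjoint) (use x_neq_y in auto)
  also have "card (x ` {i\<in>{1..n}. x i \<in> D}) = card {i\<in>{1..n}. x i \<in> D}"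
    by (intro card_image inj_on_subset[OF inj_x]) auto
  also have "card (y ` {i\<in>{1..n}. y i \<in> D}) = card {i\<in>{1..n}. y i \<in> D}"
    by (intro card_image inj_on_subset[OF inj_y]) auto
  finally show ?thesis .
qed

lemma pair_sets_sum:
  "card {i\<in>{1..n}. x i \<in> D} + card {i\<in>{1..n}. y i \<in> D} =
    card {i\<in>{1..n}. x i \<in> D \<or> y i \<in> D} + card {i\<in>{1..n}. x i \<in> D \<and> y i \<in> D}"
proof -
  have "{i\<in>{1..n}. x i \<in> D} \<union> {i\<in>{1..n}. y i \<in> D} = {i\<in>{1..n}. x i \<in> D \<or> y i \<in> D}"
    "{i\<in>{1..n}. x i \<in> D} \<inter> {i\<in>{1..n}. y i \<in> D} = {i\<in>{1..n}. x i \<in> D \<and> y i \<in> D}" by auto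
  then show ?thesis using card_Un_Int[of "{i\<in>{1..n}. x i \<in> D}" "{i\<in>{1..n}. y i \<in> D}"] by simp
qed

text \<open>Every pair is met, so the excess over n counts the pairs contained in \<open>D\<close>.
  Unmixedness thus says that no minimal cover contains a whole pair.\<close>

lemma card_vertex_cover:
  assumes "vertex_cover V E D"
  shows "card D = n + card {i\<in>{1..n}. x i \<in> D \<and> y i \<in> D}"
proof -
  have "{i\<in>{1..n}. x i \<in> D \<or> y i \<in> D} = {1..n}"
    using vertex_cover_pair[OF assms] by blast
  then show ?thesis
    using card_eq_pairs[of D] pair_sets_sum[of D] assms by (simp add: vertex_cover_def)
qed

lemma unmixed_iff_card:
  "unmixed_graph V E \<longleftrightarrow> (\<forall>D. minimal_vertex_cover V E D \<longrightarrow> card D = n)"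
  unfolding unmixed_graph_def using X_cover card_xy by metis

text \<open>If an independent set \<open>A\<close> has neighbours x_j and y_j, its complement
  contains a minimal cover; this cover must contain the whole pair and so has more than n elements.
  A failure of (i) yields \<open>A = {z, x k}\<close>, a failure of (ii) yields
  \<open>A = {x i}\<close>.\<close>

lemma unmixed_imp_transitive_pairs:
  assumes "unmixed_graph V E"
  shows "transitive_pairs"
proof -
  have key: False
    if A: "A \<subseteq> V" "\<And>u v. u \<in> A \<Longrightarrow> v \<in> A \<Longrightarrow> {u, v} \<notin> E"
      and j: "j \<in> {1..n}" and a: "a \<in> A" "{a, x j} \<in> E" and b: "b \<in> A" "{b, y j} \<in> E"
    for A j a b
  proof -
    have "vertex_cover V E (V - A)"
      unfolding vertex_cover_def
    proof (intro conjI ballI)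
      fix e assume "e \<in> E"
      then obtain u v where "e = {u, v}" "{u, v} \<in> E" "u \<in> V" "v \<in> V" "u \<noteq> v" by (rule edgeE)
      then show "e \<inter> (V - A) \<noteq> {}" using A by blast
    qed auto
    then obtain D where D: "D \<subseteq> V - A" "minimal_vertex_cover V E D"
      using minimal_vertex_cover_exists finite_V by metis
    then have vc: "vertex_cover V E D" by (simp add: minimal_vertex_cover_def)
    have meets: "u \<in> D \<or> v \<in> D" if "{u, v} \<in> E" for u v
      using vc that unfolding vertex_cover_def by fastforce
    have "a \<notin> D" "b \<notin> D" using a b D(1) by auto
    then have "x j \<in> D" "y j \<in> D" using meets a b by auto
    then have "j \<in> {i\<in>{1..n}. x i \<in> D \<and> y i \<in> D}" using j by simp
    then have "0 < card {i\<in>{1..n}. x i \<in> D \<and> y i \<in> D}" by (subst card_gt_0_iff) auto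
    moreover have "card D = n" using assms D(2) unmixed_iff_card by blast
    ultimately show False using card_vertex_cover[OF vc] by linarith
  qed
  show ?thesis unfolding transitive_pairs_def
  proof (intro conjI ballI impI notI)
    fix i j k z assume "i \<in> {1..n}" "j \<in> {1..n}" "k \<in> {1..n}" "i \<noteq> j \<and> j \<noteq> k \<and> i \<noteq> k"
      and z: "z \<in> {x i, y i}" "{z, x j} \<in> E \<and> {y j, x k} \<in> E"
    show "{z, x k} \<in> E"
    proof (rule ccontr)
      assume nE: "{z, x k} \<notin> E"
      have sub: "{z, x k} \<subseteq> V" using z edge_in_V by auto
      have indep: "{u, v} \<notin> E" if "u \<in> {z, x k}" "v \<in> {z, x k}" for u v
        using that nE no_loop insert_commute[of z "x k" "{}"] by auto
      have "{x k, y j} \<in> E" using z insert_commute[of "x k" "y j" "{}"] by simp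
      then show False
        using key[OF sub indep \<open>j \<in> {1..n}\<close>, of z "x k"] z by blast
    qed
  next
    fix i j assume "i \<in> {1..n}" "j \<in> {1..n}" "{x i, y j} \<in> E" "{x i, x j} \<in> E"
    then show False using key[of "{x i}" j "x i" "x i"] no_loop xy_in_V by blast
  qed
qed

text \<open>If a minimal cover contains x_i and y_i, each of them has a neighbour outside the cover.
  The neighbour of y_i is some x_k, as no two y's are adjacent, and condition (i) joins the two
  neighbours by an edge that the cover misses.\<close>

lemma transitive_pairs_imp_unmixed:
  assumes "transitive_pairs"
  shows "unmixed_graph V E"
  unfolding unmixed_iff_card
proof (intro allI impI)
  fix D assume D: "minimal_vertex_cover V E D"
  then have vc: "vertex_cover V E D" by (simp add: minimal_vertex_cover_def)
  have "{i\<in>{1..n}. x i \<in> D \<and> y i \<in> D} = {}"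
  proof (rule ccontr)
    assume "{i\<in>{1..n}. x i \<in> D \<and> y i \<in> D} \<noteq> {}"
    then obtain i where i: "i \<in> {1..n}" "x i \<in> D" "y i \<in> D" by auto
    obtain u where u: "{u, x i} \<in> E" "u \<notin> D" "u \<in> V"
      using minimal_vertex_cover_neighbour[OF graph D i(2)] by blast
    obtain w where w: "{w, y i} \<in> E" "w \<notin> D" "w \<in> V"
      using minimal_vertex_cover_neighbour[OF graph D i(3)] by blast
    obtain k where k: "k \<in> {1..n}" "w = x k"
      using w yy_nonedge i by (metis V_cases)
    have "k \<noteq> i" using k w i by auto
    obtain j where j: "j \<in> {1..n}" "u \<in> {x j, y j}" using u V_cases by blast
    have "j \<noteq> i" using j u i by auto
    have uw: "{u, w} \<notin> E" using u w vc by (auto simp: vertex_cover_def)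
    have yx: "{y i, x k} \<in> E" using w k insert_commute[of w "y i" "{}"] by simp
    show False
    proof (cases "j = k")
      \<comment> \<open>Both neighbours come from the same pair. The first is not y_k, whose
        matching edge to x_k would be uncovered; so it is x_k itself, adjacent to both x_i and y_i
        against (ii).\<close>
      case True
      have "{y j, x j} \<in> E" using bspec[OF matching j(1)] by (simp only: insert_commute)
      then have "u = x k" using j(2) uw k(2) True by auto
      then have "{x k, x i} \<in> E" "{x k, y i} \<in> E" using u(1) w(1) k(2) by simp_all
      then show False using transitive_pairsD(2)[OF assms k(1) i(1)] by simp
    next
      case False
      then have "{u, x k} \<in> E"
        using transitive_pairsD(1)[OF assms j(1) i(1) k(1)] j(2) u(1) yx \<open>k \<noteq> i\<close> \<open>j \<noteq> i\<close> by metis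
      then show False using uw k(2) by simp
    qed
  qed
  then show "card D = n" using card_vertex_cover[OF vc] by simp
qed

end

section \<open>The regular sequence\<close>

lemma (in ring) noetherian_Quot:
  assumes noeth: "noetherian_ring R" and cr: "cring R" and I: "ideal I R"
  shows "noetherian_ring (R Quot I)"
proof -
  interpret cring R by fact
  interpret I: ideal I R by fact
  interpret Q: cring "R Quot I" by (rule I.quotient_is_cring[OF cr])
  interpret \<pi>: ring_hom_cring R "R Quot I" "(+>) I" by (rule I.rcos_ring_hom_cring[OF cr])
  show ?thesis
  proof (rule Q.noetherian_ringI)
    fix J assume J: "ideal J (R Quot I)"
    have pre: "\<exists>a\<in>carrier R. q = I +> a" if "q \<in> carrier (R Quot I)" for q
      using that by (auto simp: FactRing_def A_RCOSETS_def' a_r_coset_def)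
    let ?K = "\<lambda>J. {r \<in> carrier R. I +> r \<in> J}"
    obtain A where A: "A \<subseteq> carrier R" "finite A" "?K J = Idl A"
      using noetherian_ring.finetely_gen[OF noeth \<pi>.ring.ideal_vimage[OF J]] by blast
    have AQ: "(+>) I ` A \<subseteq> carrier (R Quot I)" using A(1) \<pi>.hom_closed by blast
    let ?J = "Idl\<^bsub>R Quot I\<^esub> ((+>) I ` A)"
    have J': "ideal ?J (R Quot I)" by (rule Q.genideal_ideal[OF AQ])
    have "A \<subseteq> ?K J" using genideal_self[OF A(1)] A(3) by simp
    then have "(+>) I ` A \<subseteq> J" by blast
    then have sub: "?J \<subseteq> J" by (rule Q.genideal_minimal[OF J])
    have "A \<subseteq> ?K ?J" using Q.genideal_self[OF AQ] A(1) by blast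
    then have "?K J \<subseteq> ?K ?J" unfolding A(3) by (rule genideal_minimal[OF \<pi>.ring.ideal_vimage[OF J']])
    then have "J \<subseteq> ?J" using pre Q.ideal_closed(6)[OF J] by blast
    then show "\<exists>B\<subseteq>carrier (R Quot I). finite B \<and> J = Idl\<^bsub>R Quot I\<^esub> B"
      using sub A(2) AQ by (intro exI[of _ "(+>) I ` A"]) auto
  qed
qed

lemma (in cring) maximal_inverse_mod:
  assumes M: "maximalideal M R" and a: "a \<in> carrier R" "a \<notin> M"
  shows "\<exists>b\<in>carrier R. \<exists>m\<in>M. \<one> = m \<oplus> b \<otimes> a"
proof -
  interpret M: maximalideal M R by fact
  note adj = adjoin_ideal[OF M.is_ideal a(1)]
  have "adjoin M a = M \<or> adjoin M a = carrier R"
    using adjoin_superset(1)[OF M.is_ideal a(1)] ideal_closed(1)[OF adj] by (intro M.I_maximal adj)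
  then have "adjoin M a = carrier R" using adjoin_superset(2)[OF M.is_ideal a(1)] a(2) by blast
  then have "\<one> \<in> adjoin M a" by simp
  then show ?thesis unfolding adjoin_def by blast
qed

lemma vertex_ring_maximal_contraction:
  fixes I :: "('v, 'k::field) vpoly set"
  assumes V: "finite V" and I: "ideal I (vertex_ring V)" and M: "maximalideal M (vertex_ring V Quot I)"
  shows "maximal_poly_ideal V {a \<in> carrier (vertex_ring V). I +>\<^bsub>vertex_ring V\<^esub> a \<in> M}"
proof -
  let ?S = "vertex_ring V :: ('v, 'k) vpoly ring"
  let ?P = "{a \<in> carrier ?S. I +>\<^bsub>?S\<^esub> a \<in> M}"
  interpret S: cring ?S by (rule vertex_ring_cring)
  interpret I: ideal I ?S by fact
  interpret Q: cring "?S Quot I" by (rule I.quotient_is_cring[OF vertex_ring_cring])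
  interpret M: maximalideal M "?S Quot I" by fact
  interpret \<pi>: ring_hom_cring ?S "?S Quot I" "(+>\<^bsub>?S\<^esub>) I" by (rule I.rcos_ring_hom_cring[OF vertex_ring_cring])
  have pre: "\<exists>a\<in>carrier ?S. q = I +>\<^bsub>?S\<^esub> a" if "q \<in> carrier (?S Quot I)" for q
    using that by (auto simp: FactRing_def A_RCOSETS_def' a_r_coset_def)
  have P: "ideal ?P ?S" by (rule \<pi>.ring.ideal_vimage[OF M.is_ideal])
  show ?thesis
  proof (rule maximal_poly_ideal.intro[OF V P])
    have "\<one>\<^bsub>?S Quot I\<^esub> \<notin> M" using M.I_notcarr M.one_imp_carrier by blast
    then have "\<one>\<^bsub>?S\<^esub> \<notin> ?P" using \<pi>.hom_one by simp
    then show "1 \<notin> ?P" by (simp add: vertex_ring_simps)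
    fix a assume "a \<in> polys V" "a \<notin> ?P"
    then have a: "a \<in> carrier ?S" "I +>\<^bsub>?S\<^esub> a \<notin> M" by (auto simp: vertex_ring_simps)
    obtain q m where q: "q \<in> carrier (?S Quot I)" "m \<in> M"
      "\<one>\<^bsub>?S Quot I\<^esub> = m \<oplus>\<^bsub>?S Quot I\<^esub> q \<otimes>\<^bsub>?S Quot I\<^esub> (I +>\<^bsub>?S\<^esub> a)"
      using Q.maximal_inverse_mod[OF M \<pi>.hom_closed[OF a(1)] a(2)] by blast
    obtain b where b: "b \<in> carrier ?S" "q = I +>\<^bsub>?S\<^esub> b" using pre[OF q(1)] by blast
    have ba: "b \<otimes>\<^bsub>?S\<^esub> a \<in> carrier ?S" using a b by simp
    have mc: "m \<in> carrier (?S Quot I)" using q(2) by (rule M.Icarr)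
    have "\<ominus>\<^bsub>?S Quot I\<^esub> m \<in> M" by (rule Q.ideal_closed(5)[OF M.is_ideal q(2)])
    also have "\<ominus>\<^bsub>?S Quot I\<^esub> m = (I +>\<^bsub>?S\<^esub> (b \<otimes>\<^bsub>?S\<^esub> a)) \<ominus>\<^bsub>?S Quot I\<^esub> \<one>\<^bsub>?S Quot I\<^esub>"
    proof -
      have one: "\<one>\<^bsub>?S Quot I\<^esub> = m \<oplus>\<^bsub>?S Quot I\<^esub> (I +>\<^bsub>?S\<^esub> (b \<otimes>\<^bsub>?S\<^esub> a))"
        using q(3) b(2) \<pi>.hom_mult[OF b(1) a(1)] by simp
      have "\<ominus>\<^bsub>?S Quot I\<^esub> m = z \<ominus>\<^bsub>?S Quot I\<^esub> (m \<oplus>\<^bsub>?S Quot I\<^esub> z)"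
        if "z \<in> carrier (?S Quot I)" for z using mc that by algebra
      from this[OF \<pi>.hom_closed[OF ba]] show ?thesis by (simp only: one)
    qed
    also have "\<dots> = I +>\<^bsub>?S\<^esub> (b \<otimes>\<^bsub>?S\<^esub> a \<ominus>\<^bsub>?S\<^esub> \<one>\<^bsub>?S\<^esub>)"
      using ba by (simp add: S.minus_eq Q.minus_eq)
    finally have mem: "b \<otimes>\<^bsub>?S\<^esub> a \<ominus>\<^bsub>?S\<^esub> \<one>\<^bsub>?S\<^esub> \<in> ?P" using ba by simp
    have "b \<otimes>\<^bsub>?S\<^esub> a \<ominus>\<^bsub>?S\<^esub> \<one>\<^bsub>?S\<^esub> = a * b - 1"
      by (simp add: S.minus_eq vertex_ring_simps vertex_ring_uminus[OF polys_closed(2)] mult.commute)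
    then have "a * b - 1 \<in> ?P" using mem by (simp only:)
    moreover have "b \<in> polys V" using b(1) by (simp add: vertex_ring_simps)
    ultimately show "\<exists>b\<in>polys V. a * b - 1 \<in> ?P" by (rule bexI)
  qed
qed

section \<open>Splitting the edge ideal pair by pair\<close>

context paired_graph
begin

lemma vertex_ring_vars_cover:
  fixes P :: "('v, 'k::field) vpoly set"
  assumes P: "primeideal P (vertex_ring V)" and I: "edge_ideal V E \<subseteq> P"
  shows "vertex_cover V E {v \<in> V. vertex_var v \<in> P}"
  unfolding vertex_cover_def
proof (intro conjI ballI)
  fix e assume e: "e \<in> E"
  obtain u v where uv: "e = {u, v}" "{u, v} \<in> E" "u \<in> V" "v \<in> V" using edgeE[OF e] by metis
  interpret S: cring "vertex_ring V :: ('v, 'k) vpoly ring" by (rule vertex_ring_cring)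
  have "vertex_var u * vertex_var v \<in> (edge_ideal V E :: ('v, 'k) vpoly set)"
    unfolding edge_ideal_eq_sr_ideal[OF graph]
  proof -
    let ?m = "Poly_Mapping.single u (1::nat) + Poly_Mapping.single v 1"
    have k: "Poly_Mapping.keys ?m = {u, v}" unfolding keys_plus_nat by auto
    have eq: "vertex_var u * vertex_var v = Poly_Mapping.single ?m (1::'k)"
      by (simp add: vertex_var_def mult_single)
    show "vertex_var u * vertex_var v \<in> (sr_ideal V (\<lambda>U. \<exists>e\<in>E. e \<subseteq> U) :: ('v, 'k) vpoly set)"
      unfolding eq
    proof (rule single_in_sr_ideal)
      show "Poly_Mapping.keys ?m \<subseteq> V" unfolding k using uv by simp
      show "\<exists>e\<in>E. e \<subseteq> Poly_Mapping.keys ?m" unfolding k using uv by blast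
    qed
  qed
  then have "vertex_var u * vertex_var v \<in> P" using I by blast
  then have "vertex_var u \<in> P \<or> vertex_var v \<in> P"
    by (rule prime_vertex_ringD(3)[OF P polys_var[OF uv(3)] polys_var[OF uv(4)]])
  then show "e \<inter> {v \<in> V. vertex_var v \<in> P} \<noteq> {}" using uv by auto
qed auto

text \<open>The index is shifted because sequences start at 0 and pairs at 1. Modulo one vertex of
  the pair this sum becomes the other vertex.\<close>

definition pair_var :: "nat \<Rightarrow> ('v, 'k::field) vpoly" where
  "pair_var i = vertex_var (x (Suc i)) + vertex_var (y (Suc i))"

lemma pair_var_polys: "i < n \<Longrightarrow> pair_var i \<in> polys V"
  unfolding pair_var_def by (intro polys_closed polys_var xy_in_V) auto

text \<open>The nonface predicate of the edge ideal plus the ideal generated by the variables in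
  \<open>C\<close>.\<close>

definition residual :: "'v set \<Rightarrow> 'v set \<Rightarrow> bool" where
  "residual C U \<longleftrightarrow> (\<exists>e\<in>E. e \<subseteq> U) \<or> U \<inter> C \<noteq> {}"

lemma residual_mono: "mono (residual C)"
  by (rule monoI) (unfold residual_def le_bool_def, blast)

text \<open>The set \<open>T\<close> consists of the pairs that are still undecided.\<close>

definition partial_cover :: "nat set \<Rightarrow> 'v set \<Rightarrow> bool" where
  "partial_cover T C \<longleftrightarrow> C \<subseteq> V \<and> T \<subseteq> {1..n} \<and>
    (\<forall>i\<in>T. x i \<notin> C \<and> y i \<notin> C) \<and> (\<forall>i\<in>{1..n} - T. x i \<in> C \<longleftrightarrow> y i \<notin> C) \<and>
    (\<forall>i\<in>{1..n} - T. \<forall>u\<in>{x i, y i}. \<forall>w. u \<notin> C \<longrightarrow> {u, w} \<in> E \<longrightarrow> w \<in> C)"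

text \<open>Setting x_t to zero leaves y_t as the surviving vertex of its pair, and its neighbours
  have to be in the cover. By \<open>order\<close> they are x_l with l <= t; such an l is t itself
  or decided, and a decided x_l outside \<open>C\<close> would have forced its neighbour y_t into
  \<open>C\<close>.\<close>

lemma partial_cover_delete:
  assumes "partial_cover T C" "T \<noteq> {}"
  defines "t \<equiv> Min T"
  shows "partial_cover (T - {t}) (insert (x t) C)"
proof -
  have T: "T \<subseteq> {1..n}" and CV: "C \<subseteq> V" and undec: "\<And>i. i \<in> T \<Longrightarrow> x i \<notin> C \<and> y i \<notin> C"
    and dec: "\<And>i. i \<in> {1..n} - T \<Longrightarrow> x i \<in> C \<longleftrightarrow> y i \<notin> C"
    and nb: "\<And>i u w. i \<in> {1..n} - T \<Longrightarrow> u \<in> {x i, y i} \<Longrightarrow> u \<notin> C \<Longrightarrow> {u, w} \<in> E \<Longrightarrow> w \<in> C"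
    using assms(1) unfolding partial_cover_def by blast+
  have finT: "finite T" using T by (rule finite_subset) simp
  have t: "t \<in> T" "t \<in> {1..n}" unfolding t_def using Min_in[OF finT assms(2)] T by auto
  have tmin: "t \<le> i" if "i \<in> T" for i unfolding t_def using finT that by simp
  have eq: "x i = x t \<longleftrightarrow> i = t" "y i \<noteq> x t" if "i \<in> {1..n}" for i
    using x_eq_iff[OF that t(2)] x_neq_y[OF t(2) that] by auto
  show ?thesis unfolding partial_cover_def
  proof (intro conjI ballI allI impI)
    show "insert (x t) C \<subseteq> V" using CV xy_in_V(1)[OF t(2)] by simp
    show "T - {t} \<subseteq> {1..n}" using T by blast
    show "x i \<notin> insert (x t) C" "y i \<notin> insert (x t) C" if "i \<in> T - {t}" for i
      using that undec[of i] eq[of i] T by auto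
    show "x i \<in> insert (x t) C \<longleftrightarrow> y i \<notin> insert (x t) C" if i: "i \<in> {1..n} - (T - {t})" for i
    proof (cases "i = t")
      case True
      then show ?thesis using undec[OF t(1)] eq(2)[OF t(2)] by simp
    next
      case False
      then show ?thesis using i dec[of i] eq[of i] by simp
    qed
    fix i u w assume i: "i \<in> {1..n} - (T - {t})" and u: "u \<in> {x i, y i}" "u \<notin> insert (x t) C"
      and uw: "{u, w} \<in> E"
    show "w \<in> insert (x t) C"
    proof (cases "i = t")
      case False
      then have "i \<in> {1..n} - T" using i by blast
      then show ?thesis using nb[of i u w] u uw by simp
    next
      case True
      then have uy: "u = y t" using u by auto
      have "w \<in> V" using edge_in_V[OF uw] by simp
      then obtain l where l: "l \<in> {1..n}" "w = x l"
        using uw yy_nonedge[OF t(2)] uy by (metis V_cases)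
      have e: "{x l, y t} \<in> E" using uw uy l(2) by (simp only: insert_commute)
      then have "l \<le> t" using order l(1) t(2) by blast
      show ?thesis
      proof (cases "l \<in> T")
        case True
        then have "l = t" using tmin[of l] \<open>l \<le> t\<close> by simp
        then show ?thesis using l by simp
      next
        case lT: False
        have "x l \<in> C"
        proof (rule ccontr)
          assume "x l \<notin> C"
          then have "y t \<in> C" using nb[of l "x l" "y t"] lT l(1) e by simp
          then show False using undec[OF t(1)] by simp
        qed
        then show ?thesis using l by simp
      qed
    qed
  qed
qed

text \<open>The colon by x_t adds all neighbours of x_t. By (ii) x_t is never adjacent to both
  vertices of a pair, so new pairs are decided consistently; by (i) and (ii) every neighbour of the
  vertex that survives in such a pair is itself adjacent to x_t.\<close>

lemma partial_cover_colon:
  assumes "partial_cover T C" "T \<noteq> {}" and trans: transitive_pairs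
  defines "t \<equiv> Min T"
  defines "D \<equiv> C \<union> {w. {x t, w} \<in> E}"
  shows "partial_cover {i \<in> T. x i \<notin> D \<and> y i \<notin> D} D" "t \<in> T" "y t \<in> D"
proof -
  have T: "T \<subseteq> {1..n}" and CV: "C \<subseteq> V" and undec: "\<And>i. i \<in> T \<Longrightarrow> x i \<notin> C \<and> y i \<notin> C"
    and dec: "\<And>i. i \<in> {1..n} - T \<Longrightarrow> x i \<in> C \<longleftrightarrow> y i \<notin> C"
    and nb: "\<And>i u w. i \<in> {1..n} - T \<Longrightarrow> u \<in> {x i, y i} \<Longrightarrow> u \<notin> C \<Longrightarrow> {u, w} \<in> E \<Longrightarrow> w \<in> C"
    using assms(1) unfolding partial_cover_def by blast+
  have finT: "finite T" using T by (rule finite_subset) simp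
  show tT: "t \<in> T" unfolding t_def using Min_in[OF finT assms(2)] by auto
  have t: "t \<in> {1..n}" using tT T by blast
  have D_iff: "w \<in> D \<longleftrightarrow> w \<in> C \<or> {x t, w} \<in> E" for w by (simp add: D_def)
  show ytD: "y t \<in> D" using D_iff matching t by blast
  have sym: "{a, b} \<in> E \<Longrightarrow> {b, a} \<in> E" for a b by (simp only: insert_commute)
  have tr: "{z, x k} \<in> E" if "i \<in> {1..n}" "j \<in> {1..n}" "k \<in> {1..n}" "i \<noteq> j" "j \<noteq> k" "i \<noteq> k"
    "z \<in> {x i, y i}" "{z, x j} \<in> E" "{y j, x k} \<in> E" for i j k z
    using transitive_pairsD(1)[OF trans that(1-7)] that(8,9) by blast
  have xx: False if "i \<in> {1..n}" "j \<in> {1..n}" "{x i, y j} \<in> E" "{x i, x j} \<in> E" for i j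
    using transitive_pairsD(2)[OF trans that(1-3)] that(4) by blast
  \<comment> \<open>A vertex outside \<open>C\<close> of a decided pair has all its neighbours in
    \<open>C\<close>, and \<open>x t\<close> is not there; hence old decisions do not
    change.\<close>
  have old: "u \<in> D \<longleftrightarrow> u \<in> C" if i: "i \<in> {1..n} - T" and u: "u \<in> {x i, y i}" for i u
  proof
    assume "u \<in> D"
    then have "u \<in> C \<or> {u, x t} \<in> E" using D_iff sym by blast
    then show "u \<in> C" using nb[OF i u, of "x t"] undec[OF tT] by blast
  qed (simp add: D_def)
  show "partial_cover {i \<in> T. x i \<notin> D \<and> y i \<notin> D} D"
    unfolding partial_cover_def
  proof (intro conjI ballI allI impI)
    show "D \<subseteq> V" unfolding D_def using CV edge_in_V by blast
    show "{i \<in> T. x i \<notin> D \<and> y i \<notin> D} \<subseteq> {1..n}" using T by blast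
    show "x i \<notin> D" "y i \<notin> D" if "i \<in> {i \<in> T. x i \<notin> D \<and> y i \<notin> D}" for i using that by blast+
    show "x i \<in> D \<longleftrightarrow> y i \<notin> D" if i: "i \<in> {1..n} - {i \<in> T. x i \<notin> D \<and> y i \<notin> D}" for i
    proof (cases "i \<in> T")
      case True
      have "\<not> (x i \<in> D \<and> y i \<in> D)"
        using D_iff undec[OF True] xx[OF t, of i] i by blast
      then show ?thesis using i True by blast
    next
      case False
      then have "i \<in> {1..n} - T" using i by blast
      then show ?thesis using old[of i "x i"] old[of i "y i"] dec[of i] by blast
    qed
    fix i u w assume i: "i \<in> {1..n} - {i \<in> T. x i \<notin> D \<and> y i \<notin> D}" and u: "u \<in> {x i, y i}" "u \<notin> D"
      and uw: "{u, w} \<in> E"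
    have i1: "i \<in> {1..n}" using i by blast
    have wV: "w \<in> V" using edge_in_V[OF uw] by simp
    show "w \<in> D"
    proof (cases "i \<in> T")
      case False
      then have iT: "i \<in> {1..n} - T" using i by blast
      then have "w \<in> C" using nb[OF iT u(1) _ uw] old[OF iT u(1)] u(2) by blast
      then show ?thesis by (simp add: D_def)
    next
      case iT: True
      show ?thesis
      proof (cases "u = x t")
        case True
        then show ?thesis using uw D_iff by blast
      next
        case ut: False
        have it: "i \<noteq> t"
        proof
          assume "i = t"
          then have "u = y t" using u(1) ut by blast
          then show False using u(2) ytD by blast
        qed
        have "x i \<in> D \<or> y i \<in> D" using i iT by blast
        \<comment> \<open>The pair i has just been decided, and u is its vertex that is not adjacent
          to \<open>x t\<close>.\<close>
        then have alive: "(u = x i \<and> {x t, y i} \<in> E) \<or> (u = y i \<and> {x t, x i} \<in> E)"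
          using u D_iff undec[OF iT] by blast
        then show ?thesis
        proof
          assume A: "u = x i \<and> {x t, y i} \<in> E"
          show ?thesis
          proof (cases rule: V_cases[OF wV])
            case (1 k)
            have "k \<noteq> i" using 1 A uw no_loop by auto
            have "k \<noteq> t"
            proof
              assume "k = t"
              then have "{x t, x i} \<in> E" using 1 A uw sym by blast
              then show False using xx[OF t i1] A by blast
            qed
            have "{x k, x i} \<in> E" using A 1 uw sym by blast
            then have "{x k, x t} \<in> E"
              using tr[of k i t "x k"] 1 i1 t it \<open>k \<noteq> i\<close> \<open>k \<noteq> t\<close> A sym by blast
            then show ?thesis using D_iff sym 1 by blast
          next
            case (2 k)
            show ?thesis
            proof (cases "k = i \<or> k = t")
              case True
              then show ?thesis using 2 A D_iff ytD by blast
            next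
              case False
              have "{y k, x i} \<in> E" using A 2 uw sym by blast
              then have "{y k, x t} \<in> E" using tr[of k i t "y k"] 2 i1 t it False A sym by blast
              then show ?thesis using D_iff sym 2 by blast
            qed
          qed
        next
          assume A: "u = y i \<and> {x t, x i} \<in> E"
          then obtain k where k: "k \<in> {1..n}" "w = x k"
            using wV uw yy_nonedge[OF i1] by (metis V_cases)
          show ?thesis
          proof (cases "k = i")
            case True
            then show ?thesis using k A D_iff by blast
          next
            case False
            have "k \<noteq> t"
            proof
              assume "k = t"
              then have "{x t, y i} \<in> E" using k A uw sym by blast
              then show False using A u(2) D_iff by blast
            qed
            then have "{x t, x k} \<in> E"
              using tr[of t i k "x t"] k i1 t it False A uw by blast
            then show ?thesis using D_iff k by blast
          qed
        qed
      qed
    qed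
  qed
qed

text \<open>The statement ranges over all partial covers because both ideals of the split are again
  residual ideals of such covers, with fewer undecided pairs.\<close>

lemma weakly_regular_residual:
  fixes c :: "nat \<Rightarrow> nat \<Rightarrow> 'k::field"
  assumes trans: transitive_pairs and c: "\<And>i. i < n \<Longrightarrow> c i (N i) \<noteq> 0" and "partial_cover T C"
  shows "weakly_regular V (sr_ideal V (residual C)) (\<lambda>i. uni_eval (c i) (N i) (pair_var i)) n"
  using assms(3)
proof (induction "card T" arbitrary: T C rule: less_induct)
  case less
  let ?g = "\<lambda>i. uni_eval (c i) (N i) (pair_var i)"
  have g: "?g i \<in> polys V" if "i < n" for i by (rule uni_eval_polys[OF pair_var_polys[OF that]])
  have CV: "C \<subseteq> V" and T: "T \<subseteq> {1..n}"
    and dec: "\<And>i. i \<in> {1..n} - T \<Longrightarrow> x i \<in> C \<longleftrightarrow> y i \<notin> C"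
    and undec: "\<And>i. i \<in> T \<Longrightarrow> x i \<notin> C \<and> y i \<notin> C"
    and nb: "\<And>i u w. i \<in> {1..n} - T \<Longrightarrow> u \<in> {x i, y i} \<Longrightarrow> u \<notin> C \<Longrightarrow> {u, w} \<in> E \<Longrightarrow> w \<in> C"
    using less.prems unfolding partial_cover_def by blast+
  have finT: "finite T" using T by (rule finite_subset) simp
  show ?case
  proof (cases "T = {}")
    case True
    \<comment> \<open>With all pairs decided every edge meets \<open>C\<close>, so the residual
      ideal is the prime generated by the variables in \<open>C\<close>.\<close>
    have resid: "residual C U \<longleftrightarrow> U \<inter> C \<noteq> {}" if U: "U \<subseteq> V" for U
    proof -
      have "U \<inter> C \<noteq> {}" if e: "e \<in> E" "e \<subseteq> U" for e
      proof -
        obtain u w where uw: "e = {u, w}" "{u, w} \<in> E" "u \<in> V" "w \<in> V" using edgeE[OF e(1)] by metis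
        obtain i where i: "i \<in> {1..n}" "u \<in> {x i, y i}" using V_cases[OF uw(3)] by blast
        have "u \<in> C \<or> w \<in> C" using nb[OF _ i(2) _ uw(2)] i(1) True by blast
        then show ?thesis using e uw(1) by blast
      qed
      then show ?thesis unfolding residual_def by blast
    qed
    have "(\<forall>m\<in>Poly_Mapping.keys p. residual C (Poly_Mapping.keys m)) \<longleftrightarrow>
        (\<forall>m\<in>Poly_Mapping.keys p. Poly_Mapping.keys m \<inter> C \<noteq> {})"
      if "p \<in> polys V" for p :: "('v, 'k) vpoly"
      using that resid by (simp add: polys_def)
    then have eq: "sr_ideal V (residual C) = (sr_ideal V (\<lambda>U. U \<inter> C \<noteq> {}) :: ('v, 'k) vpoly set)"
      unfolding sr_ideal_def by (intro Collect_cong conj_cong refl) simp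
    define z where "z i = (if x (Suc i) \<in> C then y (Suc i) else x (Suc i))" for i
    show ?thesis
      unfolding eq
    proof (rule weakly_regular_vars[where z = z])
      fix i assume i: "i < n"
      then have i': "Suc i \<in> {1..n}" by simp
      show "z i \<in> V - C" using dec[of "Suc i"] i' True xy_in_V[OF i'] by (auto simp: z_def)
      show "pair_var i \<in> polys V" by (rule pair_var_polys[OF i])
      have d: "x (Suc i) \<in> C \<longleftrightarrow> y (Suc i) \<notin> C" using dec[of "Suc i"] i' True by simp
      have var: "vertex_var v \<in> (sr_ideal V (\<lambda>U. U \<inter> C \<noteq> {}) :: ('v, 'k) vpoly set)" if "v \<in> C" for v
        unfolding vertex_var_def using that CV by (intro single_in_sr_ideal) auto
      show "pair_var i - vertex_var (z i) \<in> (sr_ideal V (\<lambda>U. U \<inter> C \<noteq> {}) :: ('v, 'k) vpoly set)"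
        using d var[of "x (Suc i)"] var[of "y (Suc i)"] by (auto simp: pair_var_def z_def)
      show "c i (N i) \<noteq> 0" by (rule c[OF i])
    next
      show "inj_on z {..<n}"
      proof (rule inj_onI)
        fix i j assume ij: "i \<in> {..<n}" "j \<in> {..<n}" "z i = z j"
        have ij': "Suc i \<in> {1..n}" "Suc j \<in> {1..n}" using ij by auto
        show "i = j"
          using ij(3) x_eq_iff[OF ij'] y_eq_iff[OF ij'] x_neq_y[OF ij'] x_neq_y[OF ij'(2,1)]
          unfolding z_def by (auto split: if_splits)
      qed
    qed
  next
    case ne: False
    define t where "t = Min T"
    define D where "D = C \<union> {w. {x t, w} \<in> E}"
    let ?T1 = "{i \<in> T. x i \<notin> D \<and> y i \<notin> D}"
    note col = partial_cover_colon[OF less.prems ne trans, folded t_def, folded D_def]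
    note del = partial_cover_delete[OF less.prems ne, folded t_def]
    have t: "t \<in> {1..n}" using col(2) T by blast
    have xtV: "x t \<in> V" and xtC: "x t \<notin> C" using xy_in_V(1)[OF t] undec[OF col(2)] by auto
    have "card ?T1 < card T" using finT col(2,3) by (intro psubset_card_mono) auto
    then have reg1: "weakly_regular V (sr_ideal V (residual D)) ?g n" using less.hyps col(1) by blast
    have "card (T - {t}) < card T" using finT col(2) by (intro card_Diff1_less)
    then have reg2: "weakly_regular V (sr_ideal V (residual (insert (x t) C))) ?g n"
      using less.hyps del by blast
    \<comment> \<open>Combinatorial form of the colon: an edge through \<open>x t\<close> inside
      \<open>insert (x t) U\<close> amounts to a neighbour of \<open>x t\<close> in
      \<open>U\<close>.\<close>
    have colon_eq: "residual C (insert (x t) U) \<longleftrightarrow> residual D U" for U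
    proof
      assume "residual C (insert (x t) U)"
      then consider e where "e \<in> E" "e \<subseteq> insert (x t) U" | "insert (x t) U \<inter> C \<noteq> {}"
        unfolding residual_def by blast
      then show "residual D U"
      proof cases
        case (1 e)
        show ?thesis
        proof (cases "x t \<in> e")
          case True
          then obtain w where "e = {w, x t}" "w \<noteq> x t" using simple_graph_edgeE[OF graph 1(1)] by blast
          then have "w \<in> U" "{x t, w} \<in> E" using 1 by (auto simp: insert_commute)
          then show ?thesis unfolding residual_def D_def by blast
        next
          case False
          then show ?thesis using 1 unfolding residual_def by blast
        qed
      next
        case 2
        then show ?thesis using xtC unfolding residual_def D_def by blast
      qed
    next
      assume "residual D U"
      then consider "residual C U" | w where "w \<in> U" "{x t, w} \<in> E" unfolding residual_def D_def by blast
      then show "residual C (insert (x t) U)"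
      proof cases
        case 1
        then show ?thesis using monoD[OF residual_mono[of C], of U "insert (x t) U"]
          by (simp add: subset_insertI)
      next
        case (2 w)
        then have "{x t, w} \<subseteq> insert (x t) U" by simp
        then show ?thesis using 2(2) unfolding residual_def by (intro disjI1 bexI)
      qed
    qed
    have sum_eq: "residual (insert (x t) C) U \<longleftrightarrow> residual C U \<or> x t \<in> U" for U
      by (simp add: residual_def) blast
    show ?thesis
    proof (rule weakly_regular_split[where x = "vertex_var (x t)" and
          Jc = "sr_ideal V (residual D)" and Js = "sr_ideal V (residual (insert (x t) C))"])
      show "p \<in> sr_ideal V (residual D) \<longleftrightarrow> vertex_var (x t) * p \<in> sr_ideal V (residual C)"
        if "p \<in> polys V" for p :: "('v, 'k) vpoly"
        using sr_ideal_colon[OF xtV that, of "residual C"] by (simp add: colon_eq)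
      show "\<exists>h\<in>sr_ideal V (residual C). \<exists>a\<in>polys V. p = h + a * vertex_var (x t)"
        if "p \<in> sr_ideal V (residual (insert (x t) C))" for p :: "('v, 'k) vpoly"
        using sr_ideal_add_var[OF xtV residual_mono[of C], of p] that
        unfolding sr_ideal_def by (simp add: sum_eq)
      show "sr_ideal V (residual C) \<subseteq> sr_ideal V (residual (insert (x t) C))"
        unfolding sr_ideal_def using sum_eq by blast
      show "vertex_var (x t) \<in> sr_ideal V (residual (insert (x t) C))"
        unfolding vertex_var_def using xtV by (intro single_in_sr_ideal) (auto simp: residual_def)
    qed (use reg1 reg2 g xtV in \<open>auto intro: sr_ideal_ideal residual_mono polys_var\<close>)
  qed
qed

end

section \<open>Cohen-Macaulay and unmixed graphs\<close>

lemma sr_ideal_mono: "(\<And>U. B U \<Longrightarrow> B' U) \<Longrightarrow> sr_ideal V B \<subseteq> sr_ideal V B'"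
  unfolding sr_ideal_def by blast

context paired_graph
begin

lemma edge_ideal_ideal: "ideal (edge_ideal V E :: ('v, 'k::field) vpoly set) (vertex_ring V)"
  unfolding edge_ideal_eq_sr_ideal[OF graph]
  by (rule sr_ideal_ideal, rule monoI) (auto simp: le_bool_def)

lemma localization_chain_bound:
  fixes P :: "('v, 'k::field) vpoly set"
  assumes loc: "quotient_localization (vertex_ring V) L \<phi> (edge_ideal V E) P"
    and chain: "prime_chain L k N" and D: "D \<subseteq> V" "\<And>v. v \<in> D \<Longrightarrow> \<phi> (vertex_var v) \<in> N 0"
  shows "k \<le> card (V - D)"
proof -
  interpret quotient_localization "vertex_ring V" L \<phi> "edge_ideal V E" P by fact
  show ?thesis
  proof (rule prime_chain_length_le[OF finite_V prime_chain_contraction(1)[OF chain]])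
    fix v assume v: "v \<in> D"
    then have "vertex_var v \<in> polys V" using D(1) by (intro polys_var) auto
    then show "vertex_var v \<in> contraction (N 0)"
      using D(2)[OF v] by (simp add: contraction_def vertex_ring_simps)
  qed
qed

lemma localization_krull_dim_le:
  fixes P :: "('v, 'k::field) vpoly set"
  assumes loc: "quotient_localization (vertex_ring V) L \<phi> (edge_ideal V E) P"
  shows "krull_dim L \<le> enat n"
  unfolding krull_dim_def
proof (rule Sup_least, clarify)
  interpret quotient_localization "vertex_ring V" L \<phi> "edge_ideal V E" P by fact
  fix k N assume chain: "prime_chain L k N"
  let ?D = "{v \<in> V. vertex_var v \<in> contraction (N 0)}"
  have "primeideal (contraction (N 0)) (vertex_ring V)"
    using prime_chain_contraction(1)[OF chain] by (simp add: prime_chain_def)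
  then have "vertex_cover V E ?D"
    using prime_chain_contraction(2)[OF chain, of 0] by (intro vertex_ring_vars_cover) auto
  then have "n \<le> card ?D" using card_vertex_cover by simp
  moreover have "k \<le> card (V - ?D)"
    by (rule localization_chain_bound[OF loc chain]) (auto simp: contraction_def)
  moreover have "card (V - ?D) = 2 * n - card ?D"
    using finite_V card_V by (subst card_Diff_subset) auto
  ultimately show "enat k \<le> enat n" by simp
qed

lemma partial_cover_initial: "partial_cover {1..n} {}"
  unfolding partial_cover_def by simp

lemma residual_empty: "sr_ideal V (residual {}) = (edge_ideal V E :: ('v, 'k::field) vpoly set)"
  unfolding edge_ideal_eq_sr_ideal[OF graph] sr_ideal_def residual_def by simp

lemma localization_depth_ge:
  fixes P :: "('v, 'k::field) vpoly set"
  assumes trans: transitive_pairs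
    and loc: "quotient_localization (vertex_ring V) L \<phi> (edge_ideal V E) P"
    and max: "maximal_poly_ideal V P"
  shows "enat n \<le> depth L (quotient_localization.extension (vertex_ring V) L \<phi> P P)"
proof -
  interpret quotient_localization "vertex_ring V" L \<phi> "edge_ideal V E" P by fact
  interpret M: maximal_poly_ideal V P by fact
  \<comment> \<open>The Nullstellensatz is applied to each pair sum separately; the polynomial found
    depends on the maximal ideal.\<close>
  have "\<exists>c N. i < n \<longrightarrow> c N \<noteq> 0 \<and> uni_eval c N (pair_var i) \<in> P" for i
  proof (cases "i < n")
    case True
    show ?thesis
      by (rule M.nullstellensatz[OF pair_var_polys[OF True]]) (unfold uni_eval_def, blast)
  qed simp
  then obtain c N where cN: "\<And>i. i < n \<Longrightarrow> c i (N i) \<noteq> 0"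
    "\<And>i. i < n \<Longrightarrow> uni_eval (c i) (N i) (pair_var i) \<in> P" by metis
  let ?g = "\<lambda>i. uni_eval (c i) (N i) (pair_var i)"
  let ?xs = "map ?g [0..<n]"
  have reg: "weakly_regular V (edge_ideal V E) ?g n"
    unfolding residual_empty[symmetric]
    by (rule weakly_regular_residual[OF trans _ partial_cover_initial]) (rule cN(1))
  have tk: "set (take i ?xs) = ?g ` {..<i}" if "i \<le> n" for i
    using that by (simp add: take_map lessThan_atLeast0)
  have "set ?xs \<subseteq> P" using cN(2) by auto
  moreover have "a \<in> Idl\<^bsub>vertex_ring V\<^esub> (edge_ideal V E \<union> set (take i ?xs))"
    if i: "i < length ?xs" and a: "a \<in> carrier (vertex_ring V)"
      and mem: "?xs ! i \<otimes>\<^bsub>vertex_ring V\<^esub> a \<in> Idl\<^bsub>vertex_ring V\<^esub> (edge_ideal V E \<union> set (take i ?xs))" for i a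
  proof -
    have i': "i < n" using i by simp
    have "?g i * a \<in> seq_ideal V (edge_ideal V E) ?g i"
      using mem i' tk[of i] by (simp add: seq_ideal_def vertex_ring_simps)
    then have "a \<in> seq_ideal V (edge_ideal V E) ?g i"
      using reg i' a unfolding weakly_regular_def by (simp add: vertex_ring_simps)
    then show ?thesis using i' tk[of i] by (simp add: seq_ideal_def)
  qed
  ultimately have *: "regular_sequence L (map \<phi> ?xs)" "set (map \<phi> ?xs) \<subseteq> extension P"
    using regular_sequence_localization[of ?xs] by blast+
  have "enat (length (map \<phi> ?xs)) \<le> depth L (extension P)"
    unfolding depth_def by (rule Sup_upper) (use * in blast)
  then show ?thesis by simp
qed

theorem transitive_pairs_imp_cohen_macaulay:
  assumes trans: transitive_pairs
  shows "cohen_macaulay_graph TYPE('k::field) V E"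
proof -
  let ?S = "vertex_ring V :: ('v, 'k) vpoly ring"
  let ?I = "edge_ideal V E :: ('v, 'k) vpoly set"
  have ringS: "ring ?S" using vertex_ring_cring by (rule cring.axioms)
  note I = edge_ideal_ideal[where 'k = 'k]
  have Q: "cring (?S Quot ?I)" by (rule ideal.quotient_is_cring[OF I vertex_ring_cring])
  have noethS: "noetherian_ring ?S" by (rule polys_noetherian[OF finite_V])
  have "cohen_macaulay_local (localization (?S Quot ?I) M)" if M: "maximalideal M (?S Quot ?I)" for M
  proof -
    have Mp: "primeideal M (?S Quot ?I)" by (rule cring.maximalideal_prime[OF Q M])
    note loc = quotient_localization_Quot[OF vertex_ring_cring I Mp]
    interpret quotient_localization ?S "localization (?S Quot ?I) M"
      "\<lambda>a. loc_frac (?S Quot ?I) M (?I +>\<^bsub>?S\<^esub> a) \<one>\<^bsub>?S Quot ?I\<^esub>" ?I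
      "{a \<in> carrier ?S. ?I +>\<^bsub>?S\<^esub> a \<in> M}" by (rule loc)
    let ?L = "localization (?S Quot ?I) M"
    let ?P = "{a \<in> carrier ?S. ?I +>\<^bsub>?S\<^esub> a \<in> M}"
    have noeth: "noetherian_ring ?L" by (rule localization_noetherian[OF noethS])
    have "enat n \<le> depth ?L (extension ?P)"
      by (rule localization_depth_ge[OF trans loc vertex_ring_maximal_contraction[OF finite_V I M]])
    moreover have "krull_dim ?L \<le> enat n" by (rule localization_krull_dim_le[OF loc])
    moreover have "depth ?L (extension ?P) \<le> krull_dim ?L"
      by (rule S.depth_le_krull_dim[OF noeth extension_local_ring extension_unit])
    ultimately have "depth ?L (extension ?P) = krull_dim ?L" by simp
    then show ?thesis unfolding cohen_macaulay_local_def using noeth extension_local_ring by blast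
  qed
  then show ?thesis
    unfolding cohen_macaulay_graph_def cohen_macaulay_ring_def
    using Q ring.noetherian_Quot[OF ringS noethS vertex_ring_cring I] by blast
qed

section \<open>The local ring at the irrelevant ideal\<close>

definition irrelevant :: "('v, 'k::field) vpoly set" where
  "irrelevant = {p \<in> polys V. lookup p 0 = 0}"

lemma irrelevant_eq: "irrelevant = sr_ideal V (\<lambda>U. U \<noteq> {})"
  unfolding irrelevant_def sr_ideal_def by (auto simp: in_keys_iff)

lemma irrelevant_ideal: "ideal irrelevant (vertex_ring V)"
  unfolding irrelevant_eq by (rule sr_ideal_ideal, rule monoI) (auto simp: le_bool_def)

lemma edge_ideal_subset_irrelevant: "edge_ideal V E \<subseteq> irrelevant"
proof -
  have "e \<noteq> {}" if "e \<in> E" for e using edgeE[OF that] by blast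
  then show ?thesis unfolding edge_ideal_eq_sr_ideal[OF graph] irrelevant_eq sr_ideal_def by blast
qed

text \<open>The edge ideal lies in the irrelevant ideal, so membership depends only on the coset.
  This identifies the preimage of the maximal ideal of the quotient.\<close>

lemma irrelevant_image:
  fixes a :: "('v, 'k::field) vpoly"
  assumes a: "a \<in> polys V"
  shows "edge_ideal V E +>\<^bsub>vertex_ring V\<^esub> a \<in> (+>\<^bsub>vertex_ring V\<^esub>) (edge_ideal V E) ` irrelevant \<longleftrightarrow>
    a \<in> irrelevant"
proof
  let ?S = "vertex_ring V :: ('v, 'k) vpoly ring"
  let ?I = "edge_ideal V E :: ('v, 'k) vpoly set"
  interpret S: cring ?S by (rule vertex_ring_cring)
  interpret I: ideal ?I ?S by (rule edge_ideal_ideal)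
  note M = vertex_ring_idealD[OF irrelevant_ideal]
  assume "?I +>\<^bsub>?S\<^esub> a \<in> (+>\<^bsub>?S\<^esub>) ?I ` irrelevant"
  then obtain b where b: "b \<in> irrelevant" "?I +>\<^bsub>?S\<^esub> a = ?I +>\<^bsub>?S\<^esub> b" by blast
  have ab: "a \<in> carrier ?S" "b \<in> carrier ?S" using a M(2)[OF b(1)] by (simp_all add: vertex_ring_simps)
  have "a \<ominus>\<^bsub>?S\<^esub> b \<in> ?I" using S.quotient_eq_iff_same_a_r_cos[OF I.is_ideal ab] b(2) by simp
  moreover have "a \<ominus>\<^bsub>?S\<^esub> b = a - b"
    using ab(2) by (simp add: S.minus_eq vertex_ring_uminus vertex_ring_simps)
  ultimately have "a - b \<in> irrelevant" using edge_ideal_subset_irrelevant by auto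
  then have "(a - b) + b \<in> irrelevant" using M(4) b(1) by blast
  then show "a \<in> irrelevant" by simp
qed blast

lemma irrelevant_maximal:
  "maximalideal ((+>\<^bsub>vertex_ring V\<^esub>) (edge_ideal V E) ` irrelevant)
    ((vertex_ring V :: ('v, 'k::field) vpoly ring) Quot edge_ideal V E)"
proof -
  let ?S = "vertex_ring V :: ('v, 'k) vpoly ring"
  let ?I = "edge_ideal V E :: ('v, 'k) vpoly set"
  interpret S: cring ?S by (rule vertex_ring_cring)
  interpret I: ideal ?I ?S by (rule edge_ideal_ideal)
  interpret Q: cring "?S Quot ?I" by (rule I.quotient_is_cring[OF vertex_ring_cring])
  interpret \<pi>: ring_hom_cring ?S "?S Quot ?I" "(+>\<^bsub>?S\<^esub>) ?I" by (rule I.rcos_ring_hom_cring[OF vertex_ring_cring])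
  let ?M = "(+>\<^bsub>?S\<^esub>) ?I ` irrelevant"
  have pre: "\<exists>a\<in>polys V. q = ?I +>\<^bsub>?S\<^esub> a" if "q \<in> carrier (?S Quot ?I)" for q
    using that by (auto simp: FactRing_def A_RCOSETS_def' a_r_coset_def vertex_ring_simps)
  have one: "1 \<notin> (irrelevant :: ('v, 'k) vpoly set)" by (simp add: irrelevant_def)
  show ?thesis
  proof (rule maximalidealI)
    show "ideal ?M (?S Quot ?I)" by (rule S.ring_ideal_imp_quot_ideal[OF I.is_ideal irrelevant_ideal])
    have "?I +>\<^bsub>?S\<^esub> 1 \<notin> ?M" using irrelevant_image[OF polys_closed(2)] one by blast
    moreover have "?I +>\<^bsub>?S\<^esub> 1 \<in> carrier (?S Quot ?I)"
      by (rule \<pi>.hom_closed) (simp add: vertex_ring_simps polys_closed)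
    ultimately show "carrier (?S Quot ?I) \<noteq> ?M" by blast
    fix N assume N: "ideal N (?S Quot ?I)" "?M \<subseteq> N" "N \<subseteq> carrier (?S Quot ?I)"
    show "N = ?M \<or> N = carrier (?S Quot ?I)"
    proof (cases "N = ?M")
      case False
      then obtain q where q: "q \<in> N" "q \<notin> ?M" using N(2) by blast
      then obtain p where p: "p \<in> polys V" "q = ?I +>\<^bsub>?S\<^esub> p" using pre N(3) by blast
      let ?K = "{a \<in> carrier ?S. ?I +>\<^bsub>?S\<^esub> a \<in> N}"
      note K = vertex_ring_idealD[OF \<pi>.ring.ideal_vimage[OF N(1)]]
      \<comment> \<open>A polynomial outside the irrelevant ideal differs from an irrelevant one by
        its nonzero constant term, so this constant lies in the larger ideal.\<close>
      let ?c = "lookup p 0"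
      have c: "?c \<noteq> 0" using q(2) irrelevant_image[OF p(1)] p by (auto simp: irrelevant_def)
      have irr: "p - const ?c \<in> irrelevant"
        using polys_closed(7)[OF p(1) polys_closed(3)] by (simp add: irrelevant_def lookup_minus)
      then have diff: "p - const ?c \<in> ?K"
        using subsetD[OF N(2) imageI[OF irr]] vertex_ring_idealD(2)[OF irrelevant_ideal irr]
        by (simp add: vertex_ring_simps)
      have "p \<in> ?K" using p q(1) by (simp add: vertex_ring_simps)
      then have "p - (p - const ?c) \<in> ?K" by (rule K(7)[OF _ diff])
      then have "const ?c \<in> ?K" by simp
      then have "const (inverse ?c) * const ?c \<in> ?K" by (rule K(5)[OF polys_closed(3)])
      then have "1 \<in> ?K" by (simp only: const_inverse[OF c])
      then have "\<one>\<^bsub>?S Quot ?I\<^esub> \<in> N" using \<pi>.hom_one by (simp add: vertex_ring_simps)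
      then show ?thesis using ideal.one_imp_carrier[OF N(1)] by blast
    qed simp
  qed
qed

text \<open>The chain starts at the prime generated by the x's, which contains the edge ideal
  because they form a cover, and adjoins y_1, ..., y_n one at a time inside the irrelevant
  ideal.\<close>

lemma irrelevant_dim_ge:
  assumes loc: "quotient_localization (vertex_ring V) L \<phi> (edge_ideal V E)
    (irrelevant :: ('v, 'k::field) vpoly set)"
  shows "enat n \<le> krull_dim L"
proof -
  interpret quotient_localization "vertex_ring V" L \<phi> "edge_ideal V E" "irrelevant :: ('v, 'k) vpoly set"
    by fact
  let ?C = "\<lambda>i. x ` {1..n} \<union> y ` {1..i}"
  let ?Q = "\<lambda>i. sr_ideal V (\<lambda>U. U \<inter> ?C i \<noteq> {}) :: ('v, 'k) vpoly set"
  have "?Q i \<subset> ?Q (Suc i)" if i: "i < n" for i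
  proof -
    have sub: "?C i \<subseteq> ?C (Suc i)" by auto
    have "?Q i \<subseteq> ?Q (Suc i)" using sub by (intro sr_ideal_mono) blast
    moreover have "vertex_var (y (Suc i)) \<in> ?Q (Suc i)"
      unfolding vertex_var_def using i xy_in_V(2)[of "Suc i"] by (intro single_in_sr_ideal) auto
    moreover have "y (Suc i) \<notin> ?C i"
    proof
      assume "y (Suc i) \<in> ?C i"
      then consider j where "j \<in> {1..n}" "y (Suc i) = x j" | j where "j \<in> {1..i}" "y (Suc i) = y j" by blast
      then show False
      proof cases
        case (1 j)
        then show ?thesis using x_neq_y[of j "Suc i"] i by simp
      next
        case (2 j)
        then show ?thesis using y_eq_iff[of "Suc i" j] i by simp
      qed
    qed
    then have "vertex_var (y (Suc i)) \<notin> ?Q i" by (simp add: sr_ideal_def vertex_var_def)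
    ultimately show ?thesis by blast
  qed
  then have chain: "prime_chain (vertex_ring V) n ?Q"
    unfolding prime_chain_def using vars_prime[OF finite_V] by (intro conjI allI impI)
  have meets: "e \<inter> x ` {1..n} \<noteq> {}" if "e \<in> E" for e
    using X_cover that by (simp add: minimal_vertex_cover_def vertex_cover_def)
  have "edge_ideal V E \<subseteq> ?Q 0"
    unfolding edge_ideal_eq_sr_ideal[OF graph] using meets by (intro sr_ideal_mono) blast
  moreover have "?Q n \<subseteq> irrelevant" unfolding irrelevant_eq by (intro sr_ideal_mono) blast
  ultimately have "prime_chain L n (\<lambda>i. extension (?Q i))" by (rule prime_chain_extension[OF chain])
  then show ?thesis unfolding krull_dim_def by (intro Sup_upper) blast
qed

text \<open>Depth is a supremum in \<open>enat\<close> and may be infinite, so attainment is not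
  assumed: for positive m, the number m - 1 lies strictly below the supremum and hence below the
  length of some sequence.\<close>

lemma long_regular_sequence:
  assumes "enat m \<le> depth R M"
  obtains xs where "regular_sequence R xs" "set xs \<subseteq> M" "m \<le> length xs" | "m = 0"
proof (cases m)
  case (Suc k)
  then have "enat k < depth R M" using assms by (metis Suc_ile_eq)
  then obtain xs where "regular_sequence R xs" "set xs \<subseteq> M" "k < length xs"
    unfolding depth_def less_Sup_iff by auto
  then show thesis using that(1) Suc by simp
qed (rule that(2))

lemma keys_sum_single: "finite A \<Longrightarrow> Poly_Mapping.keys (\<Sum>v\<in>A. Poly_Mapping.single v (1::nat)) = A"
  by (induction A rule: finite_induct) (simp_all add: keys_plus_nat)

theorem cohen_macaulay_imp_unmixed:
  assumes cm: "cohen_macaulay_graph TYPE('k::field) V E"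
  shows "unmixed_graph V E"
  unfolding unmixed_iff_card
proof (intro allI impI)
  fix D assume D: "minimal_vertex_cover V E D"
  then have vc: "vertex_cover V E D" by (simp add: minimal_vertex_cover_def)
  then have DV: "D \<subseteq> V" by (simp add: vertex_cover_def)
  let ?S = "vertex_ring V :: ('v, 'k) vpoly ring"
  let ?I = "edge_ideal V E :: ('v, 'k) vpoly set"
  let ?M = "(+>\<^bsub>?S\<^esub>) ?I ` irrelevant"
  let ?L = "localization (?S Quot ?I) ?M"
  let ?\<phi> = "\<lambda>a. loc_frac (?S Quot ?I) ?M (?I +>\<^bsub>?S\<^esub> a) \<one>\<^bsub>?S Quot ?I\<^esub>"
  note I = edge_ideal_ideal[where 'k = 'k]
  have Q: "cring (?S Quot ?I)" by (rule ideal.quotient_is_cring[OF I vertex_ring_cring])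
  have cml: "cohen_macaulay_local ?L"
    using cm irrelevant_maximal unfolding cohen_macaulay_graph_def cohen_macaulay_ring_def by blast
  have Mp: "primeideal ?M (?S Quot ?I)" by (rule cring.maximalideal_prime[OF Q irrelevant_maximal])
  have P: "{a \<in> carrier ?S. ?I +>\<^bsub>?S\<^esub> a \<in> ?M} = irrelevant"
    using irrelevant_image vertex_ring_idealD(1)[OF irrelevant_ideal] by (auto simp: vertex_ring_simps)
  have loc: "quotient_localization ?S ?L ?\<phi> ?I irrelevant"
    using quotient_localization_Quot[OF vertex_ring_cring I Mp] unfolding P .
  interpret quotient_localization ?S ?L ?\<phi> ?I irrelevant by (rule loc)
  obtain N where N: "noetherian_ring ?L" "local_ring ?L N" "depth ?L N = krull_dim ?L"
    using cml unfolding cohen_macaulay_local_def by blast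
  have NP: "N = extension irrelevant"
    using N(2) maximal_eq_extension by (simp add: local_ring_def)
  have units: "a \<in> Units ?L" if "a \<in> carrier ?L - N" for a using that extension_unit unfolding NP by blast
  define m where "m = (\<Sum>v\<in>V - D. Poly_Mapping.single v (1::nat))"
  have keys_m: "Poly_Mapping.keys m = V - D" unfolding m_def using finite_V by (intro keys_sum_single) simp
  let ?f = "Poly_Mapping.single m (1::'k)"
  have f: "?f \<in> polys V" using keys_m by (intro polys_single) auto
  \<comment> \<open>A multiplier u with nonzero constant term keeps the monomial m in the product,
    and the support V - D of m contains no edge.\<close>
  have f0: "?\<phi> ?f \<noteq> \<zero>\<^bsub>?L\<^esub>"
  proof
    assume "?\<phi> ?f = \<zero>\<^bsub>?L\<^esub>"
    then obtain u where u: "u \<in> polys V" "u \<notin> irrelevant" "u * ?f \<in> ?I"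
      using kernel[of ?f] f by (auto simp: vertex_ring_simps)
    have "lookup (?f * u) (m + 0) = lookup u 0" by (rule lookup_single_mult)
    then have "m \<in> Poly_Mapping.keys (u * ?f)"
      using u(1,2) by (simp add: irrelevant_def in_keys_iff mult.commute)
    then obtain e where "e \<in> E" "e \<subseteq> V - D"
      using u(3) keys_m unfolding edge_ideal_eq_sr_ideal[OF graph] sr_ideal_def by auto
    then show False using vc unfolding vertex_cover_def by blast
  qed
  \<comment> \<open>By minimality v has a neighbour outside \<open>D\<close>, and that neighbour
    divides the monomial \<open>?f\<close>.\<close>
  have ann: "?\<phi> (vertex_var v) \<in> S.colon {\<zero>\<^bsub>?L\<^esub>} (?\<phi> ?f)" if v: "v \<in> D" for v
  proof -
    obtain u where u: "{u, v} \<in> E" "u \<notin> D" "u \<in> V"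
      using minimal_vertex_cover_neighbour[OF graph D v] .
    have k: "Poly_Mapping.keys (Poly_Mapping.single v (1::nat) + m) = insert v (V - D)"
      unfolding keys_plus_nat keys_m by simp
    have "vertex_var v * ?f = Poly_Mapping.single (Poly_Mapping.single v 1 + m) 1"
      by (simp add: vertex_var_def mult_single)
    also have "\<dots> \<in> ?I"
      unfolding edge_ideal_eq_sr_ideal[OF graph]
    proof (rule single_in_sr_ideal)
      show "Poly_Mapping.keys (Poly_Mapping.single v 1 + m) \<subseteq> V" unfolding k using v DV by blast
      show "\<exists>e\<in>E. e \<subseteq> Poly_Mapping.keys (Poly_Mapping.single v 1 + m)" unfolding k
        using u by (intro bexI[of _ "{u, v}"]) auto
    qed
    finally have "?\<phi> (vertex_var v * ?f) = \<zero>\<^bsub>?L\<^esub>" by (rule kernel_I)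
    moreover have vV: "vertex_var v \<in> carrier ?S" "?f \<in> carrier ?S"
      using v DV f by (auto simp: vertex_ring_simps intro: polys_var)
    ultimately have "?\<phi> (vertex_var v) \<otimes>\<^bsub>?L\<^esub> ?\<phi> ?f = \<zero>\<^bsub>?L\<^esub>"
      using hom_mult[OF vV] by (simp add: vertex_ring_simps)
    then show ?thesis unfolding S.colon_def using hom_closed[OF vV(1)] by simp
  qed
  have fL: "?\<phi> ?f \<in> carrier ?L" using hom_closed f by (simp add: vertex_ring_simps)
  have "enat n \<le> depth ?L N" unfolding N(3) by (rule irrelevant_dim_ge[OF loc])
  then have "n \<le> card (V - D)"
  proof (cases rule: long_regular_sequence)
    case (1 xs)
    obtain C where C: "prime_chain ?L (length xs) C" "S.colon {\<zero>\<^bsub>?L\<^esub>} (?\<phi> ?f) \<subseteq> C 0"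
      by (rule S.regular_sequence_prime_chain[OF N(1,2) units 1(1,2) fL f0])
    have "length xs \<le> card (V - D)"
      using ann C(2) by (intro localization_chain_bound[OF loc C(1) DV]) blast
    then show ?thesis using 1(3) by simp
  qed simp
  moreover have "card (V - D) = 2 * n - card D"
    using finite_V card_V DV by (subst card_Diff_subset) (auto intro: finite_subset)
  moreover have "card D \<le> 2 * n" using card_mono[OF finite_V DV] card_V by simp
  moreover have "n \<le> card D" using card_vertex_cover[OF vc] by simp
  ultimately show "card D = n" by simp
qed

end

theorem theorem0p3:
  fixes V :: "'v set" and E :: "'v set set" and n :: nat and x y :: "nat \<Rightarrow> 'v"
    and X Y :: "'v set"
  assumes graph: "simple_graph V E"
    and card_V: "card V = 2 * n"
    and no_isolated: "\<forall>v\<in>V. \<not> isolated_vertex E v"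
    and height: "ideal_height (vertex_ring V) (edge_ideal V E :: ('v, 'k::field) vpoly set) = enat n"
    and V_eq: "V = X \<union> Y" and disjoint: "X \<inter> Y = {}"
    and X_eq: "X = x ` {1..n}" and Y_eq: "Y = y ` {1..n}"
    and X_cover: "minimal_vertex_cover V E X"
    and Y_indep: "maximal_independent_set V E Y"
    and matching: "\<forall>i\<in>{1..n}. {x i, y i} \<in> E"
    and order: "\<forall>i\<in>{1..n}. \<forall>j\<in>{1..n}. {x i, y j} \<in> E \<longrightarrow> i \<le> j"
  shows "(cohen_macaulay_graph TYPE('k) V E \<longleftrightarrow> unmixed_graph V E) \<and>
    (unmixed_graph V E \<longleftrightarrow>
      (\<forall>i\<in>{1..n}. \<forall>j\<in>{1..n}. \<forall>k\<in>{1..n}. i \<noteq> j \<and> j \<noteq> k \<and> i \<noteq> k \<longrightarrow>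
        (\<forall>z\<in>{x i, y i}. {z, x j} \<in> E \<and> {y j, x k} \<in> E \<longrightarrow> {z, x k} \<in> E)) \<and>
      (\<forall>i\<in>{1..n}. \<forall>j\<in>{1..n}. {x i, y j} \<in> E \<longrightarrow> {x i, x j} \<notin> E))"
proof -
  interpret paired_graph V E n x y
  proof (rule paired_graph.intro)
    show "V = x ` {1..n} \<union> y ` {1..n}" using V_eq unfolding X_eq Y_eq .
    show "x ` {1..n} \<inter> y ` {1..n} = {}" using disjoint unfolding X_eq Y_eq .
    show "minimal_vertex_cover V E (x ` {1..n})" using X_cover unfolding X_eq .
    show "independent_set V E (y ` {1..n})"
      using Y_indep unfolding Y_eq maximal_independent_set_def by (rule conjunct1)
  qed fact+
  have "unmixed_graph V E \<longleftrightarrow> transitive_pairs"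
    using unmixed_imp_transitive_pairs transitive_pairs_imp_unmixed by blast
  moreover have "cohen_macaulay_graph TYPE('k) V E \<longleftrightarrow> unmixed_graph V E"
    using unmixed_imp_transitive_pairs transitive_pairs_imp_cohen_macaulay cohen_macaulay_imp_unmixed
    by blast
  ultimately show ?thesis unfolding transitive_pairs_def by (rule conjI[rotated])
qed

end
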